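(* Let $L(z)$ be an $n\times n$ $L$-operator over $\mathfrak R$, i.e. a matrix satisfying $R(z/w)L^{(1)}(z)L^{(2)}(w)=L^{(2)}(w)L^{(1)}(z)R(z/w)$ with the trigonometric $R$-matrix $R$. Then the functions $I_k(z)=\mathrm{tr}\big(L^{[k]}(z)\big)$ commute with themselves, with each other and with the functions $t_l(w)$ for different values of the parameters: $$I_k(z)I_l(w)=I_l(w)I_k(z),\qquad I_k(z)t_l(w)=t_l(w)I_k(z),$$ for all positive integers $k,l$.
   Context: Let $q$ be a nonzero complex number and $\mathfrak R$ an associative unital, not necessarily commutative, algebra over $\mathbb C$. The trigonometric $R$-matrix is $$R(z)=\frac1{z-1}\Big((qz-q^{-1})\sum_{i=1}^nE_{ii}\otimes E_{ii}+(z-1)\sum_{i\neq j}E_{ii}\otimes E_{jj}+(q-q^{-1})\sum_{i<j}\big(zE_{ij}\otimes E_{ji}+E_{ji}\otimes E_{ij}\big)\Big),$$ with $E_{ij}$ the matrix units of $\mathrm{End}(\mathbb C^n)$. $L(z)=\sum_{ij}L_{ij}(z)E_{ij}$ has entries in $\mathfrak R$ depending on the parameter $z$; for a matrix $X=\sum X_{ij}E_{ij}$ over $\mathfrak R$, $X^{(a)}$ denotes $\sum X_{ij}\,1^{\otimes(a-1)}\otimes E_{ij}\otimes1^{\otimes(k-a)}$ in $\mathfrak R\otimes\mathrm{End}(\mathbb C^n)^{\otimes k}$. For $n\times n$ matrices $A,B$ over $\mathfrak R$ put $(A*_qB)_{ik}=\sum_{j=1}^nq^{\mathrm{sgn}(j-i)}A_{ij}B_{jk}$,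 where $\mathrm{sgn}(r)=1,0,-1$ for $r>0$, $r=0$, $r<0$. Define $L^{[0]}(z)=1$ and $L^{[m]}(z)=L^{[m-1]}(z)*_qL(q^{2(m-1)}z)$ for $m\ge1$. Let $P^q=\sum_{i,j=1}^nq^{\mathrm{sgn}(i-j)}E_{ij}\otimes E_{ji}$; let $\pi_q$ be the representation of $\mathfrak S_k$ on $(\mathbb C^n)^{\otimes k}$ sending the adjacent transposition $(a,a+1)$ to $P^q$ acting in the tensor factors $a,a+1$, and let $A^q_k=\frac1{k!}\sum_{\tau\in\mathfrak S_k}(-1)^{\tau}\pi_q(\tau)$ be the $q$-antisymmetrizer, $(-1)^\tau$ being the sign of $\tau$. With $\mathrm{tr}_{1,\ldots,k}$ the trace over $(\mathbb C^n)^{\otimes k}$, define $t_k(z)=\mathrm{tr}_{1,\ldots,k}\big(A^q_kL^{(1)}(z)L^{(2)}(q^2z)\cdots L^{(k)}(q^{2(k-1)}z)\big)$.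
   Formalization: The identities are stated for nonzero z, w with z/w not an even power of q, or for all nonzero z, w if the entries of L(z) lie in a class of functions with an identity principle; for arbitrary dependence on z they fail, e.g. n=1, q²=-1, L(1)=x, L(-1)=y, L=0 elsewhere. *)

theory Defs
  imports "HOL-Analysis.Analysis" "HOL-Combinatorics.Permutations"
begin

text \<open>
  The distribution has a class of unital algebras over the reals but none over the complex
  numbers, so the scalar multiplication is a parameter here.  The index set
  \<open>{1, ..., n}\<close> is an arbitrary finite linearly ordered type \<open>'n\<close>.
\<close>

locale complex_algebra = vector_space cscale
  for cscale :: "complex \<Rightarrow> 'a::ring_1 \<Rightarrow> 'a" +
  assumes cscale_mult_left: "cscale c x * y = cscale c (x * y)"
    and cscale_mult_right: "x * cscale c y = cscale c (x * y)"

definition ord_sgn :: "'n::linorder \<Rightarrow> 'n \<Rightarrow> int"  \<comment> \<open>\<open>sgn (i - j)\<close>\<close>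
  where "ord_sgn i j = (if j < i then 1 else if i = j then 0 else - 1)"

subsection \<open>Matrices over the tensor powers\<close>

text \<open>
  An element of \<open>A \<otimes> End(\<complex>\<^sup>n)\<^sup>\<otimes>\<^sup>k\<close> is given by its matrix with respect to the standard basis
  of \<open>(\<complex>\<^sup>n)\<^sup>\<otimes>\<^sup>k\<close>, whose rows and columns are indexed by lists of length \<open>k\<close>.  Entries at lists of
  any other length carry no meaning, and the tensor factors are numbered from \<open>0\<close>.
\<close>

type_synonym ('n, 'a) tensor_op = "'n list \<Rightarrow> 'n list \<Rightarrow> 'a"

definition multi_indices :: "nat \<Rightarrow> 'n list set"
  where "multi_indices k = {I. length I = k}"

definition top_eq :: "nat \<Rightarrow> ('n, 'a) tensor_op \<Rightarrow> ('n, 'a) tensor_op \<Rightarrow> bool"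
  where "top_eq k X Y \<longleftrightarrow> (\<forall>I\<in>multi_indices k. \<forall>J\<in>multi_indices k. X I J = Y I J)"

definition top_one :: "('n, 'a::ring_1) tensor_op"
  where "top_one I J = (if I = J then 1 else 0)"

definition top_mult ::
    "nat \<Rightarrow> ('n, 'a::ring_1) tensor_op \<Rightarrow> ('n, 'a) tensor_op \<Rightarrow> ('n, 'a) tensor_op"
  where "top_mult k X Y I J = (\<Sum>K\<in>multi_indices k. X I K * Y K J)"

definition top_trace :: "nat \<Rightarrow> ('n, 'a::ring_1) tensor_op \<Rightarrow> 'a"
  where "top_trace k X = (\<Sum>I\<in>multi_indices k. X I I)"

definition top_lift ::
    "(complex \<Rightarrow> 'a::ring_1 \<Rightarrow> 'a) \<Rightarrow> ('n, complex) tensor_op \<Rightarrow> ('n, 'a) tensor_op"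
  \<comment> \<open>the embedding \<open>X \<mapsto> 1 \<otimes> X\<close> of \<open>End(\<complex>\<^sup>n)\<^sup>\<otimes>\<^sup>k\<close> into \<open>A \<otimes> End(\<complex>\<^sup>n)\<^sup>\<otimes>\<^sup>k\<close>\<close>
  where "top_lift cscale X I J = cscale (X I J) 1"

definition act_at :: "nat \<Rightarrow> 'a::ring_1^'n^'n \<Rightarrow> ('n, 'a) tensor_op"
  where "act_at a X I J =
    (if take a I = take a J \<and> drop (a + 1) I = drop (a + 1) J then X $ (I ! a) $ (J ! a) else 0)"

definition act_adjacent :: "nat \<Rightarrow> ('n, complex) tensor_op \<Rightarrow> ('n, complex) tensor_op"
  \<comment> \<open>an operator on \<open>\<complex>\<^sup>n \<otimes> \<complex>\<^sup>n\<close> acting in the factors \<open>a\<close> and \<open>a + 1\<close>\<close>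
  where "act_adjacent a X I J =
    (if take a I = take a J \<and> drop (a + 2) I = drop (a + 2) J
     then X [I ! a, I ! (a + 1)] [J ! a, J ! (a + 1)] else 0)"

definition mat_unit :: "'n \<Rightarrow> 'n \<Rightarrow> complex^'n^'n"
  where "mat_unit i j = (\<chi> a b. if a = i \<and> b = j then 1 else 0)"

definition tensor2 :: "complex^'n^'n \<Rightarrow> complex^'n^'n \<Rightarrow> ('n, complex) tensor_op"
  where "tensor2 A B I J = A $ (I ! 0) $ (J ! 0) * B $ (I ! 1) $ (J ! 1)"

subsection \<open>The trigonometric R-matrix and L-operators\<close>

definition R_matrix :: "complex \<Rightarrow> complex \<Rightarrow> ('n::{finite,linorder}, complex) tensor_op"
  where "R_matrix q z I J = 1 / (z - 1) *
    ((q * z - inverse q) * (\<Sum>i\<in>UNIV. tensor2 (mat_unit i i) (mat_unit i i) I J)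
     + (z - 1) * (\<Sum>(i, j)\<in>{(i, j). i \<noteq> j}. tensor2 (mat_unit i i) (mat_unit j j) I J)
     + (q - inverse q) * (\<Sum>(i, j)\<in>{(i, j). i < j}.
         z * tensor2 (mat_unit i j) (mat_unit j i) I J
           + tensor2 (mat_unit j i) (mat_unit i j) I J))"

text \<open>
  The spectral parameter ranges over the nonzero complex numbers; \<open>R(z/w)\<close> is defined exactly
  for \<open>z \<noteq> w\<close>.
\<close>

definition L_operator ::
    "(complex \<Rightarrow> 'a::ring_1 \<Rightarrow> 'a) \<Rightarrow> complex \<Rightarrow> (complex \<Rightarrow> 'a^'n::{finite,linorder}^'n::{finite,linorder}) \<Rightarrow> bool"
  where "L_operator cscale q L \<longleftrightarrow> (\<forall>z w. z \<noteq> 0 \<longrightarrow> w \<noteq> 0 \<longrightarrow> z \<noteq> w \<longrightarrow>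
    top_eq 2
      (top_mult 2 (top_mult 2 (top_lift cscale (R_matrix q (z / w))) (act_at 0 (L z))) (act_at 1 (L w)))
      (top_mult 2 (top_mult 2 (act_at 1 (L w)) (act_at 0 (L z))) (top_lift cscale (R_matrix q (z / w)))))"

subsection \<open>Quantum powers\<close>

definition qmult ::
    "(complex \<Rightarrow> 'a::ring_1 \<Rightarrow> 'a) \<Rightarrow> complex \<Rightarrow> 'a^'n::{finite,linorder}^'n::{finite,linorder} \<Rightarrow>
     'a^'n::{finite,linorder}^'n::{finite,linorder} \<Rightarrow> 'a^'n::{finite,linorder}^'n::{finite,linorder}"
  where "qmult cscale q A B =
    (\<chi> i k. \<Sum>j\<in>UNIV. cscale (q powi ord_sgn j i) (A $ i $ j * B $ j $ k))"

primrec qpower ::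
    "(complex \<Rightarrow> 'a::ring_1 \<Rightarrow> 'a) \<Rightarrow> complex \<Rightarrow> (complex \<Rightarrow> 'a^'n::{finite,linorder}^'n::{finite,linorder}) \<Rightarrow>
     nat \<Rightarrow> complex \<Rightarrow> 'a^'n::{finite,linorder}^'n::{finite,linorder}"
  where
    "qpower cscale q L 0 z = mat 1"
  | "qpower cscale q L (Suc m) z = qmult cscale q (qpower cscale q L m z) (L (q ^ (2 * m) * z))"

definition I_fun ::
    "(complex \<Rightarrow> 'a::ring_1 \<Rightarrow> 'a) \<Rightarrow> complex \<Rightarrow> (complex \<Rightarrow> 'a^'n::{finite,linorder}^'n::{finite,linorder}) \<Rightarrow>
     nat \<Rightarrow> complex \<Rightarrow> 'a"
  where "I_fun cscale q L k z = trace (qpower cscale q L k z)"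

subsection \<open>The q-antisymmetrizer\<close>

definition Pq :: "complex \<Rightarrow> ('n::{finite,linorder}, complex) tensor_op"
  where "Pq q I J =
    (\<Sum>i\<in>UNIV. \<Sum>j\<in>UNIV. q powi ord_sgn i j * tensor2 (mat_unit i j) (mat_unit j i) I J)"

definition is_pi_q ::
    "complex \<Rightarrow> nat \<Rightarrow> ((nat \<Rightarrow> nat) \<Rightarrow> ('n::{finite,linorder}, complex) tensor_op) \<Rightarrow> bool"
  where "is_pi_q q k \<rho> \<longleftrightarrow>
    top_eq k (\<rho> id) top_one \<and>
    (\<forall>\<sigma> \<tau>. \<sigma> permutes {..<k} \<longrightarrow> \<tau> permutes {..<k} \<longrightarrow>
      top_eq k (\<rho> (\<sigma> \<circ> \<tau>)) (top_mult k (\<rho> \<sigma>) (\<rho> \<tau>))) \<and>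
    (\<forall>a. a + 1 < k \<longrightarrow> top_eq k (\<rho> (Transposition.transpose a (a + 1))) (act_adjacent a (Pq q)))"

text \<open>
  Such a representation exists for \<open>q \<noteq> 0\<close> (shown below), and it is determined on the permutations
  of \<open>{..<k}\<close> because these are generated by the adjacent transpositions.
\<close>

definition pi_q ::
    "complex \<Rightarrow> nat \<Rightarrow> (nat \<Rightarrow> nat) \<Rightarrow> ('n::{finite,linorder}, complex) tensor_op"
  where "pi_q q k = (SOME \<rho>. is_pi_q q k \<rho>)"

definition inversion_set :: "'n::linorder list \<Rightarrow> (nat \<times> nat) set"
  where "inversion_set I = {(x, y). x < y \<and> y < length I \<and> I ! y < I ! x}"

lemma finite_inversion_set: "finite (inversion_set I)"
  by (rule finite_subset[of _ "{..<length I} \<times> {..<length I}"]) (auto simp: inversion_set_def)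

lemma inversions_adjacent_swap:
  fixes I J :: "'n::linorder list"
  assumes len: "length I = k" "length J = k" and a: "a + 1 < k"
    and IJ: "\<And>x. x < k \<Longrightarrow> I ! (Transposition.transpose a (a + 1) x) = J ! x"
  shows "int (card (inversion_set I)) - int (card (inversion_set J)) = ord_sgn (I ! a) (I ! (a + 1))"
proof -
  let ?s = "Transposition.transpose a (a + 1)" and ?p = "(a, a + 1)"
  have JI: "J ! (?s x) = I ! x" if "x < k" for x
  proof -
    have "?s x < k" using that a by (auto simp: Transposition.transpose_def)
    from IJ[OF this] show ?thesis by simp
  qed
  have map: "map_prod ?s ?s ` (inversion_set I' - {?p}) \<subseteq> inversion_set J' - {?p}"
    if "length I' = k" "length J' = k" "\<And>x. x < k \<Longrightarrow> J' ! (?s x) = I' ! x"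
    for I' J' :: "'n list"
  proof
    fix v assume "v \<in> map_prod ?s ?s ` (inversion_set I' - {?p})"
    then obtain u where u: "v = map_prod ?s ?s u" "u \<in> inversion_set I' - {?p}"
      by (rule imageE)
    obtain x y where "u = (x, y)" by (cases u)
    with u(1) have v: "v = (?s x, ?s y)" by (simp only: map_prod_simp)
    have xy: "x < y" "y < k" "I' ! y < I' ! x" "(x, y) \<noteq> ?p"
      using u(2) that(1) unfolding \<open>u = (x, y)\<close> inversion_set_def by simp_all
    have "?s x < ?s y" "?s y < k" "(?s x, ?s y) \<noteq> ?p"
      using xy(1,2,4) a unfolding Transposition.transpose_def prod.inject by presburger+
    moreover have "J' ! (?s y) < J' ! (?s x)" using that(3)[of x] that(3)[of y] xy by simp
    ultimately show "v \<in> inversion_set J' - {?p}" using v that(2) by (simp add: inversion_set_def)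
  qed
  have inj: "inj_on (map_prod ?s ?s) A" for A
    by (rule inj_on_subset[OF _ subset_UNIV]) (simp add: prod.inj_map)
  have "card (inversion_set I - {?p}) \<le> card (inversion_set J - {?p})"
    by (rule card_inj_on_le[OF inj map[OF len JI]]) (auto simp: finite_inversion_set)
  moreover have "card (inversion_set J - {?p}) \<le> card (inversion_set I - {?p})"
    by (rule card_inj_on_le[OF inj map[OF len(2,1) IJ]]) (auto simp: finite_inversion_set)
  ultimately have eq: "card (inversion_set I - {?p}) = card (inversion_set J - {?p})" by simp
  have card: "int (card (inversion_set I')) =
      int (card (inversion_set I' - {?p})) + (if I' ! (a + 1) < I' ! a then 1 else 0)"
    if "length I' = k" for I' :: "'n list"
  proof (cases "I' ! (a + 1) < I' ! a")
    case True
    then have "?p \<in> inversion_set I'" using that a by (auto simp: inversion_set_def)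
    then have "card (inversion_set I') = Suc (card (inversion_set I' - {?p}))"
      by (metis card.remove finite_inversion_set)
    with True show ?thesis by simp
  next
    case False
    then have "?p \<notin> inversion_set I'" by (auto simp: inversion_set_def)
    with False show ?thesis by simp
  qed
  have "J ! a = I ! (a + 1)" "J ! (a + 1) = I ! a"
    using IJ[of a] IJ[of "a + 1"] a by simp_all
  then show ?thesis
    using card[OF len(1)] card[OF len(2)] eq by (auto simp: ord_sgn_def)
qed

lemma Pq_entry:
  "Pq q [i, j] [i', j'] = (if i = j' \<and> j = i' then q powi ord_sgn i j else 0)"
proof -
  let ?c = "if i = j' \<and> j = i' then q powi ord_sgn i j else 0"
  have "q powi ord_sgn x y * tensor2 (mat_unit x y) (mat_unit y x) [i, j] [i', j']
      = (if y = j then if x = i then ?c else 0 else 0)" for x y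
    by (auto simp: tensor2_def mat_unit_def)
  then have "Pq q [i, j] [i', j'] = (\<Sum>x\<in>UNIV. \<Sum>y\<in>UNIV. if y = j then if x = i then ?c else 0 else 0)"
    by (simp only: Pq_def)
  also have "\<dots> = ?c" by (simp only: sum.delta finite UNIV_I if_True)
  finally show ?thesis .
qed

lemma adjacent_swap_iff:
  assumes len: "length I = k" "length J = k" and a: "a + 1 < k"
  shows "(\<forall>x<k. I ! (Transposition.transpose a (a + 1) x) = J ! x) \<longleftrightarrow>
    take a I = take a J \<and> drop (a + 2) I = drop (a + 2) J \<and> I ! a = J ! (a + 1) \<and> I ! (a + 1) = J ! a"
    (is "?L \<longleftrightarrow> ?R")
proof
  assume L: ?L
  have "take a I = take a J"
  proof (rule nth_equalityI)
    fix x assume "x < length (take a I)"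
    then have "x < a" by simp
    with L[rule_format, of x] a show "take a I ! x = take a J ! x"
      by (simp add: Transposition.transpose_def)
  qed (use len in simp)
  moreover have "drop (a + 2) I = drop (a + 2) J"
  proof (rule nth_equalityI)
    fix x assume "x < length (drop (a + 2) I)"
    then have "a + 2 + x < k" using len by simp
    with L[rule_format, of "a + 2 + x"] show "drop (a + 2) I ! x = drop (a + 2) J ! x"
      using len by (simp add: Transposition.transpose_def)
  qed (use len in simp)
  moreover have "I ! a = J ! (a + 1)" "I ! (a + 1) = J ! a"
    using L[rule_format, of a] L[rule_format, of "a + 1"] a by simp_all
  ultimately show ?R by blast
next
  assume R: ?R
  show ?L
  proof (intro allI impI)
    fix x assume x: "x < k"
    consider "x < a" | "x = a" | "x = a + 1" | "a + 2 \<le> x" by linarith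
    then show "I ! (Transposition.transpose a (a + 1) x) = J ! x"
    proof cases
      case 1
      then have "I ! x = J ! x" using R by (metis nth_take)
      with 1 show ?thesis by (simp add: Transposition.transpose_def)
    next
      case 4
      then obtain d where d: "x = a + 2 + d" using le_Suc_ex by blast
      have "drop (a + 2) I ! d = drop (a + 2) J ! d" using R by simp
      then have "I ! x = J ! x" using d x len by simp
      with 4 show ?thesis by (simp add: Transposition.transpose_def)
    qed (use R in simp_all)
  qed
qed

lemma pi_q_exists:
  assumes q: "q \<noteq> 0"
  shows "\<exists>\<rho> :: (nat \<Rightarrow> nat) \<Rightarrow> ('n::{finite,linorder}, complex) tensor_op. is_pi_q q k \<rho>"
proof -
  define e :: "'n list \<Rightarrow> int" where "e I = int (card (inversion_set I))" for I
  define \<rho> :: "(nat \<Rightarrow> nat) \<Rightarrow> ('n, complex) tensor_op"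
    where "\<rho> \<tau> I J = (if \<forall>x<k. I ! \<tau> x = J ! x then q powi (e I - e J) else 0)" for \<tau> I J
  have fin: "finite (multi_indices k :: 'n list set)"
    using finite_lists_length_eq[of "UNIV :: 'n set" k] by (simp add: multi_indices_def)
  have "top_eq k (\<rho> id) top_one"
    by (auto simp: top_eq_def \<rho>_def top_one_def multi_indices_def intro: nth_equalityI)
  moreover have "top_eq k (\<rho> (\<sigma> \<circ> \<tau>)) (top_mult k (\<rho> \<sigma>) (\<rho> \<tau>))"
    if \<sigma>: "\<sigma> permutes {..<k}" and \<tau>: "\<tau> permutes {..<k}" for \<sigma> \<tau>
    unfolding top_eq_def
  proof (intro ballI)
    fix I J :: "'n list" assume I: "I \<in> multi_indices k" and J: "J \<in> multi_indices k"
    define K where "K = map (\<lambda>x. I ! \<sigma> x) [0..<k]"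
    have K: "K \<in> multi_indices k" by (simp add: K_def multi_indices_def)
    have *: "(\<forall>x<k. I ! \<sigma> x = K' ! x) \<longleftrightarrow> K' = K" if "K' \<in> multi_indices k" for K'
    proof
      assume L: "\<forall>x<k. I ! \<sigma> x = K' ! x"
      show "K' = K"
        using that L by (intro nth_equalityI) (simp_all add: K_def multi_indices_def)
    qed (simp add: K_def)
    have "top_mult k (\<rho> \<sigma>) (\<rho> \<tau>) I J
        = (\<Sum>K'\<in>multi_indices k. if K' = K then \<rho> \<sigma> I K * \<rho> \<tau> K J else 0)"
      unfolding top_mult_def
    proof (rule sum.cong)
      fix K' :: "'n list" assume "K' \<in> multi_indices k"
      from *[OF this] have "\<rho> \<sigma> I K' = 0" if "K' \<noteq> K"
        using that unfolding \<rho>_def by (metis (full_types))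
      then show "\<rho> \<sigma> I K' * \<rho> \<tau> K' J = (if K' = K then \<rho> \<sigma> I K * \<rho> \<tau> K J else 0)"
        by (cases "K' = K") simp_all
    qed simp
    also have "\<dots> = \<rho> \<sigma> I K * \<rho> \<tau> K J" using fin K by simp
    also have "\<rho> \<sigma> I K = q powi (e I - e K)" using *[OF K] by (simp add: \<rho>_def)
    also have "\<rho> \<tau> K J = (if \<forall>x<k. I ! (\<sigma> \<circ> \<tau>) x = J ! x then q powi (e K - e J) else 0)"
    proof -
      have "K ! \<tau> x = I ! (\<sigma> \<circ> \<tau>) x" if "x < k" for x
        using permutes_in_image[OF \<tau>, of x] that by (simp add: K_def)
      then show ?thesis by (simp add: \<rho>_def)
    qed
    finally have "top_mult k (\<rho> \<sigma>) (\<rho> \<tau>) I J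
        = (if \<forall>x<k. I ! (\<sigma> \<circ> \<tau>) x = J ! x then q powi (e I - e J) else 0)"
      using q by (simp flip: power_int_add)
    then show "\<rho> (\<sigma> \<circ> \<tau>) I J = top_mult k (\<rho> \<sigma>) (\<rho> \<tau>) I J"
      by (simp only: \<rho>_def[of "\<sigma> \<circ> \<tau>"])
  qed
  moreover have "top_eq k (\<rho> (Transposition.transpose a (a + 1))) (act_adjacent a (Pq q))" if a: "a + 1 < k" for a
    unfolding top_eq_def
  proof (intro ballI)
    fix I J :: "'n list" assume "I \<in> multi_indices k" and "J \<in> multi_indices k"
    then have len: "length I = k" "length J = k" by (auto simp: multi_indices_def)
    have "e I - e J = ord_sgn (I ! a) (I ! (a + 1))" if "\<forall>x<k. I ! (Transposition.transpose a (a + 1) x) = J ! x"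
      using inversions_adjacent_swap[OF len a] that by (simp add: e_def)
    then show "\<rho> (Transposition.transpose a (a + 1)) I J = act_adjacent a (Pq q) I J"
      unfolding \<rho>_def act_adjacent_def Pq_entry
      using adjacent_swap_iff[OF len a] by auto
  qed
  ultimately have "is_pi_q q k \<rho>" by (simp add: is_pi_q_def)
  then show ?thesis by blast
qed

lemma pi_q_is_representation: "q \<noteq> 0 \<Longrightarrow> is_pi_q q k (pi_q q k)"
  unfolding pi_q_def by (rule someI_ex[OF pi_q_exists])

definition q_antisymmetrizer :: "complex \<Rightarrow> nat \<Rightarrow> ('n::{finite,linorder}, complex) tensor_op"
  where "q_antisymmetrizer q k I J =
    1 / fact k * (\<Sum>\<tau>\<in>{\<tau>. \<tau> permutes {..<k}}. of_int (sign \<tau>) * pi_q q k \<tau> I J)"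

primrec L_product ::
    "complex \<Rightarrow> (complex \<Rightarrow> 'a::ring_1^'n::{finite,linorder}^'n::{finite,linorder}) \<Rightarrow> nat \<Rightarrow> complex \<Rightarrow> nat \<Rightarrow>
     ('n, 'a) tensor_op"
  \<comment> \<open>the product of the first \<open>m\<close> factors, in the \<open>k\<close>-fold tensor power\<close>
  where
    "L_product q L k z 0 = top_one"
  | "L_product q L k z (Suc m) =
       top_mult k (L_product q L k z m) (act_at m (L (q ^ (2 * m) * z)))"

definition t_fun ::
    "(complex \<Rightarrow> 'a::ring_1 \<Rightarrow> 'a) \<Rightarrow> complex \<Rightarrow> (complex \<Rightarrow> 'a^'n::{finite,linorder}^'n::{finite,linorder}) \<Rightarrow>
     nat \<Rightarrow> complex \<Rightarrow> 'a"
  where "t_fun cscale q L k z =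
    top_trace k (top_mult k (top_lift cscale (q_antisymmetrizer q k)) (L_product q L k z k))"

subsection \<open>Values of the parameters\<close>

text \<open>
  An identity between functions of \<open>z\<close> and \<open>w\<close> is understood as holding for generic values.
  It extends to all nonzero values as soon as the entries of \<open>L\<close> lie in an algebra of functions with
  an identity principle, such as the Laurent polynomials over \<open>A\<close> or, for a Hausdorff topological
  algebra \<open>A\<close>, the continuous functions.  For an arbitrary function \<open>L\<close> the values
  \<open>z/w \<in> q\<^sup>2\<^sup>\<int>\<close> cannot be admitted: for \<open>n = 1\<close> and \<open>q\<^sup>2 = -1\<close> the matrix \<open>R(-1)\<close>
  vanishes and \<open>L(z)\<close>, \<open>L(-z)\<close> are unrelated; for \<open>q = 1\<close> the entries of a single \<open>L(z)\<close>
  are unrelated.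
\<close>

definition generic_pair :: "complex \<Rightarrow> complex \<Rightarrow> complex \<Rightarrow> bool"
  where "generic_pair q z w \<longleftrightarrow> (\<forall>s::int. z / w \<noteq> q powi (2 * s))"

definition parameter_functions :: "(complex \<Rightarrow> 'a::ring_1) set \<Rightarrow> bool"
  where "parameter_functions F \<longleftrightarrow>
    (\<forall>r. (\<lambda>_. r) \<in> F) \<and>
    (\<forall>f\<in>F. \<forall>g\<in>F. (\<lambda>u. f u + g u) \<in> F \<and> (\<lambda>u. f u * g u) \<in> F) \<and>
    (\<forall>f\<in>F. \<forall>c. c \<noteq> 0 \<longrightarrow> (\<lambda>u. f (c * u)) \<in> F) \<and>
    (\<forall>f\<in>F. countable {u. u \<noteq> 0 \<and> f u \<noteq> 0} \<longrightarrow> (\<forall>u. u \<noteq> 0 \<longrightarrow> f u = 0))"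

definition regular_dependence :: "(complex \<Rightarrow> 'a::ring_1^'n^'n) \<Rightarrow> bool"
  where "regular_dependence L \<longleftrightarrow>
    (\<exists>F. parameter_functions F \<and> (\<forall>i j. (\<lambda>u. L u $ i $ j) \<in> F))"

end

theory Submission
  imports Defs
begin

text \<open>
  Both families of functions are traces \<open>tr (X L\<^sup>(\<^sup>1\<^sup>)(z) L\<^sup>(\<^sup>2\<^sup>)(q\<^sup>2 z) \<dots>)\<close> with \<open>X\<close> in the image of the
  group algebra of the symmetric group under \<open>\<pi>\<^sub>q\<close>: for \<open>t_fun\<close> this \<open>X\<close> is the
  \<open>q\<close>-antisymmetrizer, and for \<open>I_fun\<close> it is a long cycle, because the weights
  \<open>q\<^bsup>sgn(j-i)\<^esup>\<close> of the quantum product are those which the cycle collects when it moves the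
  last index in front of all the others (\<open>I_fun_conv_cycle_trace\<close>).

  Suppose first that \<open>z/w\<close> is not in \<open>q\<^sup>2\<^sup>\<int>\<close> and that \<open>q\<^sup>2 \<noteq> 1\<close>.  The product \<open>fused_R\<close> of the
  R-matrices between the tensor factors of the two traces is invertible and exchanges the two
  products of L-operators, so
  \<open>tr (B L L') = tr (B R\<^sup>-\<^sup>1 L' L R)\<close> when \<open>B\<close> is the product of the two antisymmetrizers.
  To remove the conjugation by \<open>R\<close> one uses that \<open>R\<close> degenerates at \<open>q\<^sup>-\<^sup>2\<close> to \<open>1 - P\<^sup>q\<close>.  The
  exchange relations at the parameters \<open>z, q\<^sup>2 z\<close> then say that products of L-operators map
  \<open>q\<close>-symmetric vectors to \<open>q\<close>-symmetric vectors (the \<open>q\<close>-Manin property), and the Yang--Baxter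
  equation gives the same for \<open>R\<close> and, the relation being invertible, for \<open>R\<^sup>-\<^sup>1\<close>.  An
  operator \<open>Y\<close> with this property satisfies \<open>B Y = B Y B\<close> for the normalized \<open>B\<close>, so copies of
  \<open>B\<close> can be inserted around \<open>R\<close> until \<open>R\<close> and \<open>R\<^sup>-\<^sup>1\<close> cancel by cyclicity of the
  trace (\<open>ltrace_conjugate\<close>).  This proves that the functions \<open>t_fun\<close> commute
  (\<open>tr_op_anti_op_commute\<close>).

  A cycle alone does not satisfy such identities, and the functions \<open>I_fun\<close> are reached through
  Newton identities instead (\<open>hook_Suc\<close>).  The traces \<open>hook\<close> of an antisymmetrizer followed by a
  cycle interpolate between \<open>I_fun\<close> and \<open>t_fun\<close>; expanding the antisymmetrizer by its last
  tensor factor expresses each of them by the preceding one and by products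
  \<open>t_fun \<cdot> I_fun\<close> with fewer L-operators in \<open>I_fun\<close>.  Hence whatever commutes with all \<open>t_fun\<close>
  at the points \<open>q\<^sup>2\<^sup>s z\<close> commutes with all \<open>I_fun\<close> (\<open>cycle_trace_commute\<close>); this is applied
  once to \<open>t_fun\<close> and once more to \<open>I_fun\<close> itself.

  For \<open>q\<^sup>2 = 1\<close> there is no Manin property, but then \<open>R\<close> is diagonal with entries \<open>1\<close> and
  \<open>q\<close>, and \<open>fused_R\<close> commutes with the images of both symmetric groups.  The traces commute for
  arbitrary \<open>X\<close> (\<open>tr_op_commute_diagonal\<close>).

  Finally, if the dependence on the parameter is regular, the commutators are functions of \<open>z\<close>
  which vanish outside the countable set \<open>q\<^sup>2\<^sup>\<int> w\<close>, hence everywhere.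
\<close>

section \<open>The ring of length-preserving list matrices\<close>

text \<open>
  All tensor powers live side by side, as the diagonal blocks of one ring of matrices indexed by
  lists.  This makes products of operators on \<open>(\<complex>\<^sup>n)\<^sup>\<otimes>\<^sup>m\<close> products in a type of class \<open>ring_1\<close>,
  although \<open>m\<close> is a variable.
\<close>

typedef (overloaded) ('n, 'a::zero) lmat =
  "{X :: 'n list \<Rightarrow> 'n list \<Rightarrow> 'a. \<forall>I J. length I \<noteq> length J \<longrightarrow> X I J = 0}"
  morphisms ent Abs_lmat
  by (rule exI[of _ "\<lambda>_ _. 0"]) simp

setup_lifting type_definition_lmat

lemma lmat_eqI: "(\<And>I J. length I = length J \<Longrightarrow> ent X I J = ent Y I J) \<Longrightarrow> X = Y"
proof (rule ent_inject[THEN iffD1], intro ext)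
  fix I J assume *: "\<And>I J. length I = length J \<Longrightarrow> ent X I J = ent Y I J"
  show "ent X I J = ent Y I J"
    using * ent[of X] ent[of Y] by (cases "length I = length J") simp_all
qed

lemma finite_multi_indices [simp]: "finite (multi_indices m :: 'n::finite list set)"
  using finite_lists_length_eq[of "UNIV :: 'n set" m] by (simp add: multi_indices_def)

lemma in_multi_indices_iff [simp]: "I \<in> multi_indices m \<longleftrightarrow> length I = m"
  by (simp add: multi_indices_def)

instantiation lmat :: (finite, ring_1) ring_1
begin

lift_definition zero_lmat :: "('a, 'b) lmat" is "\<lambda>_ _. 0" by simp
lift_definition one_lmat :: "('a, 'b) lmat" is "\<lambda>I J. if I = J then 1 else 0" by auto
lift_definition plus_lmat :: "('a, 'b) lmat \<Rightarrow> ('a, 'b) lmat \<Rightarrow> ('a, 'b) lmat"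
  is "\<lambda>X Y I J. X I J + Y I J" by simp
lift_definition uminus_lmat :: "('a, 'b) lmat \<Rightarrow> ('a, 'b) lmat"
  is "\<lambda>X I J. - X I J" by simp
lift_definition minus_lmat :: "('a, 'b) lmat \<Rightarrow> ('a, 'b) lmat \<Rightarrow> ('a, 'b) lmat"
  is "\<lambda>X Y I J. X I J - Y I J" by simp
lift_definition times_lmat :: "('a, 'b) lmat \<Rightarrow> ('a, 'b) lmat \<Rightarrow> ('a, 'b) lmat"
  is "\<lambda>X Y I J. \<Sum>K\<in>multi_indices (length I). X I K * Y K J"
  by (simp add: multi_indices_def)

instance
proof
  fix X Y Z :: "('a, 'b) lmat"
  show "X * Y * Z = X * (Y * Z)"
  proof (transfer, intro ext)
    fix X Y Z :: "'a list \<Rightarrow> 'a list \<Rightarrow> 'b" and I J :: "'a list"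
    let ?M = "multi_indices (length I) :: 'a list set"
    have "(\<Sum>K\<in>?M. (\<Sum>H\<in>?M. X I H * Y H K) * Z K J) = (\<Sum>K\<in>?M. \<Sum>H\<in>?M. X I H * (Y H K * Z K J))"
      by (simp add: sum_distrib_right mult.assoc)
    also have "\<dots> = (\<Sum>H\<in>?M. \<Sum>K\<in>?M. X I H * (Y H K * Z K J))" by (rule sum.swap)
    also have "\<dots> = (\<Sum>H\<in>?M. X I H * (\<Sum>K\<in>multi_indices (length H). Y H K * Z K J))"
      by (intro sum.cong refl) (simp add: sum_distrib_left multi_indices_def)
    finally show "(\<Sum>K\<in>?M. (\<Sum>H\<in>?M. X I H * Y H K) * Z K J)
        = (\<Sum>H\<in>?M. X I H * (\<Sum>K\<in>multi_indices (length H). Y H K * Z K J))" .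
  qed
  show "1 * X = X"
  proof (transfer, intro ext)
    fix X :: "'a list \<Rightarrow> 'a list \<Rightarrow> 'b" and I J :: "'a list"
    show "(\<Sum>K\<in>multi_indices (length I). (if I = K then 1 else 0) * X K J) = X I J"
      by (simp add: if_distrib[of "\<lambda>x. x * _"] cong: if_cong)
  qed
  show "X * 1 = X"
  proof (transfer, intro ext)
    fix X :: "'a list \<Rightarrow> 'a list \<Rightarrow> 'b" and I J :: "'a list"
    assume X: "\<forall>I J. length I \<noteq> length J \<longrightarrow> X I J = 0"
    have "(\<Sum>K\<in>multi_indices (length I). X I K * (if K = J then 1 else 0))
        = (if J \<in> multi_indices (length I) then X I J else 0)"
      by (simp add: if_distrib[of "\<lambda>x. _ * x"] cong: if_cong)
    then show "(\<Sum>K\<in>multi_indices (length I). X I K * (if K = J then 1 else 0)) = X I J"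
      using X by (simp add: multi_indices_def)
  qed
  show "(X + Y) * Z = X * Z + Y * Z" "X * (Y + Z) = X * Y + X * Z"
    by (transfer; simp add: distrib_left distrib_right sum.distrib)+
  show "(0::('a, 'b) lmat) \<noteq> 1"
  proof
    assume "(0::('a, 'b) lmat) = 1"
    then have "ent 0 [] [] = ent (1 :: ('a, 'b) lmat) [] []" by simp
    then show False by (simp add: zero_lmat.rep_eq one_lmat.rep_eq)
  qed
qed (transfer; simp add: fun_eq_iff)+

end

lemmas ent_ops = zero_lmat.rep_eq one_lmat.rep_eq plus_lmat.rep_eq uminus_lmat.rep_eq
  minus_lmat.rep_eq times_lmat.rep_eq

lemma ent_sum: "ent (sum f A) I J = (\<Sum>x\<in>A. ent (f x) I J)"
  by (induction A rule: infinite_finite_induct) (simp_all add: ent_ops)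

lemma ent_of_nat_mult: "ent (of_nat c * X) I J = of_nat c * ent X I J"
  by (induction c) (simp_all add: ent_ops distrib_right)

lemma ent_of_int_mult: "ent (of_int c * X) I J = of_int c * ent X I J"
  by (cases c rule: int_diff_cases) (simp add: left_diff_distrib minus_lmat.rep_eq ent_of_nat_mult)

definition central_entries :: "('n, 'a::ring_1) lmat \<Rightarrow> bool"
  where "central_entries X \<longleftrightarrow> (\<forall>I J r. ent X I J * r = r * ent X I J)"

lemma central_entries_mult:
  assumes "central_entries X" "central_entries Y"
  shows "central_entries (X * Y :: ('n::finite, 'a::ring_1) lmat)"
proof -
  have "ent X I K * ent Y K J * r = r * (ent X I K * ent Y K J)" for I J K r
    using assms unfolding central_entries_def by (metis mult.assoc)
  then show ?thesis by (simp add: central_entries_def ent_ops sum_distrib_left sum_distrib_right)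
qed

definition ltrace :: "nat \<Rightarrow> ('n, 'a::ring_1) lmat \<Rightarrow> 'a"
  where "ltrace m X = (\<Sum>I\<in>multi_indices m. ent X I I)"

lemma ltrace_add: "ltrace m (X + Y) = ltrace m X + ltrace m (Y :: ('n::finite, 'a::ring_1) lmat)"
  by (simp add: ltrace_def ent_ops sum.distrib)

lemma ltrace_diff: "ltrace m (X - Y) = ltrace m X - ltrace m (Y :: ('n::finite, 'a::ring_1) lmat)"
  by (simp add: ltrace_def ent_ops sum_subtractf)

lemma ltrace_sum:
  "ltrace m (sum f A) = (\<Sum>x\<in>A. ltrace m (f x :: ('n::finite, 'a::ring_1) lmat))"
  by (induction A rule: infinite_finite_induct) (simp_all add: ltrace_add, simp_all add: ltrace_def ent_ops)

lemma ltrace_of_nat_mult: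
  "ltrace m (of_nat c * X) = of_nat c * ltrace m (X :: ('n::finite, 'a::ring_1) lmat)"
  by (simp add: ltrace_def ent_of_nat_mult sum_distrib_left)

text \<open>
  Over a noncommutative ring the trace is cyclic only for a factor whose entries are central.
\<close>

lemma ltrace_mult_commute:
  fixes X Y :: "('n::finite, 'a::ring_1) lmat"
  assumes "central_entries X"
  shows "ltrace m (X * Y) = ltrace m (Y * X)"
proof -
  have "ltrace m (X * Y) = (\<Sum>I\<in>multi_indices m. \<Sum>K\<in>multi_indices m. ent X I K * ent Y K I)"
    by (simp add: ltrace_def ent_ops multi_indices_def)
  also have "\<dots> = (\<Sum>K\<in>multi_indices m. \<Sum>I\<in>multi_indices m. ent Y K I * ent X I K)"
    using assms by (subst sum.swap) (simp add: central_entries_def)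
  also have "\<dots> = ltrace m (Y * X)"
    by (simp add: ltrace_def ent_ops multi_indices_def)
  finally show ?thesis .
qed

section \<open>Operators in selected tensor factors\<close>

lift_definition blk :: "nat \<Rightarrow> ('n, 'a::zero) tensor_op \<Rightarrow> ('n, 'a) lmat"
  is "\<lambda>m X I J. if length I = m \<and> length J = m then X I J else 0" by auto

text \<open>
  \<open>site ps X\<close> is the operator \<open>X\<close> on the tensor factors listed in \<open>ps\<close>, in this order.
\<close>

definition site :: "nat list \<Rightarrow> ('n, 'a::zero) tensor_op \<Rightarrow> ('n, 'a) tensor_op"
  where "site ps X I J = (if \<forall>x<length I. x \<notin> set ps \<longrightarrow> I ! x = J ! x
    then X (map ((!) I) ps) (map ((!) J) ps) else 0)"

abbreviation spread :: "nat \<Rightarrow> nat list \<Rightarrow> ('n, 'a::zero) tensor_op \<Rightarrow> ('n, 'a) lmat"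
  where "spread m ps X \<equiv> blk m (site ps X)"

text \<open>The unit of the block \<open>m\<close>, a central idempotent of the whole ring.\<close>

definition blk_unit :: "nat \<Rightarrow> ('n, 'a::ring_1) lmat"
  where "blk_unit m = blk m top_one"

lemma blk_cong: "top_eq m X Y \<Longrightarrow> blk m X = blk m Y"
  by (rule lmat_eqI) (auto simp: blk.rep_eq top_eq_def multi_indices_def)

lemma blk_eqD:
  assumes "blk m X = blk m Y" shows "top_eq m X Y"
proof -
  have "ent (blk m X) I J = ent (blk m Y) I J" for I J using assms by simp
  then show ?thesis unfolding top_eq_def multi_indices_def blk.rep_eq by (metis (mono_tags, lifting) mem_Collect_eq)
qed

lemma blk_mult: "blk m (top_mult m X Y) = blk m X * blk m (Y :: ('n::finite, 'a::ring_1) tensor_op)"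
  by (rule lmat_eqI) (auto simp: blk.rep_eq ent_ops top_mult_def multi_indices_def)

lemma ltrace_blk: "ltrace m (blk m X) = top_trace m X"
  by (simp add: ltrace_def top_trace_def blk.rep_eq multi_indices_def)

lemma blk_unit_left [simp]: "blk_unit m * blk m X = blk m (X :: ('n::finite, 'a::ring_1) tensor_op)"
  unfolding blk_unit_def blk_mult[symmetric]
  by (rule blk_cong) (auto simp: top_eq_def top_mult_def top_one_def if_distrib[of "\<lambda>x. x * _"] cong: if_cong)

lemma blk_unit_right [simp]: "blk m X * blk_unit m = blk m (X :: ('n::finite, 'a::ring_1) tensor_op)"
  unfolding blk_unit_def blk_mult[symmetric]
  by (rule blk_cong) (auto simp: top_eq_def top_mult_def top_one_def if_distrib[of "\<lambda>x. _ * x"] cong: if_cong)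

lemma blk_unit_central: "blk_unit m * X = X * (blk_unit m :: ('n::finite, 'a::ring_1) lmat)"
proof (rule lmat_eqI)
  fix I J :: "'n list" assume len: "length I = length J"
  have "ent (blk_unit m * X) I J = (\<Sum>K\<in>multi_indices (length I). if K = I then (if length I = m then ent X I J else 0) else 0)"
    unfolding ent_ops by (intro sum.cong refl) (auto simp: blk_unit_def blk.rep_eq top_one_def)
  also have "\<dots> = (if length I = m then ent X I J else 0)"
    by (subst sum.delta) simp_all
  also have "\<dots> = (\<Sum>K\<in>multi_indices (length I). if K = J then (if length I = m then ent X I J else 0) else 0)"
    using len by (subst sum.delta) simp_all
  also have "\<dots> = ent (X * blk_unit m) I J"
    unfolding ent_ops using len
    by (intro sum.cong refl) (auto simp: blk_unit_def blk.rep_eq top_one_def multi_indices_def)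
  finally show "ent (blk_unit m * X) I J = ent (X * blk_unit m) I J" .
qed

lemma blk_unit_idem [simp]: "blk_unit m * blk_unit m = (blk_unit m :: ('n::finite, 'a::ring_1) lmat)"
  by (simp add: blk_unit_def flip: blk_mult) (rule blk_cong,
     auto simp: top_eq_def top_mult_def top_one_def if_distrib[of "\<lambda>x. x * _"] cong: if_cong)

lemma map_nth_bij_betw:
  assumes ps: "distinct ps" "set ps \<subseteq> {..<m}" and I: "length I = m"
  shows "bij_betw (\<lambda>K. map ((!) K) ps)
    {K \<in> multi_indices m. \<forall>x<m. x \<notin> set ps \<longrightarrow> I ! x = K ! x} (multi_indices (length ps))"
proof (rule bij_betwI[where g = "\<lambda>W. map (\<lambda>x. case map_of (zip ps W) x of None \<Rightarrow> I ! x | Some v \<Rightarrow> v) [0..<m]"])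
  let ?g = "\<lambda>W. map (\<lambda>x. case map_of (zip ps W) x of None \<Rightarrow> I ! x | Some v \<Rightarrow> v) [0..<m]"
  have off: "?g W ! x = I ! x" if "x < m" "x \<notin> set ps" "length W = length ps" for W x
  proof -
    have "map_of (zip ps W) x = None" using that by (simp add: map_of_zip_is_None)
    then show ?thesis using that by (auto split: option.split dest!: map_of_SomeD set_zip_leftD)
  qed
  have on: "?g W ! (ps ! y) = W ! y" if "y < length ps" "length W = length ps" for W y
  proof -
    have "map_of (zip ps W) (ps ! y) = Some (W ! y)" using that ps by (simp add: map_of_zip_nth)
    moreover have "ps ! y < m" using that ps by (auto simp: subset_iff)
    ultimately show ?thesis by simp
  qed
  show "?g \<in> multi_indices (length ps) \<rightarrow> {K \<in> multi_indices m. \<forall>x<m. x \<notin> set ps \<longrightarrow> I ! x = K ! x}"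
    using off by auto
  show "map ((!) (?g W)) ps = W" if "W \<in> multi_indices (length ps)" for W
    using on that by (intro nth_equalityI) auto
  show "?g (map ((!) K) ps) = K" if K: "K \<in> {K \<in> multi_indices m. \<forall>x<m. x \<notin> set ps \<longrightarrow> I ! x = K ! x}" for K
  proof (rule nth_equalityI)
    fix x assume "x < length (?g (map ((!) K) ps))"
    then have x: "x < m" by simp
    show "?g (map ((!) K) ps) ! x = K ! x"
    proof (cases "x \<in> set ps")
      case True
      then obtain y where "y < length ps" "x = ps ! y" by (auto simp: in_set_conv_nth)
      then show ?thesis using on[of y "map ((!) K) ps"] by simp
    next
      case False
      then show ?thesis using off[of x "map ((!) K) ps"] x K by simp
    qed
  qed (use K in simp)
qed auto

text \<open>
  In a product of operators in the factors \<open>ps\<close> the intermediate multi-index agrees with the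
  outer ones at all other positions, so the sum over it is a sum over multi-indices of \<open>ps\<close>.
\<close>

lemma spread_mult:
  fixes X Y :: "('n::finite, 'a::ring_1) tensor_op"
  assumes ps: "distinct ps" "set ps \<subseteq> {..<m}"
  shows "spread m ps (top_mult (length ps) X Y) = spread m ps X * spread m ps Y"
  unfolding blk_mult[symmetric]
proof (rule blk_cong, unfold top_eq_def, intro ballI)
  fix I J :: "'n list" assume I: "I \<in> multi_indices m" and J: "J \<in> multi_indices m"
  let ?S = "{K \<in> multi_indices m. \<forall>x<m. x \<notin> set ps \<longrightarrow> I ! x = K ! x}"
  let ?r = "\<lambda>K. map ((!) K) ps"
  have "top_mult m (site ps X) (site ps Y) I J = (\<Sum>K\<in>?S. site ps X I K * site ps Y K J)"
    unfolding top_mult_def by (intro sum.mono_neutral_right) (use I in \<open>auto simp: site_def\<close>)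
  also have "\<dots> = (\<Sum>K\<in>?S. if \<forall>x<m. x \<notin> set ps \<longrightarrow> I ! x = J ! x then X (?r I) (?r K) * Y (?r K) (?r J) else 0)"
    by (intro sum.cong refl) (use I in \<open>auto simp: site_def\<close>)
  also have "\<dots> = (\<Sum>W\<in>multi_indices (length ps).
      if \<forall>x<m. x \<notin> set ps \<longrightarrow> I ! x = J ! x then X (?r I) W * Y W (?r J) else 0)"
    using I by (intro sum.reindex_bij_betw[OF map_nth_bij_betw[OF ps]]) simp
  also have "\<dots> = site ps (top_mult (length ps) X Y) I J"
  proof -
    have "(\<Sum>W\<in>A. if C then f W else 0) = (if C then sum f A else 0)" for A C and f :: "'n list \<Rightarrow> 'a"
      by simp
    then show ?thesis using I by (simp only: site_def top_mult_def in_multi_indices_iff)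
  qed
  finally show "site ps (top_mult (length ps) X Y) I J = top_mult m (site ps X) (site ps Y) I J" ..
qed

lemma spread_one: "spread m ps top_one = (blk_unit m :: ('n, 'a::ring_1) lmat)"
  unfolding blk_unit_def
proof (rule blk_cong, unfold top_eq_def, intro ballI)
  fix I J :: "'n list" assume "I \<in> multi_indices m" "J \<in> multi_indices m"
  then have "I = J" if "\<forall>x<m. x \<notin> set ps \<longrightarrow> I ! x = J ! x" "map ((!) I) ps = map ((!) J) ps"
    using that by (intro nth_equalityI) (auto simp: map_eq_conv)
  then show "site ps top_one I J = (top_one I J :: 'a)"
    using \<open>I \<in> multi_indices m\<close> by (auto simp: site_def top_one_def)
qed

lemma spread_cong:
  assumes "top_eq (length ps) X Y" shows "spread m ps X = spread m ps Y"
  using assms by (intro blk_cong) (auto simp: top_eq_def site_def)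

lemma spread_site:
  assumes ps: "distinct ps" "set ps \<subseteq> {..<m}" and qs: "set qs \<subseteq> {..<length ps}"
  shows "spread m ps (site qs X) = spread m (map ((!) ps) qs) X"
proof (rule blk_cong, unfold top_eq_def, intro ballI)
  fix I J :: "'a list" assume I: "I \<in> multi_indices m" and J: "J \<in> multi_indices m"
  have "(\<forall>x<m. x \<notin> set ps \<longrightarrow> I ! x = J ! x) \<and> (\<forall>y<length ps. y \<notin> set qs \<longrightarrow> I ! (ps ! y) = J ! (ps ! y))
      \<longleftrightarrow> (\<forall>x<m. x \<notin> (!) ps ` set qs \<longrightarrow> I ! x = J ! x)" (is "?l1 \<and> ?l2 \<longleftrightarrow> ?r")
  proof (intro iffI conjI allI impI)
    fix x assume l: "?l1 \<and> ?l2" and x: "x < m" "x \<notin> (!) ps ` set qs"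
    show "I ! x = J ! x"
    proof (cases "x \<in> set ps")
      case True
      then obtain y where "y < length ps" "x = ps ! y" by (auto simp: in_set_conv_nth)
      then show ?thesis using l x by auto
    qed (use l x in auto)
  next
    fix x assume r: ?r and x: "x < m" "x \<notin> set ps"
    have "x \<notin> (!) ps ` set qs" using x qs by (auto simp: subset_iff)
    then show "I ! x = J ! x" using r x by blast
  next
    fix y assume r: ?r and y: "y < length ps" "y \<notin> set qs"
    have "ps ! y \<notin> (!) ps ` set qs"
      using y qs ps(1) by (auto simp: subset_iff nth_eq_iff_index_eq)
    moreover have "ps ! y < m" using ps(2) y by (auto simp: subset_iff)
    ultimately show "I ! (ps ! y) = J ! (ps ! y)" using r by blast
  qed
  moreover have restrict: "map ((!) (map ((!) K) ps)) qs = map ((!) K) (map ((!) ps) qs)" for K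
    using qs by auto
  moreover have "(\<forall>y<length (map ((!) I) ps). y \<notin> set qs \<longrightarrow> map ((!) I) ps ! y = map ((!) J) ps ! y) \<longleftrightarrow> ?l2"
    by simp
  moreover have "(if P then if Q then c else 0 else 0) = (if P \<and> Q then c else 0)" for P Q and c :: 'b
    by simp
  ultimately show "site ps (site qs X) I J = site (map ((!) ps) qs) X I J"
    using I unfolding site_def restrict by (simp only: in_multi_indices_iff set_map)
qed

text \<open>
  In a product of operators in disjoint tensor factors the intermediate multi-index is forced: it
  agrees with the column index in the first set of factors and with the row index elsewhere.
\<close>

lemma ent_spread_mult_disjoint:
  fixes X Y :: "('n::finite, 'a::ring_1) tensor_op"
  assumes disj: "set ps \<inter> set qs = {}" and bd: "set ps \<subseteq> {..<m}" "set qs \<subseteq> {..<m}"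
    and I: "length I = m" and J: "length J = m"
  shows "ent (spread m ps X * spread m qs Y) I J =
    (if \<forall>x<m. x \<notin> set ps \<union> set qs \<longrightarrow> I ! x = J ! x
     then X (map ((!) I) ps) (map ((!) J) ps) * Y (map ((!) I) qs) (map ((!) J) qs) else 0)"
proof -
  define K where "K = map (\<lambda>x. if x \<in> set ps then J ! x else I ! x) [0..<m]"
  have K: "length K = m" by (simp add: K_def)
  have "site ps X I K' * site qs Y K' J =
      (if K' = K then site ps X I K * site qs Y K J else 0)" if "length K' = m" for K'
  proof (cases "K' = K")
    case False
    have "\<not> ((\<forall>x<m. x \<notin> set ps \<longrightarrow> I ! x = K' ! x) \<and> (\<forall>x<m. x \<notin> set qs \<longrightarrow> K' ! x = J ! x))"
    proof
      assume "(\<forall>x<m. x \<notin> set ps \<longrightarrow> I ! x = K' ! x) \<and> (\<forall>x<m. x \<notin> set qs \<longrightarrow> K' ! x = J ! x)"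
      then have "K' = K"
        using that disj by (intro nth_equalityI) (auto simp: K_def)
      with False show False by simp
    qed
    with False show ?thesis using I that by (auto simp: site_def)
  qed simp
  then have "ent (spread m ps X * spread m qs Y) I J
      = (\<Sum>K'\<in>multi_indices m. if K' = K then site ps X I K * site qs Y K J else 0)"
    using I J by (simp add: ent_ops blk.rep_eq)
  also have "\<dots> = site ps X I K * site qs Y K J" using K by simp
  also have "\<dots> = (if \<forall>x<m. x \<notin> set ps \<union> set qs \<longrightarrow> I ! x = J ! x
     then X (map ((!) I) ps) (map ((!) J) ps) * Y (map ((!) I) qs) (map ((!) J) qs) else 0)"
  proof -
    have 1: "map ((!) K) ps = map ((!) J) ps" using bd(1) by (intro map_cong refl) (auto simp: K_def subset_iff)
    have 2: "map ((!) K) qs = map ((!) I) qs" using bd(2) disj by (intro map_cong refl) (auto simp: K_def subset_iff disjoint_iff)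
    have 3: "\<forall>x<m. x \<notin> set ps \<longrightarrow> I ! x = K ! x" by (simp add: K_def)
    have 4: "(\<forall>x<m. x \<notin> set qs \<longrightarrow> K ! x = J ! x) \<longleftrightarrow> (\<forall>x<m. x \<notin> set ps \<union> set qs \<longrightarrow> I ! x = J ! x)"
      by (auto simp: K_def)
    have "site ps X I K = X (map ((!) I) ps) (map ((!) J) ps)"
      unfolding site_def I 1 by (rule if_P[OF 3])
    moreover have "site qs Y K J = (if \<forall>x<m. x \<notin> set ps \<union> set qs \<longrightarrow> I ! x = J ! x
        then Y (map ((!) I) qs) (map ((!) J) qs) else 0)"
      unfolding site_def K 2 4 ..
    ultimately show ?thesis by auto
  qed
  finally show ?thesis .
qed

definition central_op :: "('n, 'a::ring_1) tensor_op \<Rightarrow> bool"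
  where "central_op X \<longleftrightarrow> (\<forall>I J r. X I J * r = r * X I J)"

lemma central_entries_spread: "central_op X \<Longrightarrow> central_entries (spread m ps X)"
  by (simp add: central_op_def central_entries_def blk.rep_eq site_def)

lemma spread_commute_disjoint:
  fixes X Y :: "('n::finite, 'a::ring_1) tensor_op"
  assumes "set ps \<inter> set qs = {}" "set ps \<subseteq> {..<m}" "set qs \<subseteq> {..<m}" and X: "central_op X"
  shows "spread m ps X * spread m qs Y = spread m qs Y * spread m ps X"
proof (rule lmat_eqI)
  fix I J :: "'n list" assume len: "length I = length J"
  show "ent (spread m ps X * spread m qs Y) I J = ent (spread m qs Y * spread m ps X) I J"
  proof (cases "length I = m")
    case True
    have "ent (spread m ps X * spread m qs Y) I J =
    (if \<forall>x<m. x \<notin> set ps \<union> set qs \<longrightarrow> I ! x = J ! x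
     then X (map ((!) I) ps) (map ((!) J) ps) * Y (map ((!) I) qs) (map ((!) J) qs) else 0)"
      using assms len True by (intro ent_spread_mult_disjoint) auto
    moreover have "ent (spread m qs Y * spread m ps X) I J =
    (if \<forall>x<m. x \<notin> set qs \<union> set ps \<longrightarrow> I ! x = J ! x
     then Y (map ((!) I) qs) (map ((!) J) qs) * X (map ((!) I) ps) (map ((!) J) ps) else 0)"
      using assms len True by (intro ent_spread_mult_disjoint) auto
    ultimately show ?thesis using X by (auto simp: central_op_def)
  qed (use len in \<open>simp add: ent_ops blk.rep_eq\<close>)
qed

lemma sum_multi_indices_append:
  fixes f :: "'n::finite list \<Rightarrow> 'n list \<Rightarrow> 'a::comm_monoid_add"
  shows "(\<Sum>I\<in>multi_indices (k + l). f (take k I) (drop k I)) =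
    (\<Sum>I\<in>multi_indices k. \<Sum>J\<in>multi_indices l. f I J)"
proof -
  have "bij_betw (\<lambda>(I, J). I @ J) (multi_indices k \<times> multi_indices l) (multi_indices (k + l) :: 'n list set)"
    by (rule bij_betwI[where g = "\<lambda>I. (take k I, drop k I)"]) auto
  then have "(\<Sum>I\<in>multi_indices (k + l). f (take k I) (drop k I))
      = (\<Sum>p\<in>multi_indices k \<times> multi_indices l. f (take k (case p of (I, J) \<Rightarrow> I @ J)) (drop k (case p of (I, J) \<Rightarrow> I @ J)))"
    by (rule sum.reindex_bij_betw[symmetric])
  also have "\<dots> = (\<Sum>p\<in>multi_indices k \<times> multi_indices l. f (fst p) (snd p))"
    by (intro sum.cong) auto
  also have "\<dots> = (\<Sum>I\<in>multi_indices k. \<Sum>J\<in>multi_indices l. f I J)"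
    by (simp add: sum.cartesian_product split_def)
  finally show ?thesis .
qed

text \<open>
  The factors of the product on the right appear in the order of the operators on the left,
  whatever the positions \<open>ps\<close> and \<open>qs\<close> are.
\<close>

lemma ltrace_spread_mult_disjoint:
  fixes X Y :: "('n::finite, 'a::ring_1) tensor_op"
  assumes d: "distinct (ps @ qs)" and cover: "set (ps @ qs) = {..<m}"
  shows "ltrace m (spread m ps X * spread m qs Y) = top_trace (length ps) X * top_trace (length qs) Y"
proof -
  have m: "m = length ps + length qs"
    using distinct_card[OF d] cover by simp
  let ?f = "\<lambda>I J. X I I * Y J J"
  have disj: "set ps \<inter> set qs = {}" using d by auto
  have bd: "set ps \<subseteq> {..<m}" "set qs \<subseteq> {..<m}" using cover by auto
  have "ltrace m (spread m ps X * spread m qs Y)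
      = (\<Sum>I\<in>multi_indices m. ?f (map ((!) I) ps) (map ((!) I) qs))"
    unfolding ltrace_def by (intro sum.cong refl) (subst ent_spread_mult_disjoint[OF disj bd], auto)
  also have "\<dots> = (\<Sum>I\<in>multi_indices m. (\<lambda>W. ?f (take (length ps) W) (drop (length ps) W)) (map ((!) I) (ps @ qs)))"
    by simp
  also have "\<dots> = (\<Sum>W\<in>multi_indices (length (ps @ qs)). ?f (take (length ps) W) (drop (length ps) W))"
  proof -
    let ?I = "replicate m undefined :: 'n list"
    have "{K \<in> multi_indices m. \<forall>x<m. x \<notin> set (ps @ qs) \<longrightarrow> ?I ! x = K ! x} = multi_indices m"
      unfolding cover by auto
    moreover have "set (ps @ qs) \<subseteq> {..<m}" using cover by (rule equalityD1)
    ultimately have "bij_betw (\<lambda>K :: 'n list. map ((!) K) (ps @ qs)) (multi_indices m) (multi_indices (length (ps @ qs)))"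
      using map_nth_bij_betw[OF d, of m ?I] by (metis length_replicate)
    then show ?thesis by (rule sum.reindex_bij_betw)
  qed
  also have "\<dots> = (\<Sum>I\<in>multi_indices (length ps). \<Sum>J\<in>multi_indices (length qs). ?f I J)"
    using sum_multi_indices_append[of ?f] by simp
  also have "\<dots> = top_trace (length ps) X * top_trace (length qs) Y"
    by (simp add: top_trace_def sum_product)
  finally show ?thesis .
qed

lemma blk_eq_spread: "blk m X = spread m [0..<m] X"
proof (rule blk_cong, unfold top_eq_def, intro ballI)
  fix I J :: "'a list" assume "I \<in> multi_indices m" "J \<in> multi_indices m"
  moreover from this have "map ((!) I) [0..<m] = I" "map ((!) J) [0..<m] = J"
    using map_nth[of I] map_nth[of J] by simp_all
  ultimately show "X I J = site [0..<m] X I J" by (simp add: site_def)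
qed

lemma blk_act_at:
  assumes a: "a < m"
  shows "blk m (act_at a M) = spread m [a] (\<lambda>I J. M $ (I ! 0) $ (J ! 0))"
proof (rule blk_cong, unfold top_eq_def, intro ballI)
  fix I J :: "'a list" assume I: "I \<in> multi_indices m" and J: "J \<in> multi_indices m"
  have "take a I = take a J \<and> drop (a + 1) I = drop (a + 1) J \<longleftrightarrow> (\<forall>x<m. x \<noteq> a \<longrightarrow> I ! x = J ! x)"
    (is "?l \<longleftrightarrow> ?r")
  proof
    assume l: ?l
    show ?r
    proof (intro allI impI)
      fix x assume x: "x < m" "x \<noteq> a"
      then consider "x < a" | "a + 1 \<le> x" by linarith
      then show "I ! x = J ! x"
      proof cases
        case 1 then show ?thesis using l by (metis nth_take)
      next
        case 2
        then obtain d where d: "x = a + 1 + d" using le_Suc_ex by blast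
        have len: "a + 1 + d < length I" "a + 1 + d < length J" using x(1) I J unfolding d by simp_all
        have "drop (a + 1) I ! d = drop (a + 1) J ! d" using l by metis
        then show ?thesis using len unfolding d by (simp only: nth_drop add_leD1 less_imp_le)
      qed
    qed
  next
    assume ?r
    then show ?l using I J a by (auto intro!: nth_equalityI)
  qed
  then show "act_at a M I J = site [a] (\<lambda>I J. M $ (I ! 0) $ (J ! 0)) I J"
    using I J by (auto simp: act_at_def site_def)
qed

lemma blk_act_adjacent:
  assumes a: "a + 1 < m"
  shows "blk m (act_adjacent a X) = spread m [a, a + 1] X"
proof (rule blk_cong, unfold top_eq_def, intro ballI)
  fix I J :: "'a list" assume I: "I \<in> multi_indices m" and J: "J \<in> multi_indices m"
  have "take a I = take a J \<and> drop (a + 2) I = drop (a + 2) J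
      \<longleftrightarrow> (\<forall>x<m. x \<noteq> a \<and> x \<noteq> Suc a \<longrightarrow> I ! x = J ! x)" (is "?l \<longleftrightarrow> ?r")
  proof
    assume l: ?l
    show ?r
    proof (intro allI impI)
      fix x assume x: "x < m" "x \<noteq> a \<and> x \<noteq> Suc a"
      then consider "x < a" | "a + 2 \<le> x" by linarith
      then show "I ! x = J ! x"
      proof cases
        case 1 then show ?thesis using l by (metis nth_take)
      next
        case 2
        then obtain d where d: "x = a + 2 + d" using le_Suc_ex by blast
        have len: "a + 2 + d < length I" "a + 2 + d < length J" using x(1) I J unfolding d by simp_all
        have "drop (a + 2) I ! d = drop (a + 2) J ! d" using l by metis
        then show ?thesis using len unfolding d by (simp only: nth_drop add_leD1 less_imp_le)
      qed
    qed
  next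
    assume ?r
    then show ?l using I J a by (auto intro!: nth_equalityI)
  qed
  then show "act_adjacent a X I J = site [a, a + 1] X I J"
    using I J by (auto simp: act_adjacent_def site_def)
qed

section \<open>Ordered products\<close>

primrec oprod :: "(nat \<Rightarrow> 'r::monoid_mult) \<Rightarrow> nat \<Rightarrow> 'r"
  where
    "oprod f 0 = 1"
  | "oprod f (Suc k) = oprod f k * f k"

primrec oprod_rev :: "(nat \<Rightarrow> 'r::monoid_mult) \<Rightarrow> nat \<Rightarrow> 'r"
  where
    "oprod_rev f 0 = 1"
  | "oprod_rev f (Suc k) = f k * oprod_rev f k"

lemma oprod_cong: "(\<And>i. i < k \<Longrightarrow> f i = g i) \<Longrightarrow> oprod f k = oprod g k"
  by (induction k) simp_all

lemma oprod_add: "oprod f (k + l) = oprod f k * oprod (\<lambda>i. f (k + i)) l"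
  by (induction l) (simp_all add: mult.assoc)

lemma oprod_commute:
  assumes "\<And>i. i < k \<Longrightarrow> y * f i = f i * y"
  shows "y * oprod f k = oprod f k * y"
  using assms
proof (induction k)
  case (Suc k)
  have "y * oprod f (Suc k) = (y * oprod f k) * f k" by (simp add: mult.assoc)
  also have "\<dots> = oprod f k * (y * f k)" using Suc by (simp add: mult.assoc)
  also have "\<dots> = oprod f (Suc k) * y" using Suc.prems[of k] by (simp add: mult.assoc)
  finally show ?case .
qed simp

lemma oprod_mult_oprod:
  assumes "\<And>i j. i < j \<Longrightarrow> j < k \<Longrightarrow> f j * g i = g i * f j"
  shows "oprod f k * oprod g k = oprod (\<lambda>i. f i * g i) k"
  using assms
proof (induction k)
  case (Suc k)
  have "oprod f (Suc k) * oprod g (Suc k) = oprod f k * (f k * oprod g k) * g k"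
    by (simp add: mult.assoc)
  also have "f k * oprod g k = oprod g k * f k"
    by (rule oprod_commute) (use Suc.prems in auto)
  also have "oprod f k * (oprod g k * f k) * g k = (oprod f k * oprod g k) * (f k * g k)"
    by (simp add: mult.assoc)
  also have "oprod f k * oprod g k = oprod (\<lambda>i. f i * g i) k"
    by (rule Suc.IH) (use Suc.prems in auto)
  finally show ?case by simp
qed simp

lemma oprod_closed:
  assumes "1 \<in> G" and "\<And>x y. x \<in> G \<Longrightarrow> y \<in> G \<Longrightarrow> x * y \<in> G" and "\<And>i. i < k \<Longrightarrow> f i \<in> G"
  shows "oprod f k \<in> G"
  using assms(3) by (induction k) (use assms(1,2) in auto)

text \<open>
  Membership of an ordered product in a multiplicative set only has to be checked on one product of
  two neighbouring factors when the remaining factors belong to the set.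
\<close>

lemma oprod_closed_pair:
  assumes G: "1 \<in> G" "\<And>x y. x \<in> G \<Longrightarrow> y \<in> G \<Longrightarrow> x * y \<in> G"
    and a: "a + 1 < k" and pair: "f a * f (a + 1) \<in> G"
    and other: "\<And>i. i < k \<Longrightarrow> i \<noteq> a \<Longrightarrow> i \<noteq> a + 1 \<Longrightarrow> f i \<in> G"
  shows "oprod f k \<in> G"
proof -
  obtain l where k: "k = (a + 2) + l" using a le_Suc_ex[of "a + 2" k] by auto
  have "oprod f a \<in> G" by (rule oprod_closed[OF G]) (use other k in auto)
  then have "oprod f (a + 2) \<in> G" using G(2)[OF _ pair] by (simp add: mult.assoc numeral_2_eq_2)
  moreover have "oprod (\<lambda>i. f ((a + 2) + i)) l \<in> G"
    by (rule oprod_closed[OF G]) (use other k in auto)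
  ultimately show ?thesis unfolding k oprod_add by (rule G(2))
qed

lemma oprod_rev_closed:
  assumes "1 \<in> G" and "\<And>x y. x \<in> G \<Longrightarrow> y \<in> G \<Longrightarrow> x * y \<in> G" and "\<And>i. i < k \<Longrightarrow> f i \<in> G"
  shows "oprod_rev f k \<in> G"
  using assms(3) by (induction k) (use assms(1,2) in auto)

lemma oprod_rev_closed_pair:
  assumes G: "1 \<in> G" "\<And>x y. x \<in> G \<Longrightarrow> y \<in> G \<Longrightarrow> x * y \<in> G"
    and a: "a + 1 < k" and pair: "f (a + 1) * f a \<in> G"
    and other: "\<And>i. i < k \<Longrightarrow> i \<noteq> a \<Longrightarrow> i \<noteq> a + 1 \<Longrightarrow> f i \<in> G"
  shows "oprod_rev f k \<in> G"
proof -
  have "a + 2 \<le> k" using a by simp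
  then show ?thesis using other
  proof (induction k rule: dec_induct)
    case base
    have "oprod_rev f a \<in> G" by (rule oprod_rev_closed[OF G]) (use base in auto)
    then show ?case using G(2)[OF pair] by (simp add: mult.assoc numeral_2_eq_2)
  next
    case (step n)
    then show ?case by (auto intro!: G(2))
  qed
qed

text \<open>
  The next two lemmas fuse elementary exchange relations: the first one for a product of factors
  \<open>x a\<close> that passes one \<open>y\<close>, the second one for a fixed \<open>x\<close> that passes a product of
  factors \<open>y b\<close>.  The exchanging elements multiply in the order of the \<open>x a\<close>, but in the
  opposite order of the \<open>y b\<close>.
\<close>

lemma oprod_rev_shift: "oprod_rev f (Suc n) = oprod_rev (\<lambda>i. f (Suc i)) n * f 0"
  by (induction n) (simp_all add: mult.assoc)

lemma oprod_exchange:
  assumes ex: "\<And>a. a < k \<Longrightarrow> r a * x a * y = y * x a * r a"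
    and comm: "\<And>a b. a < k \<Longrightarrow> b < k \<Longrightarrow> a \<noteq> b \<Longrightarrow> r a * x b = x b * r a"
  shows "oprod r k * oprod x k * y = y * oprod x k * oprod r k"
  using assms
proof (induction k)
  case (Suc k)
  have 1: "r k * oprod x k = oprod x k * r k" by (rule oprod_commute) (use Suc.prems in auto)
  have 2: "x k * oprod r k = oprod r k * x k" by (rule oprod_commute) (use Suc.prems in auto)
  have 3: "oprod r k * oprod x k * y = y * oprod x k * oprod r k" by (rule Suc.IH) (use Suc.prems in auto)
  have "oprod r (Suc k) * oprod x (Suc k) * y = oprod r k * (r k * oprod x k) * x k * y"
    by (simp add: mult.assoc)
  also have "\<dots> = oprod r k * oprod x k * (r k * x k * y)" unfolding 1 by (simp add: mult.assoc)
  also have "\<dots> = (oprod r k * oprod x k * y) * x k * r k"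
    using Suc.prems(1)[of k] by (simp add: mult.assoc)
  also have "\<dots> = y * oprod x k * (oprod r k * x k) * r k" unfolding 3 by (simp add: mult.assoc)
  also have "\<dots> = y * oprod x (Suc k) * oprod r (Suc k)" unfolding 2[symmetric] by (simp add: mult.assoc)
  finally show ?case .
qed simp

lemma oprod_rev_exchange:
  assumes ex: "\<And>b. b < l \<Longrightarrow> c b * x * y b = y b * x * c b"
    and comm: "\<And>a b. a < l \<Longrightarrow> b < l \<Longrightarrow> a \<noteq> b \<Longrightarrow> c a * y b = y b * c a"
  shows "oprod_rev c l * x * oprod y l = oprod y l * x * oprod_rev c l"
  using assms
proof (induction l)
  case (Suc l)
  have 1: "c l * oprod y l = oprod y l * c l" by (rule oprod_commute) (use Suc.prems in auto)
  have "oprod_rev c l \<in> {u. y l * u = u * y l}"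
    by (rule oprod_rev_closed) (use Suc.prems(2) in \<open>auto simp: mult.assoc\<close>, metis mult.assoc)
  then have 2: "oprod_rev c l * y l = y l * oprod_rev c l" by simp
  have 3: "oprod_rev c l * x * oprod y l = oprod y l * x * oprod_rev c l"
    by (rule Suc.IH) (use Suc.prems in auto)
  have "oprod_rev c (Suc l) * x * oprod y (Suc l) = c l * (oprod_rev c l * x * oprod y l) * y l"
    by (simp add: mult.assoc)
  also have "\<dots> = (c l * oprod y l) * x * (oprod_rev c l * y l)" unfolding 3 by (simp add: mult.assoc)
  also have "\<dots> = oprod y l * (c l * x * y l) * oprod_rev c l" unfolding 1 2 by (simp add: mult.assoc)
  also have "\<dots> = oprod y (Suc l) * x * oprod_rev c (Suc l)"
    using Suc.prems(1)[of l] by (simp add: mult.assoc)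
  finally show ?case .
qed simp

section \<open>Antisymmetrizers in a representation of the symmetric group\<close>

lemma permutes_adjacent_induct [consumes 1, case_names id swap]:
  fixes k :: nat
  assumes \<tau>: "\<tau> permutes {..<k}" and id: "P id"
    and step: "\<And>a \<sigma>. a + 1 < k \<Longrightarrow> \<sigma> permutes {..<k} \<Longrightarrow> P \<sigma>
      \<Longrightarrow> P (\<sigma> \<circ> Transposition.transpose a (a + 1))"
  shows "P \<tau>"
proof -
  have adj: "Transposition.transpose a (a + 1) permutes {..<k}" if "a + 1 < k" for a
    using that by (intro permutes_swap_id) auto
  have transp: "P (\<sigma> \<circ> Transposition.transpose a (a + 1 + d))"
    if "a + 1 + d < k" "\<sigma> permutes {..<k}" "P \<sigma>" for a d \<sigma>
    using that
  proof (induction d arbitrary: \<sigma>)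
    case 0
    then show ?case using step[of a \<sigma>] by (simp only: add_0_right)
  next
    case (Suc d)
    let ?t = "Transposition.transpose (a + 1 + d) (a + 1 + d + 1)"
    have 1: "P (\<sigma> \<circ> ?t)" by (rule step) (use Suc in auto)
    have p1: "\<sigma> \<circ> ?t permutes {..<k}"
      using Suc.prems adj[of "a + 1 + d"] by (intro permutes_compose) auto
    have 2: "P (\<sigma> \<circ> ?t \<circ> Transposition.transpose a (a + 1 + d))"
      by (rule Suc.IH[OF _ p1 1]) (use Suc in auto)
    have p2: "\<sigma> \<circ> ?t \<circ> Transposition.transpose a (a + 1 + d) permutes {..<k}"
      using Suc.prems by (intro permutes_compose p1 permutes_swap_id) auto
    have "P (\<sigma> \<circ> ?t \<circ> Transposition.transpose a (a + 1 + d) \<circ> ?t)"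
      by (rule step[OF _ p2 2]) (use Suc in auto)
    moreover have "?t \<circ> Transposition.transpose a (a + 1 + d) \<circ> ?t = Transposition.transpose a (a + 1 + Suc d)"
      by (auto simp: fun_eq_iff Transposition.transpose_def)
    ultimately show ?case by (simp only: comp_assoc)
  qed
  have fin: "finite {..<k}" by simp
  show ?thesis
    using fin \<tau>
  proof (induction rule: permutes_rev_induct)
    case (swap a b \<sigma>)
    then consider d where "b = a + 1 + d" | d where "a = b + 1 + d"
      by (metis add.commute add_Suc_right less_iff_Suc_add linorder_neqE_nat plus_1_eq_Suc)
    then show ?case
    proof cases
      case 1
      show ?thesis unfolding 1 by (rule transp) (use swap 1 in auto)
    next
      case 2
      show ?thesis unfolding 2 Transposition.transpose_commute[of "b + 1 + d" b]
        by (rule transp) (use swap 2 in auto)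
    qed
  qed (rule id)
qed

text \<open>
  The value of a representation at \<open>id\<close> is an idempotent; in the application it is the unit of
  one block.
\<close>

locale perm_rep =
  fixes k :: nat and \<rho> :: "(nat \<Rightarrow> nat) \<Rightarrow> 'r::ring_1"
  assumes rep_comp: "\<sigma> permutes {..<k} \<Longrightarrow> \<tau> permutes {..<k} \<Longrightarrow> \<rho> (\<sigma> \<circ> \<tau>) = \<rho> \<sigma> * \<rho> \<tau>"
begin

definition anti :: "nat \<Rightarrow> 'r"
  where "anti j = (\<Sum>\<tau>\<in>{\<tau>. \<tau> permutes {..<j}}. of_int (sign \<tau>) * \<rho> \<tau>)"

lemma permutes_mono: "\<tau> permutes {..<j} \<Longrightarrow> j \<le> k \<Longrightarrow> \<tau> permutes {..<k}"
  by (erule permutes_subset) auto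

lemma sign_comp:
  "\<sigma> permutes {..<j::nat} \<Longrightarrow> \<tau> permutes {..<j} \<Longrightarrow> sign (\<sigma> \<circ> \<tau>) = sign \<sigma> * sign \<tau>"
  by (intro sign_compose permutes_imp_permutation[of "{..<j}"]) auto

lemma anti_mult_rep:
  assumes j: "j \<le> k" and \<sigma>: "\<sigma> permutes {..<j}"
  shows "anti j * \<rho> \<sigma> = of_int (sign \<sigma>) * anti j"
proof -
  have "anti j * \<rho> \<sigma> = (\<Sum>\<tau>\<in>{\<tau>. \<tau> permutes {..<j}}. of_int (sign \<tau>) * \<rho> (\<tau> \<circ> \<sigma>))"
    unfolding anti_def sum_distrib_right
    using j \<sigma> by (intro sum.cong refl) (simp add: rep_comp permutes_mono mult.assoc)
  also have "\<dots> = (\<Sum>\<tau>\<in>{\<tau>. \<tau> permutes {..<j}}. of_int (sign \<sigma>) * (of_int (sign (\<tau> \<circ> \<sigma>)) * \<rho> (\<tau> \<circ> \<sigma>)))"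
  proof (intro sum.cong refl)
    fix \<tau> assume "\<tau> \<in> {\<tau>. \<tau> permutes {..<j}}"
    then have "sign \<sigma> * sign (\<tau> \<circ> \<sigma>) = sign \<tau>" using \<sigma> by (simp add: sign_comp mult.left_commute)
    then show "of_int (sign \<tau>) * \<rho> (\<tau> \<circ> \<sigma>) = of_int (sign \<sigma>) * (of_int (sign (\<tau> \<circ> \<sigma>)) * \<rho> (\<tau> \<circ> \<sigma>))"
      by (metis mult.assoc of_int_mult)
  qed
  also have "\<dots> = of_int (sign \<sigma>) * anti j"
    unfolding anti_def sum_distrib_left
    by (rule sum_permutations_compose_right[OF \<sigma>, symmetric])
  finally show ?thesis .
qed

lemma rep_mult_anti:
  assumes j: "j \<le> k" and \<sigma>: "\<sigma> permutes {..<j}"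
  shows "\<rho> \<sigma> * anti j = of_int (sign \<sigma>) * anti j"
proof -
  have "\<rho> \<sigma> * anti j = (\<Sum>\<tau>\<in>{\<tau>. \<tau> permutes {..<j}}. of_int (sign \<tau>) * \<rho> (\<sigma> \<circ> \<tau>))"
    unfolding anti_def sum_distrib_left
    using j \<sigma> by (intro sum.cong refl) (simp add: rep_comp permutes_mono, metis mult.assoc mult_of_int_commute)
  also have "\<dots> = (\<Sum>\<tau>\<in>{\<tau>. \<tau> permutes {..<j}}. of_int (sign \<sigma>) * (of_int (sign (\<sigma> \<circ> \<tau>)) * \<rho> (\<sigma> \<circ> \<tau>)))"
  proof (intro sum.cong refl)
    fix \<tau> assume "\<tau> \<in> {\<tau>. \<tau> permutes {..<j}}"
    then have "sign \<sigma> * sign (\<sigma> \<circ> \<tau>) = sign \<tau>" using \<sigma> by (simp add: sign_comp)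
    then show "of_int (sign \<tau>) * \<rho> (\<sigma> \<circ> \<tau>) = of_int (sign \<sigma>) * (of_int (sign (\<sigma> \<circ> \<tau>)) * \<rho> (\<sigma> \<circ> \<tau>))"
      by (metis mult.assoc of_int_mult)
  qed
  also have "\<dots> = of_int (sign \<sigma>) * anti j"
    unfolding anti_def sum_distrib_left
    using \<sigma> by (intro sum.reindex_bij_witness[of _ "\<lambda>\<tau>. inv \<sigma> \<circ> \<tau>" "\<lambda>\<tau>. \<sigma> \<circ> \<tau>"])
      (auto simp: permutes_inv_o o_assoc intro!: permutes_compose permutes_inv)
  finally show ?thesis .
qed

text \<open>
  Right antisymmetry under the adjacent transpositions extends to all permutations because these
  transpositions generate the symmetric group.
\<close>

lemma mult_rep_sign:
  assumes j: "j \<le> k" and \<tau>: "\<tau> permutes {..<j}" and X: "X * \<rho> id = X"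
    and adj: "\<And>a. a + 1 < j \<Longrightarrow> X * \<rho> (Transposition.transpose a (a + 1)) = - X"
  shows "X * \<rho> \<tau> = of_int (sign \<tau>) * X"
  using \<tau>
proof (induction rule: permutes_adjacent_induct)
  case (swap a \<sigma>)
  let ?s = "Transposition.transpose a (a + 1)"
  have s: "?s permutes {..<j}" using swap by (intro permutes_swap_id) auto
  have "X * \<rho> (\<sigma> \<circ> ?s) = X * \<rho> \<sigma> * \<rho> ?s"
    using swap(2) s j by (simp add: rep_comp permutes_mono mult.assoc)
  also have "\<dots> = of_int (sign \<sigma>) * (X * \<rho> ?s)"
    unfolding swap.IH by (rule mult.assoc)
  also have "\<dots> = of_int (sign (\<sigma> \<circ> ?s)) * X"
    using swap s adj[of a] by (simp add: sign_comp sign_swap_id)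
  finally show ?case .
qed (simp only: X sign_id of_int_1 mult_1_left)

lemma mult_anti:
  assumes j: "j \<le> k" and X: "X * \<rho> id = X"
    and adj: "\<And>a. a + 1 < j \<Longrightarrow> X * \<rho> (Transposition.transpose a (a + 1)) = - X"
  shows "X * anti j = of_nat (fact j) * X"
proof -
  have "X * (of_int (sign \<tau>) * \<rho> \<tau>) = X" if "\<tau> permutes {..<j}" for \<tau>
  proof -
    have "X * (of_int (sign \<tau>) * \<rho> \<tau>) = of_int (sign \<tau>) * (X * \<rho> \<tau>)"
      by (metis mult.assoc mult_of_int_commute)
    also have "\<dots> = of_int (sign \<tau> * sign \<tau>) * X"
      using mult_rep_sign[OF j that X adj] by (simp only: of_int_mult mult.assoc)
    finally show ?thesis by simp
  qed
  then have "X * anti j = (\<Sum>\<tau>\<in>{\<tau>. \<tau> permutes {..<j}}. X)"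
    unfolding anti_def sum_distrib_left by (intro sum.cong) auto
  also have "\<dots> = of_nat (fact j) * X"
    by (simp add: card_permutations)
  finally show ?thesis .
qed

text \<open>
  Every permutation of \<open>{..<Suc j}\<close> is, in exactly one way, the identity or a transposition
  \<open>(a j)\<close> composed with a permutation of \<open>{..<j}\<close>.
\<close>

lemma anti_Suc:
  assumes j: "Suc j \<le> k"
  shows "anti (Suc j) = (\<rho> id - (\<Sum>a<j. \<rho> (Transposition.transpose a j))) * anti j"
proof -
  have ins: "{..<Suc j} = insert j {..<j}" by auto
  have ins_term: "(\<Sum>\<tau>\<in>{\<tau>. \<tau> permutes {..<j}}. of_int (sign (Transposition.transpose j b \<circ> \<tau>)) * \<rho> (Transposition.transpose j b \<circ> \<tau>))
      = of_int (sign (Transposition.transpose j b)) * (\<rho> (Transposition.transpose j b) * anti j)" if b: "b \<le> j" for b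
    unfolding anti_def sum_distrib_left
  proof (intro sum.cong refl)
    fix \<tau> assume \<tau>: "\<tau> \<in> {\<tau>. \<tau> permutes {..<j}}"
    let ?t = "Transposition.transpose j b"
    have t: "?t permutes {..<Suc j}" using b by (intro permutes_swap_id) auto
    have \<tau>': "\<tau> permutes {..<Suc j}" using \<tau> by (auto intro: permutes_subset)
    have "of_int (sign (?t \<circ> \<tau>)) * \<rho> (?t \<circ> \<tau>) = of_int (sign ?t) * (of_int (sign \<tau>) * \<rho> ?t) * \<rho> \<tau>"
      using t \<tau>' j by (simp add: sign_comp[OF t \<tau>'] rep_comp permutes_mono mult.assoc)
    also have "of_int (sign \<tau>) * \<rho> ?t = \<rho> ?t * of_int (sign \<tau>)" by (rule mult_of_int_commute)
    finally show "of_int (sign (?t \<circ> \<tau>)) * \<rho> (?t \<circ> \<tau>) = of_int (sign ?t) * (\<rho> ?t * (of_int (sign \<tau>) * \<rho> \<tau>))"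
      by (simp only: mult.assoc)
  qed
  have "anti (Suc j) = (\<Sum>b\<in>insert j {..<j}. \<Sum>\<tau>\<in>{\<tau>. \<tau> permutes {..<j}}.
      of_int (sign (Transposition.transpose j b \<circ> \<tau>)) * \<rho> (Transposition.transpose j b \<circ> \<tau>))"
    unfolding anti_def ins by (rule sum_over_permutations_insert) auto
  also have "\<dots> = (\<Sum>b\<in>insert j {..<j}. of_int (sign (Transposition.transpose j b)) * (\<rho> (Transposition.transpose j b) * anti j))"
    by (intro sum.cong refl ins_term) auto
  also have "\<dots> = \<rho> id * anti j + (\<Sum>b<j. - (\<rho> (Transposition.transpose b j) * anti j))"
    by (subst sum.insert) (auto simp: sign_swap_id id_def Transposition.transpose_commute intro!: sum.cong)
  also have "\<dots> = (\<rho> id - (\<Sum>a<j. \<rho> (Transposition.transpose a j))) * anti j"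
    by (simp add: sum_negf left_diff_distrib sum_distrib_right)
  finally show ?thesis .
qed

end

section \<open>The trigonometric R-matrix\<close>

text \<open>
  All scalar operators on two factors that occur here have this shape: a diagonal part and a part
  that interchanges the two indices.
\<close>

definition exchange_op :: "('n \<Rightarrow> 'n \<Rightarrow> complex) \<Rightarrow> ('n \<Rightarrow> 'n \<Rightarrow> complex) \<Rightarrow> ('n, complex) tensor_op"
  where "exchange_op d g I J = (if J = I then d (I ! 0) (I ! 1) else 0)
    + (if J = [I ! 1, I ! 0] then g (I ! 0) (I ! 1) else 0)"

definition top_apply :: "nat \<Rightarrow> ('n, complex) tensor_op \<Rightarrow> ('n list \<Rightarrow> complex) \<Rightarrow> 'n list \<Rightarrow> complex"
  where "top_apply m X F I = (\<Sum>J\<in>multi_indices m. X I J * F J)"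

lemma top_apply_mult:
  fixes X Y :: "('n::finite, complex) tensor_op"
  shows "top_apply m (top_mult m X Y) F I = top_apply m X (top_apply m Y F) I"
proof -
  have "(\<Sum>J\<in>multi_indices m. \<Sum>K\<in>multi_indices m. X I K * Y K J * F J) =
      (\<Sum>K\<in>multi_indices m. \<Sum>J\<in>multi_indices m. X I K * Y K J * F J)"
    by (rule sum.swap)
  then show ?thesis
    by (simp add: top_apply_def top_mult_def sum_distrib_right sum_distrib_left mult.assoc)
qed

text \<open>
  Identities between scalar operators are checked by applying both sides to functions of the
  multi-index: products of \<open>exchange_op\<close> then become sums of a few permuted values.
\<close>

lemma top_eq_applyI:
  fixes X Y :: "('n::finite, complex) tensor_op"
  assumes "\<And>F I. length I = m \<Longrightarrow> top_apply m X F I = top_apply m Y F I"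
  shows "top_eq m X Y"
  unfolding top_eq_def
proof (intro ballI)
  fix I J :: "'n list" assume I: "I \<in> multi_indices m" and J: "J \<in> multi_indices m"
  have "top_apply m Z (\<lambda>K. if K = J then 1 else 0) I = Z I J" for Z
    using J by (simp add: top_apply_def if_distrib[of "\<lambda>x. _ * x"] cong: if_cong)
  then show "X I J = Y I J" using assms[of I "\<lambda>K. if K = J then 1 else 0"] I by simp
qed

lemma top_apply_exchange:
  fixes d g :: "'n::finite \<Rightarrow> 'n \<Rightarrow> complex"
  assumes p: "p < m" and r: "r < m" and pr: "p \<noteq> r" and I: "length I = m"
  shows "top_apply m (site [p, r] (exchange_op d g)) F I =
    d (I ! p) (I ! r) * F I + g (I ! p) (I ! r) * F (I[p := I ! r, r := I ! p])"
proof -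
  let ?s = "I[p := I ! r, r := I ! p]"
  have "site [p, r] (exchange_op d g) I J =
      (if J = I then d (I ! p) (I ! r) else 0) + (if J = ?s then g (I ! p) (I ! r) else 0)"
    if J: "length J = m" for J
  proof -
    define A where "A \<longleftrightarrow> (\<forall>x<m. x \<notin> set [p, r] \<longrightarrow> I ! x = J ! x)"
    have 1: "J = I \<longleftrightarrow> A \<and> [J ! p, J ! r] = [I ! p, I ! r]"
      unfolding A_def using I J p r by (auto intro!: nth_equalityI)
    have 2: "J = ?s \<longleftrightarrow> A \<and> [J ! p, J ! r] = [I ! r, I ! p]"
    proof
      assume "A \<and> [J ! p, J ! r] = [I ! r, I ! p]"
      then show "J = ?s"
        unfolding A_def using I J p r pr by (intro nth_equalityI) (auto simp: nth_list_update)
    qed (unfold A_def, use I p r pr in \<open>auto simp: nth_list_update\<close>)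
    have "site [p, r] (exchange_op d g) I J = (if A then
        (if [J ! p, J ! r] = [I ! p, I ! r] then d (I ! p) (I ! r) else 0)
        + (if [J ! p, J ! r] = [I ! r, I ! p] then g (I ! p) (I ! r) else 0) else 0)"
      unfolding site_def exchange_op_def I A_def[symmetric]
      by (simp only: list.map nth_Cons_0 One_nat_def nth_Cons_Suc)
    then show ?thesis unfolding 1 2 by simp
  qed
  then have "top_apply m (site [p, r] (exchange_op d g)) F I = (\<Sum>J\<in>multi_indices m.
      (if J = I then d (I ! p) (I ! r) * F I else 0) + (if J = ?s then g (I ! p) (I ! r) * F ?s else 0))"
    unfolding top_apply_def by (intro sum.cong refl) (auto simp: distrib_right)
  also have "\<dots> = d (I ! p) (I ! r) * F I + g (I ! p) (I ! r) * F ?s"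
    using I by (simp add: sum.distrib)
  finally show ?thesis .
qed

text \<open>
  The entries of \<open>(x - y) R(x/y)\<close>.  They are polynomials in \<open>x\<close> and \<open>y\<close>, and all the relations
  below are homogeneous in them.
\<close>

definition r_diag :: "complex \<Rightarrow> complex \<Rightarrow> complex \<Rightarrow> 'n::linorder \<Rightarrow> 'n \<Rightarrow> complex"
  where "r_diag q x y i j = (if i = j then q * x - inverse q * y else x - y)"

definition r_off :: "complex \<Rightarrow> complex \<Rightarrow> complex \<Rightarrow> 'n::linorder \<Rightarrow> 'n \<Rightarrow> complex"
  where "r_off q x y i j = (if i = j then 0 else (q - inverse q) * (if i < j then x else y))"

abbreviation r_hom :: "complex \<Rightarrow> complex \<Rightarrow> complex \<Rightarrow> ('n::linorder, complex) tensor_op"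
  where "r_hom q x y \<equiv> exchange_op (r_diag q x y) (r_off q x y)"

lemma yang_baxter_hom:
  fixes q x y z :: complex
  assumes q: "q \<noteq> 0"
  shows "top_eq 3
    (top_mult 3 (top_mult 3 (site [0, 1] (r_hom q x y)) (site [0, 2] (r_hom q x z))) (site [1, 2] (r_hom q y z)))
    (top_mult 3 (top_mult 3 (site [1, 2] (r_hom q y z)) (site [0, 2] (r_hom q x z)))
      (site [0, 1] (r_hom q x y) :: ('n::{finite,linorder}, complex) tensor_op))"
proof (rule top_eq_applyI)
  fix F :: "'n list \<Rightarrow> complex" and I :: "'n list" assume "length I = 3"
  then obtain i j k where I: "I = [i, j, k]"
    by (auto simp: length_Suc_conv numeral_3_eq_3)
  obtain p where p: "inverse q = p" "q * p = 1" using q by simp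
  let ?goal = "\<lambda>i j k. top_apply 3 (top_mult 3 (top_mult 3 (site [0, 1] (r_hom q x y)) (site [0, 2] (r_hom q x z))) (site [1, 2] (r_hom q y z))) F [i, j, k]
    = top_apply 3 (top_mult 3 (top_mult 3 (site [1, 2] (r_hom q y z)) (site [0, 2] (r_hom q x z))) (site [0, 1] (r_hom q x y))) F [i, j, k]"
  note defs = top_apply_mult top_apply_exchange r_diag_def r_off_def p(1)
  \<comment> \<open>Both sides are equal as polynomials once the relative order of the three indices is fixed.\<close>
  have distinct: "?goal i j k" if "i \<noteq> j" "j \<noteq> k" "i \<noteq> k" for i j k
  proof -
    note neq = that that[symmetric]
    have flip: "j < i \<longleftrightarrow> \<not> i < j" "k < j \<longleftrightarrow> \<not> j < k" "k < i \<longleftrightarrow> \<not> i < k"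
      using that by auto
    show ?thesis
      by (cases "i < j"; cases "j < k"; cases "i < k";
          (order | simp add: defs neq flip)) (use p(2) in algebra)+
  qed
  have strict: "a \<noteq> b" "b \<noteq> a" "\<not> b < a" if "a < b" for a b :: 'n
    using that by auto
  have "?goal i i k" if "i < k" for i k
    by (simp add: defs that strict[OF that]) (use p(2) in \<open>algebra | simp add: algebra_simps\<close>)
  moreover have "?goal i i k" if "k < i" for i k
    by (simp add: defs that strict[OF that]) (use p(2) in \<open>algebra | simp add: algebra_simps\<close>)
  moreover have "?goal i k i" if "i < k" for i k
    by (simp add: defs that strict[OF that]) (use p(2) in \<open>algebra | simp add: algebra_simps\<close>)
  moreover have "?goal i k i" if "k < i" for i k
    by (simp add: defs that strict[OF that]) (use p(2) in \<open>algebra | simp add: algebra_simps\<close>)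
  moreover have "?goal k i i" if "i < k" for i k
    by (simp add: defs that strict[OF that]) (use p(2) in \<open>algebra | simp add: algebra_simps\<close>)
  moreover have "?goal k i i" if "k < i" for i k
    by (simp add: defs that strict[OF that]) (use p(2) in \<open>algebra | simp add: algebra_simps\<close>)
  moreover have "?goal i i i" for i
    by (simp add: defs)
  ultimately have "?goal i j k"
    using distinct by (metis linorder_less_linear)
  then show "top_apply 3 (top_mult 3 (top_mult 3 (site [0, 1] (r_hom q x y)) (site [0, 2] (r_hom q x z))) (site [1, 2] (r_hom q y z))) F I
    = top_apply 3 (top_mult 3 (top_mult 3 (site [1, 2] (r_hom q y z)) (site [0, 2] (r_hom q x z))) (site [0, 1] (r_hom q x y))) F I"
    unfolding I .
qed

lemma length_2_cases: "length I = 2 \<Longrightarrow> (\<And>i j. I = [i, j] \<Longrightarrow> P) \<Longrightarrow> P"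
  by (auto simp: length_Suc_conv numeral_2_eq_2)

lemma length_3_cases: "length I = 3 \<Longrightarrow> (\<And>i j k. I = [i, j, k] \<Longrightarrow> P) \<Longrightarrow> P"
  by (auto simp: length_Suc_conv numeral_3_eq_3)

lemma R_matrix_conv_hom:
  fixes q x y :: complex
  assumes "y \<noteq> 0" "x \<noteq> y"
  shows "top_eq 2 (\<lambda>I J. (x - y) * R_matrix q (x / y) I J)
    (r_hom q x y :: ('n::{finite,linorder}, complex) tensor_op)"
  unfolding top_eq_def
proof (intro ballI)
  fix I J :: "'n list" assume "I \<in> multi_indices 2" "J \<in> multi_indices 2"
  then obtain i j a b where I: "I = [i, j]" and J: "J = [a, b]"
    by (metis in_multi_indices_iff length_2_cases)
  have delta: "(\<Sum>(k, l)\<in>{(k, l). Q k l}. if k = u \<and> l = v then c k l else 0) = (if Q u v then c u v else 0)"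
    for Q and u v :: 'n and c :: "'n \<Rightarrow> 'n \<Rightarrow> complex"
  proof -
    have "(\<Sum>(k, l)\<in>{(k, l). Q k l}. if k = u \<and> l = v then c k l else 0)
        = (\<Sum>p\<in>{(k, l). Q k l}. if p = (u, v) then c u v else 0)"
      by (intro sum.cong refl) (auto split: if_splits)
    also have "\<dots> = (if Q u v then c u v else 0)" by (subst sum.delta) auto
    finally show ?thesis .
  qed
  have "(\<Sum>k\<in>UNIV. tensor2 (mat_unit k k) (mat_unit k k) I J)
      = (\<Sum>k\<in>UNIV. if k = i then (if i = j \<and> a = i \<and> b = i then 1 else 0) else 0)"
    by (intro sum.cong) (auto simp: I J tensor2_def mat_unit_def)
  also have "\<dots> = (if i = j \<and> a = i \<and> b = i then 1 else 0)" by simp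
  finally have 1: "(\<Sum>k\<in>UNIV. tensor2 (mat_unit k k) (mat_unit k k) I J)
      = (if i = j \<and> a = i \<and> b = i then 1 else 0)" .
  have "(\<Sum>(k, l)\<in>{(k, l). k \<noteq> l}. tensor2 (mat_unit k k) (mat_unit l l) I J)
      = (\<Sum>(k, l)\<in>{(k, l). k \<noteq> l}. if k = i \<and> l = j then (if a = i \<and> b = j then 1 else 0) else 0)"
    by (intro sum.cong) (auto simp: I J tensor2_def mat_unit_def)
  then have 2: "(\<Sum>(k, l)\<in>{(k, l). k \<noteq> l}. tensor2 (mat_unit k k) (mat_unit l l) I J)
      = (if i \<noteq> j then (if a = i \<and> b = j then 1 else 0) else 0)"
    by (simp only: delta)
  have t: "tensor2 (mat_unit k l) (mat_unit l k) I J
      = (if k = i \<and> l = j then (if a = j \<and> b = i then 1 else 0) else 0)" for k l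
    by (auto simp: I J tensor2_def mat_unit_def)
  have t': "x / y * tensor2 (mat_unit k l) (mat_unit l k) I J + tensor2 (mat_unit l k) (mat_unit k l) I J
      = (if k = i \<and> l = j then (if a = j \<and> b = i then x / y else 0) else 0)
      + (if k = j \<and> l = i then (if a = j \<and> b = i then 1 else 0) else 0)" for k l
    unfolding t by (cases "k = i"; cases "l = j"; cases "k = j"; cases "l = i") simp_all
  have "(\<Sum>(k, l)\<in>{(k, l). k < l}. x / y * tensor2 (mat_unit k l) (mat_unit l k) I J
      + tensor2 (mat_unit l k) (mat_unit k l) I J)
      = (\<Sum>(k, l)\<in>{(k, l). k < l}. if k = i \<and> l = j then (if a = j \<and> b = i then x / y else 0) else 0)
      + (\<Sum>(k, l)\<in>{(k, l). k < l}. if k = j \<and> l = i then (if a = j \<and> b = i then 1 else 0) else 0)"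
    unfolding sum.distrib[symmetric] split_def t' ..
  then have 3: "(\<Sum>(k, l)\<in>{(k, l). k < l}. x / y * tensor2 (mat_unit k l) (mat_unit l k) I J
      + tensor2 (mat_unit l k) (mat_unit k l) I J)
      = (if i < j then (if a = j \<and> b = i then x / y else 0) else 0)
      + (if j < i then (if a = j \<and> b = i then 1 else 0) else 0)"
    by (simp only: delta)
  have c: "(x - y) * (1 / (x / y - 1)) = y" using assms by (simp add: field_simps)
  have "(x - y) * R_matrix q (x / y) I J = y * ((q * (x / y) - inverse q) * (if i = j \<and> a = i \<and> b = i then 1 else 0)
     + (x / y - 1) * (if i \<noteq> j then (if a = i \<and> b = j then 1 else 0) else 0)
     + (q - inverse q) * ((if i < j then (if a = j \<and> b = i then x / y else 0) else 0)
      + (if j < i then (if a = j \<and> b = i then 1 else 0) else 0)))"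
    unfolding R_matrix_def 1 2 3 mult.assoc[symmetric] c ..
  also have "\<dots> = r_hom q x y I J"
  proof -
    have y: "y * (q * x / y - inverse q) = q * x - inverse q * y" "y * (x / y - 1) = x - y"
        "y * ((q - inverse q) * x / y) = (q - inverse q) * x"
      using assms(1) by (simp_all add: right_diff_distrib)
    note y = y mult.commute[of y "q - inverse q"]
    have J': "[a, b] = [i, j] \<longleftrightarrow> a = i \<and> b = j" "[a, b] = [[i, j] ! 1, [i, j] ! 0] \<longleftrightarrow> a = j \<and> b = i"
      by auto
    note defs = I J exchange_op_def r_diag_def r_off_def J' nth_Cons_0 One_nat_def nth_Cons_Suc
    consider "i = j" | "i < j" "i \<noteq> j" "\<not> j < i" | "j < i" "i \<noteq> j" "\<not> i < j" by force
    then show ?thesis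
    proof cases
      case 1 then show ?thesis unfolding defs by (cases "a = j"; cases "b = j"; simp add: y)
    next
      case 2 then show ?thesis unfolding defs by (cases "a = i \<and> b = j"; cases "a = j \<and> b = i"; (simp add: y assms(1))?; blast)
    next
      case 3 then show ?thesis unfolding defs by (cases "a = i \<and> b = j"; cases "a = j \<and> b = i"; (simp add: y assms(1))?; blast)
    qed
  qed
  finally show "(x - y) * R_matrix q (x / y) I J = r_hom q x y I J" .
qed

lemma Pq_conv_exchange:
  "top_eq 2 (Pq q) (exchange_op (\<lambda>_ _. 0) (\<lambda>i j. q powi ord_sgn i j)
    :: ('n::{finite,linorder}, complex) tensor_op)"
  unfolding top_eq_def
proof (intro ballI)
  fix I J :: "'n list" assume "I \<in> multi_indices 2" "J \<in> multi_indices 2"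
  then obtain i j a b where "I = [i, j]" "J = [a, b]"
    by (metis in_multi_indices_iff length_2_cases)
  then show "Pq q I J = exchange_op (\<lambda>_ _. 0) (\<lambda>i j. q powi ord_sgn i j) I J"
    by (auto simp: Pq_entry exchange_op_def)
qed

text \<open>At \<open>y = q\<^sup>2 x\<close> the R-matrix degenerates to a multiple of the antisymmetrizer of two factors.\<close>

lemma r_hom_degenerate:
  fixes q x :: complex
  assumes q: "q \<noteq> 0"
  shows "top_eq 2 (r_hom q x (q\<^sup>2 * x))
    (\<lambda>I J. (x - q\<^sup>2 * x) * (top_one I J - Pq q I J) :: complex)"
  unfolding top_eq_def
proof (intro ballI)
  fix I J :: "'n::{finite,linorder} list" assume "I \<in> multi_indices 2" "J \<in> multi_indices 2"
  then obtain i j a b where I: "I = [i, j]" and J: "J = [a, b]"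
    by (metis in_multi_indices_iff length_2_cases)
  define p c where "p = inverse q" and "c = x - q\<^sup>2 * x"
  have "p * q\<^sup>2 = q" using q by (simp add: p_def power2_eq_square)
  then have pq: "p * (q\<^sup>2 * x) = q * x" by (simp only: mult.assoc[symmetric])
  have "q * x - p * (q\<^sup>2 * x) = 0" unfolding pq by simp
  moreover have "(q - p) * (q\<^sup>2 * x) = c * (- q)"
    unfolding left_diff_distrib pq c_def by (simp add: algebra_simps)
  moreover have "p * (x - q\<^sup>2 * x) = p * x - q * x" unfolding right_diff_distrib pq ..
  then have "(q - p) * x = c * (- p)" unfolding c_def by (simp add: algebra_simps)
  ultimately have e: "r_diag q x (q\<^sup>2 * x) i j = (if i = j then 0 else c)"
      "r_off q x (q\<^sup>2 * x) i j = (if i = j then 0 else if i < j then c * (- p) else c * (- q))"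
    unfolding r_diag_def r_off_def p_def[symmetric] by (simp_all add: c_def)
  have s: "q powi ord_sgn i j = (if i = j then 1 else if i < j then p else q)"
    by (auto simp: ord_sgn_def p_def power_int_minus)
  have J': "[a, b] = [i, j] \<longleftrightarrow> a = i \<and> b = j" "[a, b] = [[i, j] ! 1, [i, j] ! 0] \<longleftrightarrow> a = j \<and> b = i"
      "[i, j] = [a, b] \<longleftrightarrow> a = i \<and> b = j"
    by auto
  have "r_hom q x (q\<^sup>2 * x) I J = c * (top_one I J - Pq q I J)"
    unfolding I J Pq_entry top_one_def exchange_op_def J' nth_Cons_0 One_nat_def nth_Cons_Suc e s
    by (cases "i = j") auto
  then show "r_hom q x (q\<^sup>2 * x) I J = (x - q\<^sup>2 * x) * (top_one I J - Pq q I J)"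
    by (simp only: c_def)
qed

text \<open>
  On the span of \<open>e\<^sub>i \<otimes> e\<^sub>j\<close> and \<open>e\<^sub>j \<otimes> e\<^sub>i\<close> the determinant is
  \<open>D = (q x - q\<^sup>-\<^sup>1 y) (q\<^sup>-\<^sup>1 x - q y)\<close>, and the inverse is given by the adjugate matrix.
\<close>

lemma r_hom_invertible:
  fixes q x y :: complex
  assumes q: "q \<noteq> 0" and xy: "x \<noteq> y" "q\<^sup>2 * x \<noteq> y" "x \<noteq> q\<^sup>2 * y"
  shows "\<exists>Y. top_eq 2 (top_mult 2 (r_hom q x y) Y) top_one
    \<and> top_eq 2 (top_mult 2 Y (r_hom q x y)) (top_one :: ('n::{finite,linorder}, complex) tensor_op)"
proof -
  define p where "p = inverse q"
  have qp: "q * p = 1" using q by (simp add: p_def)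
  define D where "D = (x - y)\<^sup>2 - (q - p)\<^sup>2 * x * y"
  have D: "D = (q * x - p * y) * (p * x - q * y)" unfolding D_def power2_eq_square using qp by algebra
  have nz: "q * x - p * y \<noteq> 0" "p * x - q * y \<noteq> 0"
    using xy(2,3) q unfolding p_def by (auto simp: field_simps power2_eq_square)
  have off: "r_off q x y i j * r_off q x y j i = (q - p)\<^sup>2 * x * y" if "i \<noteq> j" for i j :: 'n
    using that by (auto simp: r_off_def p_def power2_eq_square)
  define d where "d i j = (if i = j then 1 / (q * x - p * y) else (x - y) / D)" for i j :: 'n
  define g where "g i j = - r_off q x y i j / D" for i j :: 'n
  have [simp]: "D \<noteq> 0" using D nz by simp
  have app: "top_apply 2 (exchange_op d' g') F [i, j] = d' i j * F [i, j] + g' i j * F [j, i]"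
    for d' g' :: "'n \<Rightarrow> 'n \<Rightarrow> complex" and F i j
  proof -
    have "top_apply 2 (site [0, 1] (exchange_op d' g')) F [i, j] = d' i j * F [i, j] + g' i j * F [j, i]"
      by (simp add: top_apply_exchange)
    moreover have "top_apply 2 (site [0, 1] (exchange_op d' g')) F [i, j] = top_apply 2 (exchange_op d' g') F [i, j]"
      unfolding top_apply_def
      by (intro sum.cong refl) (auto simp: site_def less_2_cases_iff elim!: length_2_cases)
    ultimately show ?thesis by simp
  qed
  have one: "top_apply 2 top_one F I = F I" if "length I = 2" for F and I :: "'n list"
    using that by (simp add: top_apply_def top_one_def if_distrib[of "\<lambda>x. x * _"] cong: if_cong)
  have diag: "(x - y) * (x - y) = D + r_off q x y i j * r_off q x y j i" if "i \<noteq> j" for i j :: 'n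
    unfolding off[OF that] D_def by (simp add: power2_eq_square)
  have "top_eq 2 (top_mult 2 (r_hom q x y) (exchange_op d g)) (top_one :: ('n, complex) tensor_op)"
  proof (rule top_eq_applyI)
    fix F and I :: "'n list" assume I: "length I = 2"
    then obtain i j where [simp]: "I = [i, j]" by (rule length_2_cases)
    show "top_apply 2 (top_mult 2 (r_hom q x y) (exchange_op d g)) F I = top_apply 2 top_one F I"
    proof (cases "i = j")
      case True then show ?thesis using nz
        by (simp add: one top_apply_mult app d_def g_def r_off_def r_diag_def p_def[symmetric])
    next
      case False
      then have "top_apply 2 (top_mult 2 (r_hom q x y) (exchange_op d g)) F I
          = (((x - y) * (x - y) - r_off q x y i j * r_off q x y j i) / D) * F I"
        by (simp add: top_apply_mult app d_def g_def r_diag_def field_simps)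
      then show ?thesis using False by (simp add: one diag[OF False])
    qed
  qed
  moreover have "top_eq 2 (top_mult 2 (exchange_op d g) (r_hom q x y)) (top_one :: ('n, complex) tensor_op)"
  proof (rule top_eq_applyI)
    fix F and I :: "'n list" assume I: "length I = 2"
    then obtain i j where [simp]: "I = [i, j]" by (rule length_2_cases)
    show "top_apply 2 (top_mult 2 (exchange_op d g) (r_hom q x y)) F I = top_apply 2 top_one F I"
    proof (cases "i = j")
      case True then show ?thesis using nz
        by (simp add: one top_apply_mult app d_def g_def r_off_def r_diag_def p_def[symmetric])
    next
      case False
      then have "top_apply 2 (top_mult 2 (exchange_op d g) (r_hom q x y)) F I
          = (((x - y) * (x - y) - r_off q x y i j * r_off q x y j i) / D) * F I"
        by (simp add: top_apply_mult app d_def g_def r_diag_def field_simps)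
      then show ?thesis using False by (simp add: one diag[OF False])
    qed
  qed
  ultimately show ?thesis by blast
qed

text \<open>
  For \<open>q\<^sup>2 = 1\<close> the R-matrix is diagonal, and the product of the two R-matrices that join two
  factors with a third one is symmetric in these two factors.
\<close>

lemma Pq_commute_r_hom:
  fixes q x y :: complex
  assumes q: "q\<^sup>2 = 1"
  shows "top_eq 3
      (top_mult 3 (site [0, 1] (Pq q)) (top_mult 3 (site [0, 2] (r_hom q x y)) (site [1, 2] (r_hom q x y))))
      (top_mult 3 (top_mult 3 (site [0, 2] (r_hom q x y)) (site [1, 2] (r_hom q x y)))
        (site [0, 1] (Pq q) :: ('n::{finite,linorder}, complex) tensor_op))"
    and "top_eq 3
      (top_mult 3 (site [1, 2] (Pq q)) (top_mult 3 (site [0, 2] (r_hom q x y)) (site [0, 1] (r_hom q x y))))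
      (top_mult 3 (top_mult 3 (site [0, 2] (r_hom q x y)) (site [0, 1] (r_hom q x y)))
        (site [1, 2] (Pq q) :: ('n::{finite,linorder}, complex) tensor_op))"
proof -
  have q': "inverse q = q"
    using q by (metis inverse_unique power2_eq_square)
  let ?P = "exchange_op (\<lambda>_ _. 0) (\<lambda>i j. q powi ord_sgn i j) :: ('n, complex) tensor_op"
  have site_P: "top_eq 3 (site ps (Pq q)) (site ps ?P)" if "length ps = 2" for ps
    using Pq_conv_exchange[of q] that by (auto simp: top_eq_def site_def)
  have app_P: "top_apply 3 (site ps (Pq q)) F I = top_apply 3 (site ps ?P) F I"
    if "length ps = 2" "length I = 3" for ps F and I :: "'n list"
    using site_P[OF that(1)] that(2) by (auto simp: top_eq_def top_apply_def intro!: sum.cong)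
  note simps = top_apply_mult top_apply_exchange r_diag_def r_off_def q' app_P mult.commute mult.left_commute
  show "top_eq 3
      (top_mult 3 (site [0, 1] (Pq q)) (top_mult 3 (site [0, 2] (r_hom q x y)) (site [1, 2] (r_hom q x y))))
      (top_mult 3 (top_mult 3 (site [0, 2] (r_hom q x y)) (site [1, 2] (r_hom q x y)))
        (site [0, 1] (Pq q) :: ('n::{finite,linorder}, complex) tensor_op))"
    by (rule top_eq_applyI, erule length_3_cases) (simp add: simps)
  show "top_eq 3
      (top_mult 3 (site [1, 2] (Pq q)) (top_mult 3 (site [0, 2] (r_hom q x y)) (site [0, 1] (r_hom q x y))))
      (top_mult 3 (top_mult 3 (site [0, 2] (r_hom q x y)) (site [0, 1] (r_hom q x y)))
        (site [1, 2] (Pq q) :: ('n::{finite,linorder}, complex) tensor_op))"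
    by (rule top_eq_applyI, erule length_3_cases) (simp add: simps)
qed

section \<open>Scalar operators and L-operators\<close>

context complex_algebra
begin

lemma cscale_one_mult: "cscale c 1 * x = cscale c x"
  by (simp add: cscale_mult_left)

lemma mult_cscale_one: "x * cscale c 1 = cscale c x"
  by (simp add: cscale_mult_right)

lemma of_nat_mult_conv_cscale: "of_nat n * x = cscale (of_nat n) x"
  by (induction n) (simp_all add: distrib_right scale_left_distrib)

lemma of_nat_mult_cancel:
  fixes x y :: 'a
  assumes "of_nat n * x = of_nat n * y" "n > 0" shows "x = y"
proof -
  have "cscale (of_nat n) x = cscale (of_nat n) y"
    using assms(1) by (simp only: of_nat_mult_conv_cscale)
  moreover have "(of_nat n :: complex) \<noteq> 0" using assms(2) by simp
  ultimately show ?thesis using scale_left_imp_eq by blast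
qed

lemma lmat_of_nat_mult_cancel:
  fixes X Y :: "('n::finite, 'a) lmat"
  assumes "of_nat n * X = of_nat n * Y" "n > 0" shows "X = Y"
proof (rule lmat_eqI)
  fix I J
  have "of_nat n * ent X I J = of_nat n * ent Y I J"
    using assms(1) by (metis ent_of_nat_mult)
  then show "ent X I J = ent Y I J" using assms(2) by (rule of_nat_mult_cancel)
qed

definition lscale :: "complex \<Rightarrow> ('n, 'a) lmat \<Rightarrow> ('n, 'a) lmat"
  where "lscale c X = Abs_lmat (\<lambda>I J. cscale c (ent X I J))"

lemma ent_lscale: "ent (lscale c X) I J = cscale c (ent X I J)"
  using ent[of X] by (simp add: lscale_def Abs_lmat_inverse)

lemma lscale_mult_left: "lscale c X * Y = lscale c (X * Y :: ('n::finite, 'a) lmat)"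
  by (rule lmat_eqI) (simp add: ent_ops ent_lscale cscale_mult_left scale_sum_right)

lemma lscale_mult_right: "X * lscale c Y = lscale c (X * Y :: ('n::finite, 'a) lmat)"
  by (rule lmat_eqI) (simp add: ent_ops ent_lscale cscale_mult_right scale_sum_right)

lemma lscale_cancel:
  assumes "lscale c X = lscale c Y" "c \<noteq> 0" shows "X = Y"
proof (rule lmat_eqI)
  fix I J
  have "cscale c (ent X I J) = cscale c (ent Y I J)" using assms(1) by (metis ent_lscale)
  then show "ent X I J = ent Y I J" using assms(2) by simp
qed

definition scalar_op :: "nat \<Rightarrow> nat list \<Rightarrow> ('n, complex) tensor_op \<Rightarrow> ('n, 'a) lmat"
  where "scalar_op m ps X = spread m ps (top_lift cscale X)"

text \<open>
  Keeping the condition under which the entries of \<open>scalar_op m ps X\<close> vanish as one predicate makes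
  linearity in \<open>X\<close> a simplification.
\<close>

definition same_off :: "nat \<Rightarrow> nat list \<Rightarrow> 'n list \<Rightarrow> 'n list \<Rightarrow> bool"
  where "same_off m ps I J \<longleftrightarrow> length I = m \<and> length J = m \<and> (\<forall>x<m. x \<notin> set ps \<longrightarrow> I ! x = J ! x)"

lemma ent_scalar_op: "ent (scalar_op m ps X) I J =
    (if same_off m ps I J then cscale (X (map ((!) I) ps) (map ((!) J) ps)) 1 else 0)"
  by (auto simp: same_off_def scalar_op_def blk.rep_eq site_def top_lift_def)

lemma central_op_lift: "central_op (top_lift cscale X)"
  by (simp add: central_op_def top_lift_def cscale_one_mult mult_cscale_one)

lemma central_entries_scalar_op: "central_entries (scalar_op m ps X)"
  unfolding scalar_op_def by (rule central_entries_spread[OF central_op_lift])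

lemma top_lift_mult:
  "top_lift cscale (top_mult k X Y) = top_mult k (top_lift cscale X) (top_lift cscale Y)"
  by (intro ext) (simp add: top_lift_def top_mult_def cscale_one_mult scale_sum_left)

lemma scalar_op_mult:
  fixes X Y :: "('n::finite, complex) tensor_op"
  assumes "distinct ps" "set ps \<subseteq> {..<m}" "length ps = k"
  shows "scalar_op m ps (top_mult k X Y) = scalar_op m ps X * scalar_op m ps Y"
  unfolding scalar_op_def top_lift_mult using spread_mult[OF assms(1,2)] assms(3) by blast

lemma scalar_op_one: "scalar_op m ps top_one = (blk_unit m :: ('n, 'a) lmat)"
proof -
  have "top_lift cscale top_one = (top_one :: ('n, 'a) tensor_op)" by (intro ext) (simp add: top_lift_def top_one_def)
  then show ?thesis unfolding scalar_op_def by (simp only: spread_one)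
qed

lemma scalar_op_cong: "top_eq k X Y \<Longrightarrow> length ps = k \<Longrightarrow> scalar_op m ps X = scalar_op m ps Y"
  unfolding scalar_op_def by (rule spread_cong) (auto simp: top_eq_def top_lift_def)

lemma scalar_op_site:
  assumes "distinct ps" "set ps \<subseteq> {..<m}" "set qs \<subseteq> {..<length ps}"
  shows "scalar_op m ps (site qs X) = scalar_op m (map ((!) ps) qs) X"
proof -
  have "top_lift cscale (site qs X) = site qs (top_lift cscale X)"
    by (intro ext) (auto simp: top_lift_def site_def)
  then show ?thesis using spread_site[OF assms] by (simp add: scalar_op_def)
qed

lemma scalar_op_scale: "scalar_op m ps (\<lambda>I J. c * X I J) = lscale c (scalar_op m ps X)"
  by (rule lmat_eqI) (simp add: ent_lscale ent_scalar_op)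

lemma scalar_op_diff: "scalar_op m ps (\<lambda>I J. X I J - Y I J) = scalar_op m ps X - (scalar_op m ps Y :: ('n::finite, 'a) lmat)"
  by (rule lmat_eqI) (simp add: ent_ops ent_scalar_op scale_left_diff_distrib)

lemma scalar_op_sum: "scalar_op m ps (\<lambda>I J. \<Sum>x\<in>A. X x I J) = (\<Sum>x\<in>A. scalar_op m ps (X x) :: ('n::finite, 'a) lmat)"
  by (rule lmat_eqI) (simp add: ent_sum ent_scalar_op scale_sum_left)

lemma scalar_op_of_int: "scalar_op m ps (\<lambda>I J. of_int c * X I J) = of_int c * (scalar_op m ps X :: ('n::finite, 'a) lmat)"
proof (rule lmat_eqI)
  have "cscale (of_int c) x = of_int c * x" for x
    by (cases c rule: int_diff_cases) (simp add: scale_left_diff_distrib left_diff_distrib of_nat_mult_conv_cscale)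
  then show "ent (scalar_op m ps (\<lambda>I J. of_int c * X I J)) I J = ent (of_int c * scalar_op m ps X) I J" for I J :: "'n list"
    by (simp add: ent_of_int_mult ent_scalar_op flip: scale_scale)
qed

lemma scalar_op_commute:
  fixes X Y :: "('n::finite, complex) tensor_op"
  assumes "set ps \<inter> set qs = {}" "set ps \<subseteq> {..<m}" "set qs \<subseteq> {..<m}"
  shows "scalar_op m ps X * scalar_op m qs Y = scalar_op m qs Y * scalar_op m ps X"
  unfolding scalar_op_def by (rule spread_commute_disjoint[OF assms central_op_lift])

end

definition mat_at :: "nat \<Rightarrow> nat \<Rightarrow> 'a::zero^'n^'n \<Rightarrow> ('n, 'a) lmat"
  where "mat_at m a M = spread m [a] (\<lambda>I J. M $ (I ! 0) $ (J ! 0))"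

lemma spread_act_at:
  assumes ps: "distinct ps" "set ps \<subseteq> {..<m}" and a: "a < length ps"
  shows "spread m ps (act_at a M) = mat_at m (ps ! a) M"
proof -
  have "top_eq (length ps) (act_at a M) (site [a] (\<lambda>I J. M $ (I ! 0) $ (J ! 0)))"
    by (rule blk_eqD[OF blk_act_at[OF a]])
  then have "spread m ps (act_at a M) = spread m ps (site [a] (\<lambda>I J. M $ (I ! 0) $ (J ! 0)))"
    by (rule spread_cong)
  also have "\<dots> = mat_at m (ps ! a) M"
    unfolding mat_at_def using spread_site[OF ps, of "[a]"] a by simp
  finally show ?thesis .
qed

lemma (in complex_algebra) scalar_op_commute_mat_at:
  fixes M :: "'a^'n::finite^'n::finite"
  assumes "a \<notin> set ps" "set ps \<subseteq> {..<m}" "a < m"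
  shows "scalar_op m ps X * mat_at m a M = mat_at m a M * scalar_op m ps X"
  unfolding scalar_op_def mat_at_def using assms by (intro spread_commute_disjoint central_op_lift) auto

locale l_operator_algebra = complex_algebra cscale
  for cscale :: "complex \<Rightarrow> 'a::ring_1 \<Rightarrow> 'a" +
  fixes q :: complex and L :: "complex \<Rightarrow> 'a^'n::{finite,linorder}^'n::{finite,linorder}"
  assumes q_nonzero: "q \<noteq> 0" and RLL: "L_operator cscale q L"
begin

definition Rop :: "nat \<Rightarrow> nat \<Rightarrow> nat \<Rightarrow> complex \<Rightarrow> complex \<Rightarrow> ('n, 'a) lmat"
  where "Rop m a b x y = scalar_op m [a, b] (r_hom q x y)"

definition Pop :: "nat \<Rightarrow> nat \<Rightarrow> ('n, 'a) lmat"
  where "Pop m a = scalar_op m [a, a + 1] (Pq q)"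

lemma blk_unit_scalar_op [simp]: "blk_unit m * scalar_op m ps X = (scalar_op m ps X :: ('n, 'a) lmat)"
    "scalar_op m ps X * blk_unit m = (scalar_op m ps X :: ('n, 'a) lmat)"
  by (simp_all add: scalar_op_def)

text \<open>The R-matrix enters the relation linearly, so it may be rescaled to a polynomial in the parameters.\<close>

lemma Rop_mat_at_mat_at:
  assumes ab: "a < m" "b < m" "a \<noteq> b" and zw: "z \<noteq> 0" "w \<noteq> 0" "z \<noteq> w"
  shows "Rop m a b z w * mat_at m a (L z) * mat_at m b (L w) = mat_at m b (L w) * mat_at m a (L z) * Rop m a b z w"
proof -
  define R :: "('n, 'a) lmat" where "R = scalar_op m [a, b] (R_matrix q (z / w))"
  have ps: "distinct [a, b]" "set [a, b] \<subseteq> {..<m}" using ab by auto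
  have len: "length [a, b] = 2" by simp
  have act: "spread m [a, b] (act_at 0 M) = mat_at m a M" "spread m [a, b] (act_at 1 M) = mat_at m b M"
    for M
    using spread_act_at[OF ps, of 0] spread_act_at[OF ps, of 1] by simp_all
  have "R * mat_at m a (L z) * mat_at m b (L w) = mat_at m b (L w) * mat_at m a (L z) * R"
  proof -
    have mult: "spread m [a, b] (top_mult 2 X Y) = spread m [a, b] X * spread m [a, b] Y"
      for X Y :: "('n, 'a) tensor_op"
      using spread_mult[OF ps, of X Y] unfolding len .
    have "top_eq (length [a, b])
      (top_mult 2 (top_mult 2 (top_lift cscale (R_matrix q (z / w))) (act_at 0 (L z))) (act_at 1 (L w)))
      (top_mult 2 (top_mult 2 (act_at 1 (L w)) (act_at 0 (L z))) (top_lift cscale (R_matrix q (z / w))))"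
      using RLL zw unfolding L_operator_def len by simp
    from spread_cong[OF this, of m] show ?thesis
      unfolding mult act R_def scalar_op_def .
  qed
  moreover have "Rop m a b z w = lscale (z - w) R"
    unfolding Rop_def R_def scalar_op_scale[symmetric]
    by (rule scalar_op_cong[OF _ len, symmetric]) (rule R_matrix_conv_hom[OF zw(2,3)])
  ultimately show ?thesis by (simp only: lscale_mult_left lscale_mult_right)
qed

lemma Rop_yang_baxter:
  assumes "distinct [a, b, c]" "a < m" "b < m" "c < m"
  shows "Rop m a b x y * Rop m a c x z * Rop m b c y z = Rop m b c y z * Rop m a c x z * Rop m a b x y"
proof -
  have ps: "distinct [a, b, c]" "set [a, b, c] \<subseteq> {..<m}" "length [a, b, c] = 3" using assms by auto
  note site = scalar_op_site[OF ps(1,2), of "[0, 1]"] scalar_op_site[OF ps(1,2), of "[0, 2]"] scalar_op_site[OF ps(1,2), of "[1, 2]"]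
  show ?thesis
    using scalar_op_cong[OF yang_baxter_hom[OF q_nonzero, of x y z] ps(3), of m, unfolded scalar_op_mult[OF ps]]
    by (simp add: Rop_def site del: One_nat_def)
qed

lemma Rop_degenerate:
  "Rop m a b x (q\<^sup>2 * x) = lscale (x - q\<^sup>2 * x) (blk_unit m - scalar_op m [a, b] (Pq q))"
proof -
  have "Rop m a b x (q\<^sup>2 * x) = scalar_op m [a, b] (\<lambda>I J. (x - q\<^sup>2 * x) * (top_one I J - Pq q I J))"
    unfolding Rop_def by (rule scalar_op_cong[OF r_hom_degenerate[OF q_nonzero]]) simp
  then show ?thesis by (simp add: scalar_op_scale scalar_op_diff scalar_op_one)
qed

lemma Rop_invertible:
  assumes "a < m" "b < m" "a \<noteq> b" and "x \<noteq> y" "q\<^sup>2 * x \<noteq> y" "x \<noteq> q\<^sup>2 * y"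
  shows "\<exists>Y. Rop m a b x y * scalar_op m [a, b] Y = blk_unit m \<and> scalar_op m [a, b] Y * Rop m a b x y = blk_unit m"
proof -
  obtain Y where Y: "top_eq 2 (top_mult 2 (r_hom q x y) Y) (top_one :: ('n, complex) tensor_op)"
      "top_eq 2 (top_mult 2 Y (r_hom q x y)) (top_one :: ('n, complex) tensor_op)"
    using r_hom_invertible[OF q_nonzero assms(4-6)] by blast
  have ps: "distinct [a, b]" "set [a, b] \<subseteq> {..<m}" "length [a, b] = 2" using assms by auto
  show ?thesis
    using scalar_op_cong[OF Y(1) ps(3), of m] scalar_op_cong[OF Y(2) ps(3), of m]
    unfolding scalar_op_mult[OF ps] scalar_op_one Rop_def[symmetric] by blast
qed

abbreviation Dop :: "nat \<Rightarrow> nat \<Rightarrow> ('n, 'a) lmat"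
  where "Dop m a \<equiv> blk_unit m - Pop m a"

text \<open>
  At parameters \<open>z, q\<^sup>2 z\<close> the exchange relations become relations with the antisymmetrizer
  of two neighbouring factors; this is the \<open>q\<close>-Manin property.
\<close>

lemma Dop_mat_at_mat_at:
  assumes "a + 1 < m" "z \<noteq> 0" "q\<^sup>2 \<noteq> 1"
  shows "Dop m a * (mat_at m a (L z) * mat_at m (a + 1) (L (q\<^sup>2 * z)))
    = mat_at m (a + 1) (L (q\<^sup>2 * z)) * mat_at m a (L z) * Dop m a"
proof -
  have "z - q\<^sup>2 * z \<noteq> 0" using assms by simp
  moreover have "q\<^sup>2 * z \<noteq> 0" "z \<noteq> q\<^sup>2 * z" using assms q_nonzero by auto
  ultimately show ?thesis
    using Rop_mat_at_mat_at[of a m "a + 1" z "q\<^sup>2 * z"] assms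
    unfolding Rop_degenerate Pop_def by (auto simp: lscale_mult_left lscale_mult_right mult.assoc dest: lscale_cancel)
qed

text \<open>
  The Yang--Baxter equation with one R-matrix at its degenerate point: the R-matrix, read as a
  matrix over operators in either of its two factors, is itself \<open>q\<close>-Manin.
\<close>

lemma Dop_Rop_Rop:
  assumes "a + 1 < m" "c < m" "c \<noteq> a" "c \<noteq> a + 1" "x \<noteq> 0" "q\<^sup>2 \<noteq> 1"
  shows "Dop m a * (Rop m a c x y * Rop m (a + 1) c (q\<^sup>2 * x) y)
      = Rop m (a + 1) c (q\<^sup>2 * x) y * Rop m a c x y * Dop m a"
    and "Dop m a * (Rop m c (a + 1) y (q\<^sup>2 * x) * Rop m c a y x)
      = Rop m c a y x * Rop m c (a + 1) y (q\<^sup>2 * x) * Dop m a"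
proof -
  have nz: "x - q\<^sup>2 * x \<noteq> 0" using assms by simp
  show "Dop m a * (Rop m a c x y * Rop m (a + 1) c (q\<^sup>2 * x) y)
      = Rop m (a + 1) c (q\<^sup>2 * x) y * Rop m a c x y * Dop m a"
    using Rop_yang_baxter[of a "a + 1" c m x "q\<^sup>2 * x" y] assms nz
    unfolding Rop_degenerate Pop_def by (auto simp: lscale_mult_left lscale_mult_right mult.assoc dest: lscale_cancel)
  show "Dop m a * (Rop m c (a + 1) y (q\<^sup>2 * x) * Rop m c a y x)
      = Rop m c a y x * Rop m c (a + 1) y (q\<^sup>2 * x) * Dop m a"
    using Rop_yang_baxter[of c a "a + 1" m y x "q\<^sup>2 * x"] assms nz
    unfolding Rop_degenerate Pop_def by (auto simp: lscale_mult_left lscale_mult_right mult.assoc dest: lscale_cancel)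
qed

lemma Pop_commute_Rop_Rop:
  assumes "a + 1 < m" "c < m" "c \<noteq> a" "c \<noteq> a + 1" "q\<^sup>2 = 1"
  shows "Pop m a * (Rop m a c x y * Rop m (a + 1) c x y) = Rop m a c x y * Rop m (a + 1) c x y * Pop m a"
    and "Pop m a * (Rop m c (a + 1) y x * Rop m c a y x) = Rop m c (a + 1) y x * Rop m c a y x * Pop m a"
proof -
  have ps: "distinct [a, a + 1, c]" "set [a, a + 1, c] \<subseteq> {..<m}" "length [a, a + 1, c] = 3" using assms by auto
  have ps': "distinct [c, a, a + 1]" "set [c, a, a + 1] \<subseteq> {..<m}" "length [c, a, a + 1] = 3" using assms by auto
  show "Pop m a * (Rop m a c x y * Rop m (a + 1) c x y) = Rop m a c x y * Rop m (a + 1) c x y * Pop m a"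
    using scalar_op_cong[OF Pq_commute_r_hom(1)[OF assms(5), of x y] ps(3), of m, unfolded scalar_op_mult[OF ps]]
    by (simp add: Rop_def Pop_def scalar_op_site[OF ps(1,2), of "[0, 1]"] scalar_op_site[OF ps(1,2), of "[0, 2]"]
          scalar_op_site[OF ps(1,2), of "[1, 2]"] del: One_nat_def)
  show "Pop m a * (Rop m c (a + 1) y x * Rop m c a y x) = Rop m c (a + 1) y x * Rop m c a y x * Pop m a"
    using scalar_op_cong[OF Pq_commute_r_hom(2)[OF assms(5), of y x] ps'(3), of m, unfolded scalar_op_mult[OF ps']]
    by (simp add: Rop_def Pop_def scalar_op_site[OF ps'(1,2), of "[0, 1]"] scalar_op_site[OF ps'(1,2), of "[0, 2]"]
          scalar_op_site[OF ps'(1,2), of "[1, 2]"] del: One_nat_def)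
qed

end

context l_operator_algebra
begin

section \<open>Traces of products of L-operators\<close>

definition L_string :: "nat \<Rightarrow> nat \<Rightarrow> nat \<Rightarrow> complex \<Rightarrow> ('n, 'a) lmat"
  where "L_string m s k z = oprod (\<lambda>a. mat_at m (s + a) (L (q ^ (2 * a) * z))) k"

text \<open>The common shape of \<open>t_fun\<close> and, by a result below, of \<open>I_fun\<close>.\<close>

definition tr_op :: "('n, complex) tensor_op \<Rightarrow> nat \<Rightarrow> complex \<Rightarrow> 'a"
  where "tr_op X k z = top_trace k (top_mult k (top_lift cscale X) (L_product q L k z k))"

lemma t_fun_conv_tr_op: "t_fun cscale q L k z = tr_op (q_antisymmetrizer q k) k z"
  by (simp add: t_fun_def tr_op_def)

lemma spread_L_product:
  assumes "s + n \<le> m" "j \<le> n"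
  shows "spread m [s..<s + n] (L_product q L n z j) = blk_unit m * L_string m s j z"
  using assms(2)
proof (induction j)
  case 0
  show ?case by (simp add: spread_one L_string_def)
next
  case (Suc j)
  have ps: "distinct [s..<s + n]" "set [s..<s + n] \<subseteq> {..<m}" "length [s..<s + n] = n" using assms by auto
  have "spread m [s..<s + n] (L_product q L n z (Suc j))
      = spread m [s..<s + n] (L_product q L n z j) * spread m [s..<s + n] (act_at j (L (q ^ (2 * j) * z)))"
    using spread_mult[OF ps(1,2)] unfolding ps(3) by simp
  also have "spread m [s..<s + n] (act_at j (L (q ^ (2 * j) * z))) = mat_at m (s + j) (L (q ^ (2 * j) * z))"
    using spread_act_at[OF ps(1,2), of j] Suc.prems by simp
  finally show ?case using Suc by (simp add: L_string_def mult.assoc)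
qed

lemma scalar_op_commute_L_string:
  assumes "set ps \<subseteq> {..<m}" "set ps \<inter> {s..<s + k} = {}" "s + k \<le> m"
  shows "scalar_op m ps X * L_string m s k z = L_string m s k z * scalar_op m ps X"
  unfolding L_string_def by (rule oprod_commute, rule scalar_op_commute_mat_at) (use assms in auto)

lemma spread_lift_L_product:
  assumes "s + n \<le> m"
  shows "spread m [s..<s + n] (top_mult n (top_lift cscale X) (L_product q L n z n))
    = scalar_op m [s..<s + n] X * L_string m s n z"
proof -
  have ps: "distinct [s..<s + n]" "set [s..<s + n] \<subseteq> {..<m}" "length [s..<s + n] = n" using assms by auto
  have "spread m [s..<s + n] (top_mult n (top_lift cscale X) (L_product q L n z n))
    = spread m [s..<s + n] (top_lift cscale X) * spread m [s..<s + n] (L_product q L n z n)"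
    using spread_mult[OF ps(1,2)] unfolding ps(3) by blast
  also have "\<dots> = scalar_op m [s..<s + n] X * (blk_unit m * L_string m s n z)"
    unfolding scalar_op_def using spread_L_product[OF assms order_refl] by simp
  finally show ?thesis unfolding mult.assoc[symmetric] blk_unit_scalar_op .
qed

lemma tr_op_conv_ltrace: "tr_op X k z = ltrace k (scalar_op k [0..<k] X * L_string k 0 k z)"
  using spread_lift_L_product[of 0 k k X z]
  unfolding tr_op_def ltrace_blk[symmetric] by (simp add: blk_eq_spread[of k "top_mult _ _ _"])

text \<open>
  Scalar operators move past the L-operators in the other tensor factors, so a product of two
  traces is one trace, with the two groups of L-operators in the order of the product.
\<close>

lemma tr_op_mult:
  assumes "m = k + l"
  shows "tr_op X k z * tr_op Y l w
      = ltrace m (scalar_op m [0..<k] X * scalar_op m [k..<m] Y * (L_string m 0 k z * L_string m k l w))"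
    and "tr_op Y l w * tr_op X k z
      = ltrace m (scalar_op m [0..<k] X * scalar_op m [k..<m] Y * (L_string m k l w * L_string m 0 k z))"
proof -
  let ?A = "spread m [0..<0 + k] (top_mult k (top_lift cscale X) (L_product q L k z k))"
  let ?B = "spread m [k..<k + l] (top_mult l (top_lift cscale Y) (L_product q L l w l))"
  have A: "?A = scalar_op m [0..<k] X * L_string m 0 k z" using assms by (subst spread_lift_L_product) auto
  have B: "?B = scalar_op m [k..<m] Y * L_string m k l w" using assms by (subst spread_lift_L_product) auto
  have XY: "scalar_op m [0..<k] X * scalar_op m [k..<m] Y = scalar_op m [k..<m] Y * scalar_op m [0..<k] X"
    by (rule scalar_op_commute) (use assms in auto)
  have YL: "scalar_op m [k..<m] Y * L_string m 0 k z = L_string m 0 k z * scalar_op m [k..<m] Y"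
    by (rule scalar_op_commute_L_string) (use assms in auto)
  have XL: "scalar_op m [0..<k] X * L_string m k l w = L_string m k l w * scalar_op m [0..<k] X"
    by (rule scalar_op_commute_L_string) (use assms in auto)
  have "tr_op X k z * tr_op Y l w = ltrace m (?A * ?B)"
    unfolding tr_op_def using assms by (subst ltrace_spread_mult_disjoint) auto
  also have "?A * ?B = scalar_op m [0..<k] X * (L_string m 0 k z * scalar_op m [k..<m] Y) * L_string m k l w"
    unfolding A B by (simp only: mult.assoc)
  also have "\<dots> = scalar_op m [0..<k] X * scalar_op m [k..<m] Y * (L_string m 0 k z * L_string m k l w)"
    unfolding YL[symmetric] by (simp only: mult.assoc)
  finally show "tr_op X k z * tr_op Y l w
      = ltrace m (scalar_op m [0..<k] X * scalar_op m [k..<m] Y * (L_string m 0 k z * L_string m k l w))" .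
  have "tr_op Y l w * tr_op X k z = ltrace m (?B * ?A)"
    unfolding tr_op_def using assms by (subst ltrace_spread_mult_disjoint) auto
  also have "?B * ?A = scalar_op m [k..<m] Y * (L_string m k l w * scalar_op m [0..<k] X) * L_string m 0 k z"
    unfolding A B by (simp only: mult.assoc)
  also have "\<dots> = scalar_op m [0..<k] X * scalar_op m [k..<m] Y * (L_string m k l w * L_string m 0 k z)"
    unfolding XL[symmetric] XY by (simp only: mult.assoc)
  finally show "tr_op Y l w * tr_op X k z
      = ltrace m (scalar_op m [0..<k] X * scalar_op m [k..<m] Y * (L_string m k l w * L_string m 0 k z))" .
qed

section \<open>Fusion of R-matrices\<close>

text \<open>
  For these parameters all the R-matrices between two strings \<open>x, q\<^sup>2 x, \<dots>\<close> and
  \<open>y, q\<^sup>2 y, \<dots>\<close> are defined and invertible.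
\<close>

definition separated :: "complex \<Rightarrow> complex \<Rightarrow> bool"
  where "separated x y \<longleftrightarrow> (\<forall>s t. q ^ (2 * s) * x \<noteq> q ^ (2 * t) * y)"

lemma separated_sym: "separated x y \<longleftrightarrow> separated y x"
  unfolding separated_def by metis

lemma separated_power: "separated x y \<Longrightarrow> separated (q ^ (2 * s) * x) (q ^ (2 * t) * y)"
  unfolding separated_def by (metis add_mult_distrib2 mult.assoc power_add)

lemma separated_neq:
  assumes "separated x y" shows "x \<noteq> y" "q\<^sup>2 * x \<noteq> y" "x \<noteq> q\<^sup>2 * y"
  using assms[unfolded separated_def, rule_format, of 0 0] assms[unfolded separated_def, rule_format, of 1 0]
    assms[unfolded separated_def, rule_format, of 0 1] by simp_all

definition fused_col :: "nat \<Rightarrow> nat \<Rightarrow> complex \<Rightarrow> nat \<Rightarrow> complex \<Rightarrow> ('n, 'a) lmat"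
  where "fused_col m k z c y = oprod (\<lambda>a. Rop m a c (q ^ (2 * a) * z) y) k"

text \<open>
  The product of the R-matrices between all the first \<open>k\<close> and all the last \<open>l\<close> factors, ordered
  so that it exchanges the two groups of L-operators.
\<close>

definition fused_R :: "nat \<Rightarrow> nat \<Rightarrow> complex \<Rightarrow> complex \<Rightarrow> ('n, 'a) lmat"
  where "fused_R k l z w = oprod_rev (\<lambda>b. fused_col (k + l) k z (k + b) (q ^ (2 * b) * w)) l"

lemma Rop_commute_disjoint:
  assumes "{a, b} \<inter> {c, d} = {}" "a < m" "b < m" "c < m" "d < m"
  shows "Rop m a b x y * Rop m c d x' y' = Rop m c d x' y' * Rop m a b x y"
  unfolding Rop_def by (rule scalar_op_commute) (use assms in auto)

lemma Rop_commute_mat_at: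
  assumes "c \<noteq> a" "c \<noteq> b" "a < m" "b < m" "c < m"
  shows "Rop m a b x y * mat_at m c M = mat_at m c M * Rop m a b x y"
  unfolding Rop_def by (rule scalar_op_commute_mat_at) (use assms in auto)

lemma Pop_commute_scalar_op:
  assumes "a \<notin> set ps" "a + 1 \<notin> set ps" "set ps \<subseteq> {..<m}" "a + 1 < m"
  shows "Pop m a * scalar_op m ps X = scalar_op m ps X * Pop m a"
  unfolding Pop_def by (rule scalar_op_commute) (use assms in auto)

lemma fused_R_exchange:
  assumes zw: "separated z w" "z \<noteq> 0" "w \<noteq> 0" and m: "m = k + l"
  shows "fused_R k l z w * (L_string m 0 k z * L_string m k l w) = L_string m k l w * L_string m 0 k z * fused_R k l z w"
proof -
  have "oprod (\<lambda>a. Rop m a c (q ^ (2 * a) * z) y) k * oprod (\<lambda>a. mat_at m a (L (q ^ (2 * a) * z))) k * mat_at m c (L y)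
      = mat_at m c (L y) * oprod (\<lambda>a. mat_at m a (L (q ^ (2 * a) * z))) k * oprod (\<lambda>a. Rop m a c (q ^ (2 * a) * z) y) k"
    if c: "k \<le> c" "c < m" and y: "y = q ^ (2 * t) * w" for c y t
  proof (rule oprod_exchange)
    fix a assume a: "a < k"
    have "q ^ (2 * a) * z \<noteq> y" using zw y by (simp add: separated_def)
    then show "Rop m a c (q ^ (2 * a) * z) y * mat_at m a (L (q ^ (2 * a) * z)) * mat_at m c (L y)
        = mat_at m c (L y) * mat_at m a (L (q ^ (2 * a) * z)) * Rop m a c (q ^ (2 * a) * z) y"
      using a c zw y q_nonzero by (intro Rop_mat_at_mat_at) auto
  next
    fix a b assume "a < k" "b < k" "a \<noteq> b"
    then show "Rop m a c (q ^ (2 * a) * z) y * mat_at m b (L (q ^ (2 * b) * z))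
        = mat_at m b (L (q ^ (2 * b) * z)) * Rop m a c (q ^ (2 * a) * z) y"
      using c by (intro Rop_commute_mat_at) auto
  qed
  note col = this
  have "oprod_rev (\<lambda>b. fused_col m k z (k + b) (q ^ (2 * b) * w)) l * L_string m 0 k z
        * oprod (\<lambda>b. mat_at m (k + b) (L (q ^ (2 * b) * w))) l
      = oprod (\<lambda>b. mat_at m (k + b) (L (q ^ (2 * b) * w))) l * L_string m 0 k z
        * oprod_rev (\<lambda>b. fused_col m k z (k + b) (q ^ (2 * b) * w)) l"
  proof (rule oprod_rev_exchange)
    fix b assume "b < l"
    then show "fused_col m k z (k + b) (q ^ (2 * b) * w) * L_string m 0 k z * mat_at m (k + b) (L (q ^ (2 * b) * w))
        = mat_at m (k + b) (L (q ^ (2 * b) * w)) * L_string m 0 k z * fused_col m k z (k + b) (q ^ (2 * b) * w)"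
      unfolding fused_col_def L_string_def add_0 by (intro col) (auto simp: m)
  next
    fix a b assume ab: "a < l" "b < l" "a \<noteq> b"
    show "fused_col m k z (k + a) (q ^ (2 * a) * w) * mat_at m (k + b) (L (q ^ (2 * b) * w))
        = mat_at m (k + b) (L (q ^ (2 * b) * w)) * fused_col m k z (k + a) (q ^ (2 * a) * w)"
      unfolding fused_col_def
      by (rule oprod_commute[symmetric], rule Rop_commute_mat_at[symmetric]) (use ab in \<open>auto simp: m\<close>)
  qed
  then show ?thesis unfolding fused_R_def m L_string_def[of "k + l" k] by (simp only: mult.assoc)
qed

text \<open>
  To see that the fused R-matrix has a property that is stable under products, group its factors
  so that the R-matrices meeting the neighbouring factors \<open>a\<close> and \<open>a + 1\<close> occur in pairs.
\<close>

lemma fused_R_closed: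
  fixes G :: "('n, 'a) lmat set"
  assumes G: "1 \<in> G" "\<And>X Y. X \<in> G \<Longrightarrow> Y \<in> G \<Longrightarrow> X * Y \<in> G"
    and zw: "separated z w" "z \<noteq> 0" "w \<noteq> 0"
    and a: "a + 1 < k \<or> k \<le> a \<and> a + 1 < k + l"
    and disj: "\<And>c d x y. separated x y \<Longrightarrow> c < k + l \<Longrightarrow> d < k + l \<Longrightarrow> c \<noteq> d \<Longrightarrow>
      {c, d} \<inter> {a, a + 1} = {} \<Longrightarrow> Rop (k + l) c d x y \<in> G"
    and pair1: "\<And>c x y. separated x y \<Longrightarrow> x \<noteq> 0 \<Longrightarrow> c < k + l \<Longrightarrow> c \<noteq> a \<Longrightarrow> c \<noteq> a + 1 \<Longrightarrow>
      Rop (k + l) a c x y * Rop (k + l) (a + 1) c (q\<^sup>2 * x) y \<in> G"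
    and pair2: "\<And>c x y. separated x y \<Longrightarrow> x \<noteq> 0 \<Longrightarrow> c < k + l \<Longrightarrow> c \<noteq> a \<Longrightarrow> c \<noteq> a + 1 \<Longrightarrow>
      Rop (k + l) c (a + 1) y (q\<^sup>2 * x) * Rop (k + l) c a y x \<in> G"
  shows "fused_R k l z w \<in> G"
proof -
  have nz: "q ^ (2 * s) * z \<noteq> 0" "q ^ (2 * s) * w \<noteq> 0" for s using zw q_nonzero by auto
  have shift: "q ^ (2 * (s + 1)) * x = q\<^sup>2 * (q ^ (2 * s) * x)" for s x
    by (simp add: power2_eq_square mult.assoc)
  from a show ?thesis
  proof
    assume a: "a + 1 < k"
    show ?thesis
      unfolding fused_R_def
    proof (rule oprod_rev_closed[OF G])
      fix b assume b: "b < l"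
      show "fused_col (k + l) k z (k + b) (q ^ (2 * b) * w) \<in> G"
        unfolding fused_col_def
      proof (rule oprod_closed_pair[OF G a])
        show "Rop (k + l) a (k + b) (q ^ (2 * a) * z) (q ^ (2 * b) * w)
            * Rop (k + l) (a + 1) (k + b) (q ^ (2 * (a + 1)) * z) (q ^ (2 * b) * w) \<in> G"
          unfolding shift using a b by (intro pair1 separated_power zw(1) nz) auto
      next
        fix i assume "i < k" "i \<noteq> a" "i \<noteq> a + 1"
        then show "Rop (k + l) i (k + b) (q ^ (2 * i) * z) (q ^ (2 * b) * w) \<in> G"
          using a b by (intro disj separated_power zw(1)) auto
      qed
    qed
  next
    assume a: "k \<le> a \<and> a + 1 < k + l"
    then obtain b where b: "a = k + b" "b + 1 < l" using le_Suc_ex by auto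
    show ?thesis
      unfolding fused_R_def
    proof (rule oprod_rev_closed_pair[OF G b(2)])
      have "fused_col (k + l) k z (k + (b + 1)) (q ^ (2 * (b + 1)) * w) * fused_col (k + l) k z (k + b) (q ^ (2 * b) * w)
          = oprod (\<lambda>i. Rop (k + l) i (k + (b + 1)) (q ^ (2 * i) * z) (q ^ (2 * (b + 1)) * w)
              * Rop (k + l) i (k + b) (q ^ (2 * i) * z) (q ^ (2 * b) * w)) k"
        unfolding fused_col_def by (rule oprod_mult_oprod, rule Rop_commute_disjoint) (use b in auto)
      also have "\<dots> \<in> G"
      proof (rule oprod_closed[OF G])
        fix i assume "i < k"
        then show "Rop (k + l) i (k + (b + 1)) (q ^ (2 * i) * z) (q ^ (2 * (b + 1)) * w)
              * Rop (k + l) i (k + b) (q ^ (2 * i) * z) (q ^ (2 * b) * w) \<in> G"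
          unfolding shift add.assoc[symmetric] b(1)[symmetric]
          using b by (intro pair2 separated_power nz) (use zw(1) separated_sym in auto)
      qed
      finally show "fused_col (k + l) k z (k + (b + 1)) (q ^ (2 * (b + 1)) * w)
          * fused_col (k + l) k z (k + b) (q ^ (2 * b) * w) \<in> G" .
    next
      fix i assume i: "i < l" "i \<noteq> b" "i \<noteq> b + 1"
      show "fused_col (k + l) k z (k + i) (q ^ (2 * i) * w) \<in> G"
        unfolding fused_col_def
      proof (rule oprod_closed[OF G])
        fix j assume "j < k"
        then show "Rop (k + l) j (k + i) (q ^ (2 * j) * z) (q ^ (2 * i) * w) \<in> G"
          using i b by (intro disj separated_power zw(1)) auto
      qed
    qed
  qed
qed

lemma central_entries_fused_R: "central_entries (fused_R k l z w)"
proof -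
  let ?G = "{X :: ('n, 'a) lmat. central_entries X}"
  have G: "1 \<in> ?G" "\<And>X Y. X \<in> ?G \<Longrightarrow> Y \<in> ?G \<Longrightarrow> X * Y \<in> ?G"
    by (simp add: central_entries_def one_lmat.rep_eq) (simp add: central_entries_mult)
  have "Rop m a b x y \<in> ?G" for m a b x y by (simp add: Rop_def central_entries_scalar_op)
  then have "fused_R k l z w \<in> ?G"
    unfolding fused_R_def fused_col_def by (intro oprod_rev_closed[OF G] oprod_closed[OF G])
  then show ?thesis by simp
qed

definition blk_inverse :: "nat \<Rightarrow> ('n, 'a) lmat \<Rightarrow> ('n, 'a) lmat \<Rightarrow> bool"
  where "blk_inverse m X Y \<longleftrightarrow> X * Y = blk_unit m \<and> Y * X = blk_unit m"

lemma blk_inverse_mult: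
  assumes "blk_inverse m X Y" "blk_inverse m X' Y'"
  shows "blk_inverse m (X * X') (Y' * Y)"
proof -
  have "X * X' * (Y' * Y) = X * (X' * Y') * Y" by (simp only: mult.assoc)
  also have "\<dots> = X * blk_unit m * Y" using assms by (simp only: blk_inverse_def)
  also have "\<dots> = blk_unit m * (X * Y)" unfolding blk_unit_central[of m X, symmetric] by (rule mult.assoc)
  finally have 1: "X * X' * (Y' * Y) = blk_unit m" using assms by (simp add: blk_inverse_def)
  have "Y' * Y * (X * X') = Y' * (Y * X) * X'" by (simp only: mult.assoc)
  also have "\<dots> = Y' * blk_unit m * X'" using assms by (simp only: blk_inverse_def)
  also have "\<dots> = blk_unit m * (Y' * X')" unfolding blk_unit_central[of m Y', symmetric] by (rule mult.assoc)
  finally show ?thesis using 1 assms by (simp add: blk_inverse_def)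
qed

lemma blk_inverse_one: "blk_inverse m 1 (blk_unit m)"
  by (simp add: blk_inverse_def)

lemma Rop_blk_inverse:
  assumes "separated x y" "a < m" "b < m" "a \<noteq> b"
  obtains Y where "blk_inverse m (Rop m a b x y) (scalar_op m [a, b] Y)"
  using Rop_invertible[OF assms(2-4) separated_neq[OF assms(1)]] unfolding blk_inverse_def by blast

lemma fused_R_invertible:
  assumes zw: "separated z w"
  shows "\<exists>Y. blk_inverse (k + l) (fused_R k l z w) Y"
proof -
  let ?G = "{X. \<exists>Y. blk_inverse (k + l) X Y}"
  have G: "1 \<in> ?G" "X * Y \<in> ?G" if "X \<in> ?G" "Y \<in> ?G" for X Y
    using that blk_inverse_mult blk_inverse_one by blast+
  have "fused_R k l z w \<in> ?G"
    unfolding fused_R_def fused_col_def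
  proof (rule oprod_rev_closed, goal_cases)
    case (3 b)
    show ?case
    proof (rule oprod_closed, goal_cases)
      case (3 a)
      then show ?case
        using Rop_blk_inverse[OF separated_power[OF zw, of a b], of a "k + l" "k + b"] \<open>b < l\<close> by auto
    qed (use blk_inverse_mult blk_inverse_one in blast)+
  qed (use blk_inverse_mult blk_inverse_one in blast)+
  then show ?thesis by simp
qed

section \<open>Operators preserving \<open>q\<close>-symmetric vectors\<close>

abbreviation Sop :: "nat \<Rightarrow> nat \<Rightarrow> ('n, 'a) lmat"
  where "Sop m a \<equiv> blk_unit m + Pop m a"

lemma Pop_square: "a + 1 < m \<Longrightarrow> Pop m a * Pop m a = blk_unit m"
proof -
  assume a: "a + 1 < m"
  have ps: "distinct [a, a + 1]" "set [a, a + 1] \<subseteq> {..<m}" "length [a, a + 1] = 2" using a by auto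
  let ?s = "Transposition.transpose 0 1 :: nat \<Rightarrow> nat"
  have s: "?s permutes {..<2}" by (intro permutes_swap_id) auto
  let ?\<rho> = "pi_q q 2 :: _ \<Rightarrow> ('n, complex) tensor_op"
  have rep: "is_pi_q q 2 ?\<rho>"
    by (rule pi_q_is_representation[OF q_nonzero])
  have "scalar_op m [a, a + 1] (?\<rho> (?s \<circ> ?s)) = scalar_op m [a, a + 1] (?\<rho> ?s) * scalar_op m [a, a + 1] (?\<rho> ?s)"
    unfolding scalar_op_mult[OF ps, symmetric] by (rule scalar_op_cong[OF _ ps(3)]) (use rep[unfolded is_pi_q_def] s in blast)
  moreover have "scalar_op m [a, a + 1] (?\<rho> ?s) = Pop m a"
  proof -
    have "top_eq 2 (?\<rho> ?s) (act_adjacent 0 (Pq q) :: ('n, complex) tensor_op)"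
      using rep unfolding is_pi_q_def by (metis add_0 one_less_numeral_iff semiring_norm(76))
    moreover have "top_eq 2 (act_adjacent 0 (Pq q)) (Pq q :: ('n, complex) tensor_op)"
      unfolding top_eq_def by (auto simp: act_adjacent_def elim!: length_2_cases)
    ultimately show ?thesis
      unfolding Pop_def using scalar_op_cong[OF _ ps(3)] by metis
  qed
  moreover have "scalar_op m [a, a + 1] (?\<rho> (?s \<circ> ?s)) = blk_unit m"
    unfolding scalar_op_one[of m "[a, a + 1]", symmetric]
    by (rule scalar_op_cong[OF _ ps(3)]) (use rep in \<open>simp add: is_pi_q_def\<close>)
  ultimately show ?thesis by simp
qed

text \<open>
  \<open>X\<close> maps the \<open>q\<close>-symmetric vectors in the factors \<open>a\<close>, \<open>a + 1\<close> to such vectors.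
\<close>

definition preserves_sym :: "nat \<Rightarrow> nat \<Rightarrow> ('n, 'a) lmat \<Rightarrow> bool"
  where "preserves_sym m a X \<longleftrightarrow> Dop m a * X * Sop m a = 0"

lemma blk_unit_Pop [simp]: "blk_unit m * Pop m a = Pop m a" "Pop m a * blk_unit m = Pop m a"
  by (simp_all add: Pop_def)

lemma Dop_mult_Sop:
  assumes "a + 1 < m" shows "Dop m a * Sop m a = 0"
  using Pop_square[OF assms] by (simp add: left_diff_distrib distrib_left)

text \<open>
  On the block, \<open>2 = (1 - P) + (1 + P)\<close>, so preserving symmetric vectors amounts to
  \<open>2 D X = D X D\<close> for \<open>D = 1 - P\<close>, which is stable under products.
\<close>

lemma preserves_sym_mult:
  assumes a: "a + 1 < m" and X: "preserves_sym m a X" and Y: "preserves_sym m a Y"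
  shows "preserves_sym m a (X * Y)"
proof -
  have "of_nat 2 * (Dop m a * (X * Y) * Sop m a) = Dop m a * X * (blk_unit m + blk_unit m) * Y * Sop m a"
  proof -
    have "X * blk_unit m * Y * Sop m a = X * Y * (blk_unit m * Sop m a)"
      unfolding mult.assoc[of X "blk_unit m" Y] blk_unit_central[of m Y] by (simp only: mult.assoc)
    also have "blk_unit m * Sop m a = Sop m a" by (simp add: distrib_left)
    finally have "X * blk_unit m * Y * Sop m a = X * Y * Sop m a" .
    moreover have "d * x * (e + e) * y * u = d * (x * e * y * u) + d * (x * e * y * u)" for d x e y u :: "('n, 'a) lmat"
      by (simp add: distrib_left distrib_right mult.assoc)
    ultimately show ?thesis by (simp only: mult.assoc of_nat_numeral mult_2)
  qed
  also have "\<dots> = Dop m a * X * (Sop m a + Dop m a) * Y * Sop m a" by simp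
  also have "\<dots> = (Dop m a * X * Sop m a) * Y * Sop m a + Dop m a * X * (Dop m a * Y * Sop m a)"
  proof -
    have "d * x * (u + d) * y * u = (d * x * u) * y * u + d * x * (d * y * u)" for d x y u :: "('n, 'a) lmat"
      by (simp add: distrib_left distrib_right mult.assoc)
    then show ?thesis .
  qed
  also have "\<dots> = of_nat 2 * 0"
    using X Y unfolding preserves_sym_def by simp
  finally show ?thesis
    unfolding preserves_sym_def by (rule lmat_of_nat_mult_cancel) simp
qed

lemma preserves_sym_commute:
  assumes a: "a + 1 < m" and "Pop m a * X = X * Pop m a"
  shows "preserves_sym m a X"
proof -
  have "Dop m a * X = X * Dop m a"
    using assms(2) by (simp add: left_diff_distrib right_diff_distrib blk_unit_central)
  then show ?thesis
    unfolding preserves_sym_def using Dop_mult_Sop[OF a] by (simp add: mult.assoc)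
qed

lemma preserves_sym_intertwine:
  assumes a: "a + 1 < m" and "Dop m a * X = X' * Dop m a"
  shows "preserves_sym m a X"
  unfolding preserves_sym_def assms(2) mult.assoc Dop_mult_Sop[OF a] by simp

lemma preserves_sym_one: "a + 1 < m \<Longrightarrow> preserves_sym m a 1"
  by (rule preserves_sym_commute) simp_all

lemma preserves_sym_blk_unit: "a + 1 < m \<Longrightarrow> preserves_sym m a (blk_unit m)"
  by (rule preserves_sym_commute) simp_all

lemma L_string_preserves_sym:
  assumes q2: "q\<^sup>2 \<noteq> 1" and z: "z \<noteq> 0" and m: "s + k \<le> m" and a: "s \<le> a" "a + 1 < s + k"
  shows "preserves_sym m a (L_string m s k z)"
proof -
  obtain b where b: "a = s + b" "b + 1 < k" using a le_Suc_ex by auto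
  have am: "a + 1 < m" using a m by simp
  have "L_string m s k z \<in> {X. preserves_sym m a X}"
    unfolding L_string_def
  proof (rule oprod_closed_pair[OF _ _ b(2)], goal_cases)
    case 3
    let ?x = "q ^ (2 * b) * z"
    have nz: "?x \<noteq> 0" using z q_nonzero by simp
    have "preserves_sym m a (mat_at m a (L ?x) * mat_at m (a + 1) (L (q\<^sup>2 * ?x)))"
      by (rule preserves_sym_intertwine[OF am Dop_mat_at_mat_at[OF am nz q2]])
    moreover have "q ^ (2 * (b + 1)) * z = q\<^sup>2 * ?x" by (simp add: power2_eq_square mult.assoc)
    ultimately show ?case unfolding b(1) by (simp only: mem_Collect_eq add.assoc)
  next
    case (4 i)
    have "Pop m a * mat_at m (s + i) M = mat_at m (s + i) M * Pop m a" for M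
      unfolding Pop_def by (rule scalar_op_commute_mat_at) (use 4 am m b in auto)
    then show ?case using preserves_sym_commute[OF am] by simp
  qed (use preserves_sym_one[OF am] preserves_sym_mult[OF am] in auto)
  then show ?thesis by simp
qed

lemma L_string_commute_Pop:
  assumes "a + 1 < m" "s + k \<le> m" "a + 1 < s \<or> s + k \<le> a"
  shows "Pop m a * L_string m s k z = L_string m s k z * Pop m a"
  unfolding Pop_def by (rule scalar_op_commute_L_string) (use assms in auto)

text \<open>
  The inverse of the fused R-matrix preserves symmetric vectors as well, because the intertwining
  relation of each pair of R-matrices can be inverted.
\<close>

lemma fused_R_preserves_sym:
  assumes q2: "q\<^sup>2 \<noteq> 1" and zw: "separated z w" "z \<noteq> 0" "w \<noteq> 0"
    and a: "a + 1 < k \<or> k \<le> a \<and> a + 1 < k + l"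
  shows "\<exists>Y. blk_inverse (k + l) (fused_R k l z w) Y \<and> preserves_sym (k + l) a (fused_R k l z w)
    \<and> preserves_sym (k + l) a Y"
proof -
  define m where "m = k + l"
  have am: "a + 1 < m" using a by (auto simp: m_def)
  let ?G = "{X. \<exists>Y. blk_inverse m X Y \<and> preserves_sym m a X \<and> preserves_sym m a Y}"
  have pair: "A * B \<in> ?G"
    if "blk_inverse m A A'" "blk_inverse m B B'" and D: "Dop m a * (A * B) = B * A * Dop m a" for A B A' B'
  proof -
    have e: "blk_inverse m (A * B) (B' * A')" "blk_inverse m (B * A) (A' * B')"
      using that blk_inverse_mult by blast+
    have "A' * B' * (Dop m a * (A * B)) * (B' * A') = A' * B' * (B * A) * (Dop m a * (B' * A'))"
      unfolding D by (simp only: mult.assoc)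
    then have "A' * B' * Dop m a * ((A * B) * (B' * A')) = A' * B' * (B * A) * (Dop m a * (B' * A'))"
      by (simp only: mult.assoc)
    then have "A' * B' * Dop m a * blk_unit m = blk_unit m * (Dop m a * (B' * A'))"
      by (simp only: e[unfolded blk_inverse_def])
    then have "A' * B' * (Dop m a * blk_unit m) = (blk_unit m * Dop m a) * (B' * A')"
      by (simp only: mult.assoc)
    moreover have "Dop m a * blk_unit m = Dop m a" "blk_unit m * Dop m a = Dop m a"
      by (simp_all add: left_diff_distrib right_diff_distrib)
    ultimately have "Dop m a * (B' * A') = A' * B' * Dop m a" by (simp only:)
    then show ?thesis using e(1) preserves_sym_intertwine[OF am D] preserves_sym_intertwine[OF am] by blast
  qed
  have "fused_R k l z w \<in> ?G"
  proof (rule fused_R_closed[OF _ _ zw a], goal_cases)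
    case 1
    show ?case using blk_inverse_one preserves_sym_one[OF am] preserves_sym_blk_unit[OF am] by blast
  next
    case (2 X Y)
    then show ?case using blk_inverse_mult preserves_sym_mult[OF am] by blast
  next
    case (3 c d x y)
    then obtain Y where Y: "blk_inverse m (Rop m c d x y) (scalar_op m [c, d] Y)"
      using Rop_blk_inverse[of x y c m d] by (auto simp: m_def)
    have "preserves_sym m a (scalar_op m [c, d] Z)" for Z
      by (rule preserves_sym_commute[OF am], rule Pop_commute_scalar_op) (use 3 am in \<open>auto simp: m_def\<close>)
    then show ?case using Y unfolding m_def[symmetric] Rop_def by blast
  next
    case (4 c x y)
    have g: "separated (q\<^sup>2 * x) y" using separated_power[OF 4(1), of 1 0] by simp
    obtain A' where A': "blk_inverse m (Rop m a c x y) A'"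
      using Rop_blk_inverse[OF 4(1), of a m c] 4 am by (auto simp: m_def)
    obtain B' where B': "blk_inverse m (Rop m (a + 1) c (q\<^sup>2 * x) y) B'"
      using Rop_blk_inverse[OF g, of "a + 1" m c] 4 am by (auto simp: m_def)
    show ?case unfolding m_def[symmetric]
      by (rule pair[OF A' B' Dop_Rop_Rop(1)]) (use 4 am q2 in \<open>auto simp: m_def\<close>)
  next
    case (5 c x y)
    have g: "separated y x" "separated y (q\<^sup>2 * x)" using separated_power[OF 5(1), of 1 0] 5(1) separated_sym by auto
    obtain A' where A': "blk_inverse m (Rop m c (a + 1) y (q\<^sup>2 * x)) A'"
      using Rop_blk_inverse[OF g(2), of c m "a + 1"] 5 am by (auto simp: m_def)
    obtain B' where B': "blk_inverse m (Rop m c a y x) B'"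
      using Rop_blk_inverse[OF g(1), of c m a] 5 am by (auto simp: m_def)
    show ?case unfolding m_def[symmetric]
      by (rule pair[OF A' B' Dop_Rop_Rop(2)]) (use 5 am q2 in \<open>auto simp: m_def\<close>)
  qed
  then show ?thesis by (simp add: m_def)
qed

lemma fused_R_commute_Pop:
  assumes q2: "q\<^sup>2 = 1" and zw: "separated z w" "z \<noteq> 0" "w \<noteq> 0"
    and a: "a + 1 < k \<or> k \<le> a \<and> a + 1 < k + l"
  shows "Pop (k + l) a * fused_R k l z w = fused_R k l z w * Pop (k + l) a"
proof -
  define m where "m = k + l"
  have am: "a + 1 < m" using a by (auto simp: m_def)
  have "fused_R k l z w \<in> {X. Pop m a * X = X * Pop m a}"
  proof (rule fused_R_closed[OF _ _ zw a], goal_cases)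
    case (2 X Y)
    then show ?case by simp (metis mult.assoc)
  next
    case (3 c d x y)
    then show ?case unfolding m_def[symmetric] Rop_def
      using Pop_commute_scalar_op[of a "[c, d]" m] am by (auto simp: m_def)
  next
    case (4 c x y)
    then show ?case using Pop_commute_Rop_Rop(1)[OF am, of c x y] q2 by (simp add: m_def)
  next
    case (5 c x y)
    then show ?case using Pop_commute_Rop_Rop(2)[OF am, of c y x] q2 by (simp add: m_def)
  qed simp
  then show ?thesis by (simp add: m_def)
qed

end

context l_operator_algebra
begin

section \<open>Commutativity of the traces of antisymmetrizers\<close>

definition pi_at :: "nat \<Rightarrow> nat \<Rightarrow> nat \<Rightarrow> (nat \<Rightarrow> nat) \<Rightarrow> ('n, 'a) lmat"
  where "pi_at m s n \<tau> = scalar_op m [s..<s + n] (pi_q q n \<tau>)"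

lemma pi_q_rep: "is_pi_q q n (pi_q q n :: _ \<Rightarrow> ('n, complex) tensor_op)"
  by (rule pi_q_is_representation[OF q_nonzero])

lemma perm_rep_pi_at:
  assumes "s + n \<le> m" shows "perm_rep n (pi_at m s n)"
proof
  fix \<sigma> \<tau> :: "nat \<Rightarrow> nat" assume perms: "\<sigma> permutes {..<n}" "\<tau> permutes {..<n}"
  have ps: "distinct [s..<s + n]" "set [s..<s + n] \<subseteq> {..<m}" "length [s..<s + n] = n" using assms by auto
  have "top_eq n (pi_q q n (\<sigma> \<circ> \<tau>)) (top_mult n (pi_q q n \<sigma>) (pi_q q n \<tau>) :: ('n, complex) tensor_op)"
    using pi_q_rep[of n, unfolded is_pi_q_def] perms by blast
  then show "pi_at m s n (\<sigma> \<circ> \<tau>) = pi_at m s n \<sigma> * pi_at m s n \<tau>"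
    unfolding pi_at_def scalar_op_mult[OF ps, symmetric] by (rule scalar_op_cong[OF _ ps(3)])
qed

lemma pi_at_id: "pi_at m s n id = blk_unit m"
  unfolding pi_at_def scalar_op_one[of m "[s..<s + n]", symmetric]
  using pi_q_rep[of n, unfolded is_pi_q_def] by (intro scalar_op_cong[of n]) auto

lemma scalar_op_act_adjacent:
  assumes "s + n \<le> m" "a + 1 < n"
  shows "scalar_op m [s..<s + n] (act_adjacent a X) = scalar_op m [s + a, s + a + 1] X"
proof -
  have ps: "distinct [s..<s + n]" "set [s..<s + n] \<subseteq> {..<m}" "length [s..<s + n] = n" using assms by auto
  have "scalar_op m [s..<s + n] (act_adjacent a X) = scalar_op m [s..<s + n] (site [a, a + 1] X)"
    using assms by (intro scalar_op_cong[OF _ ps(3)] blk_eqD blk_act_adjacent) auto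
  also have "\<dots> = scalar_op m [s + a, s + a + 1] X"
    using assms by (subst scalar_op_site[OF ps(1,2)]) auto
  finally show ?thesis .
qed

lemma pi_at_adjacent:
  assumes "s + n \<le> m" "a + 1 < n"
  shows "pi_at m s n (Transposition.transpose a (a + 1)) = Pop m (s + a)"
proof -
  have "pi_at m s n (Transposition.transpose a (a + 1)) = scalar_op m [s..<s + n] (act_adjacent a (Pq q))"
    unfolding pi_at_def using pi_q_rep[of n, unfolded is_pi_q_def] assms by (intro scalar_op_cong[of n]) auto
  then show ?thesis unfolding Pop_def scalar_op_act_adjacent[OF assms] .
qed

text \<open>The antisymmetrizer without the factor \<open>1 / n!\<close>.\<close>

definition anti_op :: "nat \<Rightarrow> ('n, complex) tensor_op"
  where "anti_op n = (\<lambda>I J. \<Sum>\<tau>\<in>{\<tau>. \<tau> permutes {..<n}}. of_int (sign \<tau>) * pi_q q n \<tau> I J)"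

lemma scalar_op_anti_op: "scalar_op m [s..<s + n] (anti_op n) = perm_rep.anti (pi_at m s n) n"
  if "s + n \<le> m"
  by (simp add: anti_op_def perm_rep.anti_def[OF perm_rep_pi_at[OF that]] scalar_op_sum scalar_op_of_int pi_at_def)

lemma tr_op_scale: "tr_op (\<lambda>I J. c * X I J) k z = cscale c (tr_op X k z)"
  unfolding tr_op_conv_ltrace scalar_op_scale lscale_mult_left
  by (simp add: ltrace_def ent_lscale scale_sum_right)

lemma tr_op_anti_op: "tr_op (anti_op n) n z = of_nat (fact n) * t_fun cscale q L n z"
proof -
  have "(anti_op n :: ('n, complex) tensor_op) = (\<lambda>I J. fact n * q_antisymmetrizer q n I J)"
    by (intro ext) (simp add: anti_op_def q_antisymmetrizer_def)
  then show ?thesis by (simp add: tr_op_scale t_fun_conv_tr_op of_nat_mult_conv_cscale)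
qed

lemma anti_op_Pop:
  assumes "s + n \<le> m" "a + 1 < n"
  shows "scalar_op m [s..<s + n] (anti_op n) * Pop m (s + a) = - scalar_op m [s..<s + n] (anti_op n)"
proof -
  have "Transposition.transpose a (a + 1) permutes {..<n}" using assms by (intro permutes_swap_id) auto
  then show ?thesis
    unfolding scalar_op_anti_op[OF assms(1)] pi_at_adjacent[OF assms, symmetric]
    by (subst perm_rep.anti_mult_rep[OF perm_rep_pi_at[OF assms(1)] order_refl]) (simp_all add: sign_swap_id)
qed

lemma mult_anti_op:
  assumes m: "s + n \<le> m" and X: "X * blk_unit m = X"
    and adj: "\<And>a. s \<le> a \<Longrightarrow> a + 1 < s + n \<Longrightarrow> X * Pop m a = - X"
  shows "X * scalar_op m [s..<s + n] (anti_op n) = of_nat (fact n) * X"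
  unfolding scalar_op_anti_op[OF m]
proof (rule perm_rep.mult_anti[OF perm_rep_pi_at[OF m] order_refl])
  show "X * pi_at m s n id = X" by (simp only: pi_at_id X)
  fix a assume a: "a + 1 < n"
  show "X * pi_at m s n (Transposition.transpose a (a + 1)) = - X"
    unfolding pi_at_adjacent[OF m a] by (rule adj) (use a in auto)
qed

text \<open>
  The element \<open>B\<close> is half of \<open>B (1 - P)\<close>, and \<open>(1 - P) Y (1 + P) = 0\<close>.
\<close>

lemma mult_Pop_of_preserves_sym:
  assumes a: "a + 1 < m" and B: "B * blk_unit m = B" "B * Pop m a = - B" and Y: "preserves_sym m a Y"
  shows "B * Y * Pop m a = - (B * Y)"
proof -
  have BD: "B * Dop m a = of_nat 2 * B" using B by (simp add: right_diff_distrib mult_2)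
  have "of_nat 2 * (B * Y * Sop m a) = B * Dop m a * Y * Sop m a"
    unfolding BD by (simp only: mult.assoc)
  also have "\<dots> = B * (Dop m a * Y * Sop m a)" by (simp only: mult.assoc)
  also have "\<dots> = of_nat 2 * 0" using Y by (simp add: preserves_sym_def)
  finally have "B * Y * Sop m a = 0" by (rule lmat_of_nat_mult_cancel) simp
  moreover have "B * Y * blk_unit m = B * Y"
    by (metis B(1) blk_unit_central mult.assoc)
  ultimately show ?thesis by (simp add: distrib_left eq_neg_iff_add_eq_0 add.commute)
qed

text \<open>
  The trace of \<open>B W\<close> is invariant under conjugation of \<open>W\<close> by an invertible scalar \<open>R\<close> as soon as
  the quasi-idempotent \<open>B\<close> satisfies \<open>B Y B = c B Y\<close> for \<open>Y = R\<close>, \<open>R\<^sup>-\<^sup>1\<close> and \<open>W\<close>: these identities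
  allow copies of \<open>B\<close> to be inserted on both sides of \<open>R\<close> before the trace is rotated.
\<close>

lemma ltrace_conjugate:
  fixes B R V W :: "('n, 'a) lmat"
  assumes c: "c > 0" and inv: "blk_inverse m R V"
    and cent: "central_entries B" "central_entries R" and Be: "B * blk_unit m = B"
    and absorb: "B * B = of_nat c * B" "B * R * B = of_nat c * (B * R)"
      "B * V * B = of_nat c * (B * V)" "B * W * B = of_nat c * (B * W)"
  shows "ltrace m (B * (V * W * R)) = ltrace m (B * W)"
proof -
  define sc where "sc X = of_nat c * X" for X :: "('n, 'a) lmat"
  have sc: "X * sc Y = sc (X * Y)" "sc X * Y = sc (X * Y)" for X Y
    unfolding sc_def by (simp_all only: mult.assoc[symmetric] mult_of_nat_commute[of c X, symmetric])
  note absorb_sc = absorb[folded sc_def]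
  have "B * V * (B * W) * (B * R * B) = sc (B * V * (B * W * B) * R)"
    unfolding absorb_sc(2) by (simp only: sc mult.assoc)
  also have "\<dots> = sc (sc (B * V * B * W * R))"
    unfolding absorb_sc(4) by (simp only: sc mult.assoc)
  also have "\<dots> = sc (sc (sc (B * (V * W * R))))"
    unfolding absorb_sc(3) by (simp only: sc mult.assoc)
  finally have 1: "B * V * (B * W) * (B * R * B) = sc (sc (sc (B * (V * W * R))))" .
  have "(B * R * B) * (B * V * (B * W)) = B * R * (B * B) * V * B * W" by (simp only: mult.assoc)
  also have "\<dots> = sc (B * R * (B * V * B) * W)"
    unfolding absorb_sc(1) by (simp only: sc mult.assoc)
  also have "\<dots> = sc (sc (B * R * B * V * W))"
    unfolding absorb_sc(3) by (simp only: sc mult.assoc)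
  also have "\<dots> = sc (sc (sc (B * (R * V) * W)))"
    unfolding absorb_sc(2) by (simp only: sc mult.assoc)
  also have "B * (R * V) * W = B * W" using inv Be by (simp add: blk_inverse_def)
  finally have 2: "(B * R * B) * (B * V * (B * W)) = sc (sc (sc (B * W)))" .
  have "ltrace m (B * V * (B * W) * (B * R * B)) = ltrace m ((B * R * B) * (B * V * (B * W)))"
    by (rule ltrace_mult_commute[symmetric]) (intro central_entries_mult cent)
  then have "of_nat c * (of_nat c * (of_nat c * ltrace m (B * (V * W * R))))
      = of_nat c * (of_nat c * (of_nat c * ltrace m (B * W)))"
    unfolding 1 2 sc_def ltrace_of_nat_mult .
  then show ?thesis using of_nat_mult_cancel c by metis
qed

text \<open>
  For \<open>B\<close> the product of the antisymmetrizers in the first \<open>k\<close> and the last \<open>l\<close> factors, a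
  right factor \<open>B\<close> is absorbed, up to \<open>k! l!\<close>, by everything that is right antisymmetric in
  both groups of factors.
\<close>

lemma tr_op_anti_op_commute:
  assumes q2: "q\<^sup>2 \<noteq> 1" and zw: "separated z w" "z \<noteq> 0" "w \<noteq> 0"
  shows "tr_op (anti_op k) k z * tr_op (anti_op l) l w = tr_op (anti_op l) l w * tr_op (anti_op k) k z"
proof -
  define m where "m = k + l"
  define A where "A = (scalar_op m [0..<k] (anti_op k) :: ('n, 'a) lmat)"
  define A' where "A' = (scalar_op m [k..<m] (anti_op l) :: ('n, 'a) lmat)"
  define B where "B = A * A'"
  define R where "R = fused_R k l z w"
  define W where "W = L_string m k l w * L_string m 0 k z"
  have AA': "A * A' = A' * A"
    unfolding A_def A'_def by (rule scalar_op_commute) (auto simp: m_def)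
  have Be: "B * blk_unit m = B" by (simp add: B_def A'_def mult.assoc)
  have BP: "B * Pop m a = - B" if a: "a + 1 < k \<or> k \<le> a \<and> a + 1 < k + l" for a
  proof (cases "a + 1 < k")
    case True
    have "A * Pop m a = - A"
      using anti_op_Pop[of 0 k m a] True by (simp add: A_def m_def)
    then show ?thesis by (simp add: B_def AA' mult.assoc)
  next
    case False
    then obtain b where b: "a = k + b" "b + 1 < l" using a le_Suc_ex by auto
    have "A' * Pop m a = - A'"
      using anti_op_Pop[of k l m b] b by (simp add: A'_def m_def)
    then show ?thesis by (simp add: B_def mult.assoc)
  qed
  have absorb: "X * B = of_nat (fact k * fact l) * X"
    if X: "X * blk_unit m = X" and adj: "\<And>a. a + 1 < k \<or> k \<le> a \<and> a + 1 < k + l \<Longrightarrow> X * Pop m a = - X" for X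
  proof -
    have 1: "X * A = of_nat (fact k) * X" unfolding A_def
      using mult_anti_op[of 0 k m X] X adj by (simp add: m_def)
    have 2: "X * A' = of_nat (fact l) * X" unfolding A'_def
      using mult_anti_op[of k l m X] X adj by (simp add: m_def)
    have "X * B = (X * A) * A'" by (simp only: B_def mult.assoc)
    also have "\<dots> = of_nat (fact k) * (X * A')" unfolding 1 by (rule mult.assoc)
    finally show ?thesis unfolding 2 by (simp only: of_nat_mult mult.assoc)
  qed
  have absorb_sym: "B * Y * B = of_nat (fact k * fact l) * (B * Y)"
    if Y: "\<And>a. a + 1 < k \<or> k \<le> a \<and> a + 1 < k + l \<Longrightarrow> preserves_sym m a Y" for Y
  proof (rule absorb)
    show "B * Y * blk_unit m = B * Y" by (metis Be blk_unit_central mult.assoc)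
    show "B * Y * Pop m a = - (B * Y)" if a: "a + 1 < k \<or> k \<le> a \<and> a + 1 < k + l" for a
      by (rule mult_Pop_of_preserves_sym[OF _ Be BP[OF a] Y[OF a]]) (use a in \<open>auto simp: m_def\<close>)
  qed
  obtain V where V: "blk_inverse m R V" using fused_R_invertible[OF zw(1)] unfolding R_def m_def by blast
  have V_unit: "V * R = blk_unit m" using V by (simp add: blk_inverse_def)
  have sym_R: "preserves_sym m a R" and sym_V: "preserves_sym m a V"
    if a: "a + 1 < k \<or> k \<le> a \<and> a + 1 < k + l" for a
  proof -
    obtain Y where Y: "blk_inverse m R Y" "preserves_sym m a R" "preserves_sym m a Y"
      using fused_R_preserves_sym[OF q2 zw a] unfolding R_def m_def by blast
    show "preserves_sym m a R" by fact
    have am: "a + 1 < m" using a by (auto simp: m_def)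
    have "blk_unit m * V = Y * blk_unit m"
      using V Y(1) unfolding blk_inverse_def by (metis mult.assoc)
    moreover have "preserves_sym m a X" if "preserves_sym m a (blk_unit m * X)" for X
    proof -
      have "Dop m a * (blk_unit m * X) = Dop m a * X"
        by (simp add: left_diff_distrib right_diff_distrib flip: mult.assoc)
      then show ?thesis using that by (simp add: preserves_sym_def)
    qed
    ultimately show "preserves_sym m a V"
      using preserves_sym_mult[OF am Y(3) preserves_sym_blk_unit[OF am]] by metis
  qed
  have sym_W: "preserves_sym m a W" if a: "a + 1 < k \<or> k \<le> a \<and> a + 1 < k + l" for a
  proof -
    have am: "a + 1 < m" using a by (auto simp: m_def)
    show ?thesis
    proof (cases "a + 1 < k")
      case True
      then show ?thesis unfolding W_def
        by (intro preserves_sym_mult[OF am] L_string_preserves_sym[OF q2 zw(2)]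
            preserves_sym_commute[OF am] L_string_commute_Pop[OF am]) (auto simp: m_def)
    next
      case False
      then show ?thesis unfolding W_def using a
        by (intro preserves_sym_mult[OF am] L_string_preserves_sym[OF q2 zw(3)]
            preserves_sym_commute[OF am] L_string_commute_Pop[OF am]) (auto simp: m_def)
    qed
  qed
  have "ltrace m (B * (V * W * R)) = ltrace m (B * W)"
  proof (rule ltrace_conjugate[OF _ V])
    show "central_entries B" unfolding B_def A_def A'_def by (intro central_entries_mult central_entries_scalar_op)
    show "central_entries R" unfolding R_def by (rule central_entries_fused_R)
    show "B * B = of_nat (fact k * fact l) * B" using absorb[OF Be BP] by simp
    show "B * R * B = of_nat (fact k * fact l) * (B * R)" by (rule absorb_sym[OF sym_R])
    show "B * V * B = of_nat (fact k * fact l) * (B * V)" by (rule absorb_sym[OF sym_V])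
    show "B * W * B = of_nat (fact k * fact l) * (B * W)" by (rule absorb_sym[OF sym_W])
  qed (simp_all add: Be)
  moreover have "B * (V * W * R) = B * (L_string m 0 k z * L_string m k l w)"
  proof -
    have "W * R = R * (L_string m 0 k z * L_string m k l w)"
      unfolding W_def R_def by (rule fused_R_exchange[OF zw m_def, symmetric])
    then have "B * (V * W * R) = B * (V * R) * (L_string m 0 k z * L_string m k l w)"
      by (simp only: mult.assoc)
    then show ?thesis unfolding V_unit Be .
  qed
  ultimately show ?thesis
    unfolding tr_op_mult[OF m_def] B_def A_def A'_def W_def by simp
qed

text \<open>
  For \<open>q\<^sup>2 = 1\<close> the fused R-matrix commutes with the whole images of both symmetric groups, and
  the trace can be rotated at once.  The hypotheses on \<open>X\<close> and \<open>Y\<close> hold for everything that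
  the operators of adjacent transpositions generate.
\<close>

lemma tr_op_commute_diagonal:
  fixes X Y :: "('n, complex) tensor_op"
  assumes q2: "q\<^sup>2 = 1" and zw: "separated z w" "z \<noteq> 0" "w \<noteq> 0" and m: "m = k + l"
    and X: "\<And>U. blk_unit m * U = U * blk_unit m \<Longrightarrow> (\<And>a. a + 1 < k \<Longrightarrow> Pop m a * U = U * Pop m a)
      \<Longrightarrow> scalar_op m [0..<k] X * U = U * scalar_op m [0..<k] X"
    and Y: "\<And>U. (\<And>a. k \<le> a \<Longrightarrow> a + 1 < m \<Longrightarrow> Pop m a * U = U * Pop m a)
      \<Longrightarrow> scalar_op m [k..<m] Y * U = U * scalar_op m [k..<m] Y"
  shows "tr_op X k z * tr_op Y l w = tr_op Y l w * tr_op X k z"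
proof -
  define B where "B = (scalar_op m [0..<k] X * scalar_op m [k..<m] Y :: ('n, 'a) lmat)"
  define R where "R = fused_R k l z w"
  define W where "W = L_string m k l w * L_string m 0 k z"
  obtain V where V: "V * R = blk_unit m" "R * V = blk_unit m"
    using fused_R_invertible[OF zw(1)] unfolding R_def m blk_inverse_def by blast
  have PR: "Pop m a * R = R * Pop m a" if "a + 1 < k \<or> k \<le> a \<and> a + 1 < k + l" for a
    unfolding R_def m by (rule fused_R_commute_Pop[OF q2 zw that])
  have "scalar_op m [0..<k] X * R = R * scalar_op m [0..<k] X" using PR by (intro X) (auto simp: blk_unit_central)
  moreover have "scalar_op m [k..<m] Y * R = R * scalar_op m [k..<m] Y" using PR m by (intro Y) auto
  moreover have "x * y * r = r * (x * y)" if "x * r = r * x" "y * r = r * y" for x y r :: "('n, 'a) lmat"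
    unfolding mult.assoc that(2) unfolding mult.assoc[symmetric] that(1) ..
  ultimately have BR: "B * R = R * B" unfolding B_def by blast
  have Be: "B * blk_unit m = B" by (simp add: B_def mult.assoc)
  have WR: "W * R = R * (L_string m 0 k z * L_string m k l w)"
    unfolding W_def R_def by (rule fused_R_exchange[OF zw m, symmetric])
  have "B * V * W * R = B * (V * R) * (L_string m 0 k z * L_string m k l w)"
    by (simp only: WR mult.assoc)
  then have "B * (L_string m 0 k z * L_string m k l w) = B * V * W * R"
    unfolding V Be ..
  then have "ltrace m (B * (L_string m 0 k z * L_string m k l w)) = ltrace m (R * (B * V * W))"
    using ltrace_mult_commute[OF central_entries_fused_R, of m k l z w "B * V * W"] by (simp add: R_def)
  also have "R * (B * V * W) = (R * B) * (V * W)" by (simp only: mult.assoc)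
  also have "\<dots> = B * (R * V) * W" unfolding BR[symmetric] by (simp only: mult.assoc)
  also have "\<dots> = B * W" unfolding V Be ..
  finally show ?thesis
    unfolding tr_op_mult[OF m] B_def W_def .
qed

end

section \<open>Newton identities\<close>

text \<open>A cycle of the first \<open>j + 1\<close> factors, as a product of adjacent transpositions.\<close>

primrec cycle_op :: "complex \<Rightarrow> nat \<Rightarrow> nat \<Rightarrow> ('n::{finite,linorder}, complex) tensor_op"
  where
    "cycle_op q n 0 = top_one"
  | "cycle_op q n (Suc j) = top_mult n (act_adjacent j (Pq q)) (cycle_op q n j)"

context l_operator_algebra
begin

lemma scalar_op_cycle_op:
  assumes "s + n \<le> m" "j = 0 \<or> j < n"
  shows "scalar_op m [s..<s + n] (cycle_op q n j) = blk_unit m * oprod_rev (\<lambda>i. Pop m (s + i)) j"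
  using assms(2)
proof (induction j)
  case 0
  then show ?case by (simp add: scalar_op_one)
next
  case (Suc j)
  have ps: "distinct [s..<s + n]" "set [s..<s + n] \<subseteq> {..<m}" "length [s..<s + n] = n" using assms by auto
  have "scalar_op m [s..<s + n] (act_adjacent j (Pq q)) = Pop m (s + j)"
    unfolding Pop_def using Suc.prems assms by (intro scalar_op_act_adjacent) auto
  then have "scalar_op m [s..<s + n] (cycle_op q n (Suc j))
      = Pop m (s + j) * (blk_unit m * oprod_rev (\<lambda>i. Pop m (s + i)) j)"
    using Suc by (simp add: scalar_op_mult[OF ps])
  also have "\<dots> = blk_unit m * (Pop m (s + j) * oprod_rev (\<lambda>i. Pop m (s + i)) j)"
    by (simp only: mult.assoc[symmetric] blk_unit_central[of m "Pop m (s + j)", symmetric])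
  finally show ?case by simp
qed

lemma pi_at_restrict:
  assumes \<tau>: "\<tau> permutes {..<j}" and m: "j \<le> n" "s + n \<le> m"
  shows "pi_at m s n \<tau> = pi_at m s j \<tau>"
  using \<tau>
proof (induction rule: permutes_adjacent_induct)
  case id
  show ?case by (simp only: pi_at_id)
next
  case (swap a \<sigma>)
  let ?s = "Transposition.transpose a (a + 1)"
  have "?s permutes {..<j}" using swap by (intro permutes_swap_id) auto
  moreover from this have "?s permutes {..<n}" using m by (auto intro: permutes_subset)
  moreover have "\<sigma> permutes {..<n}" using swap m by (auto intro: permutes_subset)
  ultimately have "pi_at m s n (\<sigma> \<circ> ?s) = pi_at m s n \<sigma> * pi_at m s n ?s"
      "pi_at m s j (\<sigma> \<circ> ?s) = pi_at m s j \<sigma> * pi_at m s j ?s"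
    using perm_rep.rep_comp[OF perm_rep_pi_at] swap m by auto
  moreover have "pi_at m s n ?s = pi_at m s j ?s"
    using swap m by (simp only: pi_at_adjacent)
  ultimately show ?case using swap.IH by (simp only:)
qed

lemma anti_restrict:
  assumes "j \<le> n" shows "perm_rep.anti (pi_at n 0 n) j = scalar_op n [0..<j] (anti_op j)"
proof -
  have "perm_rep.anti (pi_at n 0 n) j = perm_rep.anti (pi_at n 0 j) j"
    unfolding perm_rep.anti_def[OF perm_rep_pi_at[of 0 n n, simplified]]
      perm_rep.anti_def[OF perm_rep_pi_at[of 0 j n, simplified, OF assms]]
    using assms by (intro sum.cong refl) (simp add: pi_at_restrict[of _ j n 0 n])
  also have "\<dots> = scalar_op n [0..<j] (anti_op j)" using scalar_op_anti_op[of 0 j n] assms by simp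
  finally show ?thesis .
qed

text \<open>
  The interpolating traces: an antisymmetrizer in the first \<open>j + 1\<close> factors and a cycle
  through the last of these and all the remaining ones.
\<close>

definition hook :: "nat \<Rightarrow> complex \<Rightarrow> nat \<Rightarrow> 'a"
  where "hook n z j = ltrace n (oprod_rev (\<lambda>i. Pop n (j + i)) (n - 1 - j)
    * perm_rep.anti (pi_at n 0 n) (Suc j) * L_string n 0 n z)"

abbreviation cycle_trace :: "nat \<Rightarrow> complex \<Rightarrow> 'a"
  where "cycle_trace n z \<equiv> tr_op (cycle_op q n (n - 1)) n z"

abbreviation anti_trace :: "nat \<Rightarrow> complex \<Rightarrow> 'a"
  where "anti_trace n z \<equiv> tr_op (anti_op n) n z"

lemma rep_unit_anti: "j \<le> n \<Longrightarrow> blk_unit n * perm_rep.anti (pi_at n 0 n) j = perm_rep.anti (pi_at n 0 n) j"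
  by (simp add: anti_restrict)

lemma hook_0: "n \<ge> 1 \<Longrightarrow> hook n z 0 = cycle_trace n z"
proof -
  assume n: "n \<ge> 1"
  have "{\<tau>. \<tau> permutes {..<Suc 0}} = {id :: nat \<Rightarrow> nat}" by (simp add: lessThan_Suc)
  then have "perm_rep.anti (pi_at n 0 n) (Suc 0) = blk_unit n"
    by (simp add: perm_rep.anti_def[OF perm_rep_pi_at[of 0 n n, simplified]] pi_at_id sign_id del: id_apply)
  moreover have "scalar_op n [0..<n] (cycle_op q n (n - 1)) = blk_unit n * oprod_rev (Pop n) (n - 1)"
    using scalar_op_cycle_op[of 0 n n "n - 1"] n by simp
  ultimately show ?thesis
    unfolding hook_def tr_op_conv_ltrace by (simp add: blk_unit_central)
qed

lemma hook_last: "n \<ge> 1 \<Longrightarrow> hook n z (n - 1) = anti_trace n z"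
  unfolding hook_def tr_op_conv_ltrace by (simp add: anti_restrict)

text \<open>
  Let \<open>j = i + 1\<close>.  Expanding the antisymmetrizer in \<open>j + 1\<close> factors by its last factor gives one
  term in which the trace splits and \<open>j\<close> terms with a transposition \<open>(a j)\<close>.  Each of these is
  conjugate to \<open>(j-1 j)\<close> by a permutation that the antisymmetrizer in \<open>j\<close> factors absorbs; here
  the \<open>q\<close>-Manin property carries the permutation through the L-operators.
\<close>

lemma hook_Suc:
  assumes q2: "q\<^sup>2 \<noteq> 1" and z: "z \<noteq> 0" and j: "Suc i < n"
  shows "hook n z (Suc i) = anti_trace (Suc i) z * cycle_trace (n - Suc i) (q ^ (2 * Suc i) * z)
    - of_nat (Suc i) * hook n z i"
proof -
  define j where "j = Suc i"
  have jn: "j < n" using j by (simp add: j_def)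
  interpret perm_rep n "pi_at n 0 n" using perm_rep_pi_at[of 0 n n] by simp
  define C where "C = oprod_rev (\<lambda>i. Pop n (j + i)) (n - 1 - j)"
  define A where "A = anti j"
  define LL where "LL = L_string n 0 n z"
  have C_pred: "oprod_rev (\<lambda>a. Pop n (i + a)) (n - 1 - i) = C * Pop n i"
  proof -
    have "n - 1 - i = Suc (n - 1 - j)" using jn by (simp add: j_def)
    then show ?thesis unfolding C_def j_def by (simp only: oprod_rev_shift) simp
  qed
  have conjugate: "ltrace n (C * pi_at n 0 n (Transposition.transpose a j) * A * LL) = hook n z i" if a: "a < j" for a
  proof -
    let ?\<sigma> = "Transposition.transpose a i" and ?s = "Transposition.transpose i (i + 1)"
    let ?sg = "of_int (sign ?\<sigma>) :: ('n, 'a) lmat"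
    let ?\<rho> = "pi_at n 0 n"
    have \<sigma>j: "?\<sigma> permutes {..<j}" using a by (intro permutes_swap_id) (auto simp: j_def)
    have \<sigma>: "?\<sigma> permutes {..<n}" using jn by (intro permutes_mono[OF \<sigma>j]) simp
    have s: "?s permutes {..<n}" using jn by (intro permutes_swap_id) (auto simp: j_def)
    have "Transposition.transpose a j = ?\<sigma> \<circ> ?s \<circ> ?\<sigma>"
      using a by (auto simp: fun_eq_iff Transposition.transpose_def j_def)
    then have "?\<rho> (Transposition.transpose a j) = ?\<rho> ?\<sigma> * ?\<rho> ?s * ?\<rho> ?\<sigma>"
      using \<sigma> s by (simp only: rep_comp permutes_compose)
    moreover have "?\<rho> ?s = Pop n i" using pi_at_adjacent[of 0 n n i] jn by (simp add: j_def)
    ultimately have conj: "?\<rho> (Transposition.transpose a j) = ?\<rho> ?\<sigma> * Pop n i * ?\<rho> ?\<sigma>" by simp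
    have left: "?\<rho> ?\<sigma> * A = ?sg * A"
      unfolding A_def using jn by (intro rep_mult_anti \<sigma>j) simp
    have AP: "A * Pop n b = - A" if "b + 1 < j" for b
      using anti_op_Pop[of 0 j n b] that jn by (simp add: A_def anti_restrict)
    have Ae: "A * blk_unit n = A" using jn by (simp add: A_def anti_restrict)
    have right: "A * LL * ?\<rho> ?\<sigma> = ?sg * (A * LL)"
    proof (rule mult_rep_sign[OF _ \<sigma>j])
      show "A * LL * ?\<rho> id = A * LL"
        unfolding pi_at_id mult.assoc blk_unit_central[of n LL, symmetric]
        unfolding mult.assoc[symmetric] Ae ..
      fix b assume b: "b + 1 < j"
      have "A * LL * Pop n b = - (A * LL)"
        by (rule mult_Pop_of_preserves_sym[OF _ Ae AP[OF b]])
          (use b jn in \<open>auto simp: LL_def intro!: L_string_preserves_sym[OF q2 z]\<close>)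
      then show "A * LL * ?\<rho> (Transposition.transpose b (b + 1)) = - (A * LL)"
        using pi_at_adjacent[of 0 n n b] b jn by simp
    qed (use jn in simp)
    have comm: "C * ?\<rho> ?\<sigma> = ?\<rho> ?\<sigma> * C"
    proof -
      have "C \<in> {X. X * ?\<rho> ?\<sigma> = ?\<rho> ?\<sigma> * X}"
        unfolding C_def
      proof (rule oprod_rev_closed, goal_cases)
        case (2 X Y)
        then have X: "X * ?\<rho> ?\<sigma> = ?\<rho> ?\<sigma> * X" and Y: "Y * ?\<rho> ?\<sigma> = ?\<rho> ?\<sigma> * Y" by auto
        have "X * Y * ?\<rho> ?\<sigma> = X * ?\<rho> ?\<sigma> * Y" by (simp only: mult.assoc Y)
        then show ?case by (simp add: X mult.assoc)
      next
        case (3 b)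
        have eq: "?\<rho> ?\<sigma> = scalar_op n [0..<j] (pi_q q j ?\<sigma>)"
          using pi_at_restrict[OF \<sigma>j, of n 0 n] jn by (simp add: pi_at_def)
        show ?case unfolding eq mem_Collect_eq by (rule Pop_commute_scalar_op) (use 3 jn in auto)
      qed simp
      then show ?thesis by simp
    qed
    have sg: "?sg * X = X * ?sg" for X by (rule mult_of_int_commute)
    have "C * ?\<rho> (Transposition.transpose a j) * A * LL = (C * ?\<rho> ?\<sigma>) * Pop n i * (?\<rho> ?\<sigma> * A) * LL"
      unfolding conj by (simp only: mult.assoc)
    also have "\<dots> = ?\<rho> ?\<sigma> * (C * Pop n i * (A * LL * ?sg))"
      unfolding comm left sg[of A] mult.assoc sg[of LL] ..
    finally have "ltrace n (C * ?\<rho> (Transposition.transpose a j) * A * LL)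
        = ltrace n (C * Pop n i * (A * LL * ?sg) * ?\<rho> ?\<sigma>)"
      using ltrace_mult_commute[OF central_entries_scalar_op] by (simp add: pi_at_def)
    also have "C * Pop n i * (A * LL * ?sg) * ?\<rho> ?\<sigma> = C * Pop n i * (?sg * (A * LL * ?\<rho> ?\<sigma>))"
      unfolding sg[of "A * LL", symmetric] by (simp only: mult.assoc)
    also have "\<dots> = C * Pop n i * (of_int (sign ?\<sigma> * sign ?\<sigma>) * (A * LL))"
      unfolding right by (simp only: mult.assoc of_int_mult)
    also have "\<dots> = C * Pop n i * A * LL" by (simp add: mult.assoc)
    finally show ?thesis
      unfolding hook_def C_pred A_def LL_def j_def .
  qed
  have "anti (Suc j) = A - (\<Sum>a<j. pi_at n 0 n (Transposition.transpose a j)) * A"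
    using anti_Suc[of j] jn rep_unit_anti[of j n] by (simp add: A_def left_diff_distrib pi_at_id)
  then have "C * anti (Suc j) * LL = C * A * LL - (\<Sum>a<j. C * pi_at n 0 n (Transposition.transpose a j) * A * LL)"
    by (simp add: right_diff_distrib left_diff_distrib sum_distrib_left sum_distrib_right mult.assoc)
  then have "hook n z j = ltrace n (C * A * LL) - (\<Sum>a<j. hook n z i)"
    using conjugate by (simp add: hook_def C_def LL_def ltrace_diff ltrace_sum)
  moreover have "ltrace n (C * A * LL) = anti_trace j z * cycle_trace (n - j) (q ^ (2 * j) * z)"
  proof -
    have n: "n = j + (n - j)" using jn by simp
    have split: "LL = L_string n 0 j z * L_string n j (n - j) (q ^ (2 * j) * z)"
    proof -
      have "LL = oprod (\<lambda>a. mat_at n (0 + a) (L (q ^ (2 * a) * z))) (j + (n - j))"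
        unfolding LL_def L_string_def using n by simp
      then show ?thesis
        unfolding oprod_add L_string_def by (simp add: distrib_left power_add mult_ac)
    qed
    have cyc: "scalar_op n [j..<n] (cycle_op q (n - j) (n - j - 1)) = blk_unit n * C"
    proof -
      have "n - j - 1 = 0 \<or> n - j - 1 < n - j" by auto
      from scalar_op_cycle_op[OF _ this, of j n] show ?thesis using jn by (simp add: C_def)
    qed
    have CA: "C * A = scalar_op n [0..<j] (anti_op j) * scalar_op n [j..<n] (cycle_op q (n - j) (n - j - 1))"
    proof -
      have "C * A = blk_unit n * C * A"
        using rep_unit_anti[of j n] jn
        by (metis A_def blk_unit_central less_imp_le mult.assoc)
      also have "\<dots> = scalar_op n [j..<n] (cycle_op q (n - j) (n - j - 1)) * scalar_op n [0..<j] (anti_op j)"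
        unfolding cyc using jn by (simp add: A_def anti_restrict)
      also have "\<dots> = scalar_op n [0..<j] (anti_op j) * scalar_op n [j..<n] (cycle_op q (n - j) (n - j - 1))"
        by (rule scalar_op_commute) (use jn in auto)
      finally show ?thesis .
    qed
    show ?thesis unfolding tr_op_mult(1)[OF n] CA split ..
  qed
  ultimately show ?thesis by (simp add: j_def)
qed

text \<open>
  The Newton identities express the traces of cycles through those of antisymmetrizers.  They are
  read downwards, from \<open>hook n x (n - 1)\<close>, the trace of the antisymmetrizer, to \<open>hook n x 0\<close>, that
  of the cycle; the coefficient of each new hook is a positive integer and can be cancelled.
\<close>

lemma cycle_trace_commute:
  assumes q2: "q\<^sup>2 \<noteq> 1" and z: "z \<noteq> 0" and n: "n \<ge> 1"
    and y: "\<And>j s. anti_trace j (q ^ (2 * s) * z) * y = y * anti_trace j (q ^ (2 * s) * z)"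
  shows "cycle_trace n (q ^ (2 * s) * z) * y = y * cycle_trace n (q ^ (2 * s) * z)"
  using n
proof (induction n arbitrary: s rule: less_induct)
  case (less n)
  define x where "x = q ^ (2 * s) * z"
  have x: "x \<noteq> 0" using z q_nonzero by (simp add: x_def)
  have anti: "anti_trace j x * y = y * anti_trace j x" for j unfolding x_def by (rule y)
  have "hook n x (n - 1 - d) * y = y * hook n x (n - 1 - d)" if "d \<le> n - 1" for d
    using that
  proof (induction d)
    case 0
    then show ?case using hook_last[OF less.prems] anti by simp
  next
    case (Suc d)
    define i where "i = n - 1 - Suc d"
    have i: "Suc i < n" "n - 1 - d = Suc i" using Suc.prems by (auto simp: i_def)
    have pow: "q ^ (2 * Suc i) * x = q ^ (2 * (Suc i + s)) * z"
      unfolding x_def distrib_left power_add by (rule mult.assoc[symmetric])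
    have c: "cycle_trace (n - Suc i) (q ^ (2 * Suc i) * x) * y = y * cycle_trace (n - Suc i) (q ^ (2 * Suc i) * x)"
      unfolding pow by (rule less.IH) (use i in auto)
    have h: "of_nat (Suc i) * hook n x i = anti_trace (Suc i) x * cycle_trace (n - Suc i) (q ^ (2 * Suc i) * x) - hook n x (Suc i)"
      unfolding hook_Suc[OF q2 x i(1)] by simp
    have "of_nat (Suc i) * (hook n x i * y) = of_nat (Suc i) * (y * hook n x i)"
    proof -
      have "of_nat (Suc i) * (hook n x i * y) = (of_nat (Suc i) * hook n x i) * y" by (simp only: mult.assoc)
      also have "\<dots> = y * (of_nat (Suc i) * hook n x i)"
      proof -
        have "u * v * y = y * (u * v)" if "u * y = y * u" "v * y = y * v" for u v
          unfolding mult.assoc that(2) unfolding mult.assoc[symmetric] that(1) ..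
        note this[OF anti[of "Suc i"] c]
        moreover have "hook n x (Suc i) * y = y * hook n x (Suc i)"
          using Suc.IH Suc.prems unfolding i(2) by simp
        ultimately show ?thesis
          unfolding h left_diff_distrib right_diff_distrib by (simp only:)
      qed
      also have "\<dots> = of_nat (Suc i) * (y * hook n x i)"
        by (metis mult.assoc mult_of_nat_commute)
      finally show ?thesis .
    qed
    then have "hook n x i * y = y * hook n x i" by (rule of_nat_mult_cancel) simp
    then show ?case by (simp add: i_def)
  qed
  from this[of "n - 1"] show ?case using hook_0[OF less.prems, of x] by (simp add: x_def)
qed

end

section \<open>Traces of quantum powers as traces of cycles\<close>

lemma sum_multi_indices_Suc:
  fixes f :: "'n::finite list \<Rightarrow> 'a::comm_monoid_add"
  shows "(\<Sum>I\<in>multi_indices (Suc k). f I) = (\<Sum>I\<in>multi_indices k. \<Sum>j\<in>UNIV. f (I @ [j]))"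
proof -
  have "bij_betw (\<lambda>(I, j). I @ [j]) (multi_indices k \<times> UNIV) (multi_indices (Suc k) :: 'n list set)"
    by (rule bij_betwI[where g = "\<lambda>I. (butlast I, last I)"]) (auto simp: length_Suc_conv_rev)
  then have "(\<Sum>I\<in>multi_indices (Suc k). f I) = (\<Sum>p\<in>multi_indices k \<times> UNIV. f (case p of (I, j) \<Rightarrow> I @ [j]))"
    by (rule sum.reindex_bij_betw[symmetric])
  then show ?thesis by (simp add: sum.cartesian_product split_def)
qed

lemma L_product_entry:
  assumes "length I = k" "length J = k" "j \<le> k"
  shows "L_product q L k z j I J =
    (if drop j I = drop j J then oprod (\<lambda>a. L (q ^ (2 * a) * z) $ (I ! a) $ (J ! a)) j else 0)"
  using assms(2,3)
proof (induction j arbitrary: J)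
  case 0
  then show ?case by (simp add: top_one_def)
next
  case (Suc j)
  let ?K = "take j J @ drop j I"
  let ?o = "oprod (\<lambda>a. L (q ^ (2 * a) * z) $ (I ! a) $ (J ! a))"
  have K: "length ?K = k" using Suc.prems assms(1) by simp
  have jk: "j \<le> k" using Suc.prems by simp
  have "L_product q L k z j I K * act_at j (L (q ^ (2 * j) * z)) K J
      = (if K = ?K then (if drop (Suc j) I = drop (Suc j) J then ?o (Suc j) else 0) else 0)"
    if "length K = k" for K
  proof (cases "K = ?K")
    case True
    have o: "oprod (\<lambda>a. L (q ^ (2 * a) * z) $ (I ! a) $ (K ! a)) j = ?o j"
      using Suc.prems by (intro oprod_cong) (simp add: True nth_append)
    have K: "K ! j = I ! j" "drop j I = drop j K" "take j K = take j J" "drop (j + 1) K = drop (j + 1) I"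
      using Suc.prems assms(1) unfolding True by (simp_all add: nth_append)
    have "L_product q L k z j I K = ?o j"
      unfolding Suc.IH[OF that jk] if_P[OF K(2)] by (rule o)
    moreover have "act_at j (L (q ^ (2 * j) * z)) K J
        = (if drop (j + 1) I = drop (j + 1) J then L (q ^ (2 * j) * z) $ (I ! j) $ (J ! j) else 0)"
      unfolding act_at_def K(1,3,4) by simp
    ultimately show ?thesis unfolding if_P[OF True] by simp
  next
    case False
    have "\<not> (drop j I = drop j K \<and> take j K = take j J)"
      using False by (metis append_take_drop_id)
    then have "L_product q L k z j I K = 0 \<or> act_at j (L (q ^ (2 * j) * z)) K J = 0"
      unfolding Suc.IH[OF that jk] act_at_def by auto
    then show ?thesis unfolding if_not_P[OF False] by auto
  qed
  then have "L_product q L k z (Suc j) I J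
      = (\<Sum>K\<in>multi_indices k. if K = ?K then (if drop (Suc j) I = drop (Suc j) J then ?o (Suc j) else 0) else 0)"
    by (simp add: top_mult_def)
  also have "\<dots> = (if drop (Suc j) I = drop (Suc j) J then ?o (Suc j) else 0)"
    using K by (subst sum.delta) simp_all
  finally show ?case .
qed

text \<open>
  The cycle takes the last of the first \<open>j + 1\<close> indices to the front, at the cost of a power of
  \<open>q\<close> for each index that it passes.
\<close>

lemma top_apply_cycle_op:
  fixes I :: "'n::{finite,linorder} list"
  assumes "length I = k" "j < k"
  shows "top_apply k (cycle_op q k j) F I =
    (\<Prod>i<j. q powi ord_sgn (I ! i) (I ! j)) * F (I ! j # take j I @ drop (Suc j) I)"
  using assms
proof (induction j arbitrary: I)
  case 0
  then have "I ! 0 # drop (Suc 0) I = I" by (metis Cons_nth_drop_Suc drop0)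
  then show ?case
    using 0 by (simp add: top_apply_def top_one_def if_distrib[of "\<lambda>x. x * _"] cong: if_cong)
next
  case (Suc j)
  let ?I = "I[j := I ! (j + 1), j + 1 := I ! j]"
  have adj: "top_apply k (act_adjacent j (Pq q)) G I = q powi ord_sgn (I ! j) (I ! (j + 1)) * G ?I" for G
  proof -
    let ?P = "exchange_op (\<lambda>_ _. 0) (\<lambda>i j. q powi ord_sgn i j) :: ('n, complex) tensor_op"
    have "top_eq k (act_adjacent j (Pq q)) (site [j, j + 1] (Pq q) :: ('n, complex) tensor_op)"
      using Suc.prems by (intro blk_eqD blk_act_adjacent) simp
    moreover have "top_eq k (site [j, j + 1] (Pq q)) (site [j, j + 1] ?P)"
      using Pq_conv_exchange[of q] by (auto simp: top_eq_def site_def)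
    ultimately have "top_apply k (act_adjacent j (Pq q)) G I = top_apply k (site [j, j + 1] ?P) G I"
      using Suc.prems by (auto simp: top_eq_def top_apply_def intro!: sum.cong)
    then show ?thesis using Suc.prems by (simp add: top_apply_exchange)
  qed
  have len: "length ?I = k" using Suc.prems by simp
  have nth: "?I ! j = I ! Suc j" "i < j \<Longrightarrow> ?I ! i = I ! i" for i
    using Suc.prems by (simp_all add: nth_list_update)
  have perm: "?I ! j # take j ?I @ drop (Suc j) ?I = I ! Suc j # take (Suc j) I @ drop (Suc (Suc j)) I"
  proof -
    have "drop (Suc j) ?I = I ! j # drop (Suc (Suc j)) I"
      using Suc.prems by (subst Cons_nth_drop_Suc[symmetric]) (auto simp: drop_update_cancel)
    then show ?thesis using Suc.prems by (simp add: nth(1) take_Suc_conv_app_nth)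
  qed
  have "top_apply k (cycle_op q k (Suc j)) F I
      = q powi ord_sgn (I ! j) (I ! (j + 1)) * top_apply k (cycle_op q k j) F ?I"
    by (simp add: top_apply_mult adj)
  also have "\<dots> = q powi ord_sgn (I ! j) (I ! Suc j)
      * ((\<Prod>i<j. q powi ord_sgn (?I ! i) (?I ! j)) * F (?I ! j # take j ?I @ drop (Suc j) ?I))"
    using Suc.IH[OF len] Suc.prems by simp
  also have "(\<Prod>i<j. q powi ord_sgn (?I ! i) (?I ! j)) = (\<Prod>i<j. q powi ord_sgn (I ! i) (I ! Suc j))"
    by (intro prod.cong refl) (simp only: nth lessThan_iff)
  finally show ?case unfolding perm by simp
qed

lemma cycle_op_entry:
  fixes I :: "'n::{finite,linorder} list"
  assumes "length I = k" "length J = Suc k"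
  shows "cycle_op q (Suc k) k (I @ [i]) J =
    (if J = i # I then \<Prod>a<k. q powi ord_sgn (I ! a) i else 0)"
proof -
  have "cycle_op q (Suc k) k (I @ [i]) J = top_apply (Suc k) (cycle_op q (Suc k) k) (\<lambda>K. if K = J then 1 else 0) (I @ [i])"
    using assms by (simp add: top_apply_def if_distrib[of "\<lambda>x. _ * x"] cong: if_cong)
  also have "\<dots> = (\<Prod>a<k. q powi ord_sgn ((I @ [i]) ! a) i) * (if i # I = J then 1 else 0)"
    using assms by (subst top_apply_cycle_op) (simp_all add: nth_append)
  also have "(\<Prod>a<k. q powi ord_sgn ((I @ [i]) ! a) i) = (\<Prod>a<k. q powi ord_sgn (I ! a) i)"
    using assms by (intro prod.cong refl) (simp add: nth_append)
  finally show ?thesis by auto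
qed

context l_operator_algebra
begin

text \<open>
  Iterating the quantum product sums over the paths of indices from \<open>i\<close> to \<open>k\<close>; each intermediate
  index is compared with the first index \<open>i\<close>.
\<close>

lemma qpower_entry:
  "qpower cscale q L (Suc n) z $ i $ k = (\<Sum>I\<in>multi_indices n. cscale (\<Prod>a<n. q powi ord_sgn (I ! a) i)
     (oprod (\<lambda>a. L (q ^ (2 * a) * z) $ ((i # I) ! a) $ ((I @ [k]) ! a)) (Suc n)))"
proof (induction n arbitrary: k)
  case 0
  have "cscale (q powi ord_sgn j i) (mat 1 $ i $ j * L z $ j $ k) = (if j = i then L z $ i $ k else 0)" for j
    by (simp add: mat_def ord_sgn_def)
  then have "qpower cscale q L (Suc 0) z $ i $ k = L z $ i $ k" by (simp add: qmult_def)
  then show ?case by (simp add: multi_indices_def)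
next
  case (Suc n)
  let ?p = "\<lambda>I k. oprod (\<lambda>a. L (q ^ (2 * a) * z) $ ((i # I) ! a) $ ((I @ [k]) ! a))"
  let ?c = "\<lambda>n I. \<Prod>a<n. q powi ord_sgn (I ! a) i"
  let ?Z = "L (q ^ (2 * Suc n) * z)"
  have "qpower cscale q L (Suc (Suc n)) z $ i $ k
      = (\<Sum>j\<in>UNIV. cscale (q powi ord_sgn j i) (qpower cscale q L (Suc n) z $ i $ j * ?Z $ j $ k))"
    by (subst qpower.simps(2)) (simp add: qmult_def)
  also have "\<dots> = (\<Sum>j\<in>UNIV. \<Sum>I\<in>multi_indices n. cscale (?c n I * q powi ord_sgn j i) (?p I j (Suc n) * ?Z $ j $ k))"
    unfolding Suc.IH sum_distrib_right scale_sum_right by (simp add: cscale_mult_left mult.commute)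
  also have "\<dots> = (\<Sum>I\<in>multi_indices n. \<Sum>j\<in>UNIV. cscale (?c n I * q powi ord_sgn j i) (?p I j (Suc n) * ?Z $ j $ k))"
    by (rule sum.swap)
  also have "\<dots> = (\<Sum>I\<in>multi_indices n. \<Sum>j\<in>UNIV. cscale (?c (Suc n) (I @ [j])) (?p (I @ [j]) k (Suc (Suc n))))"
  proof (intro sum.cong refl)
    fix I :: "'n list" and j assume "I \<in> multi_indices n"
    then have I: "length I = n" by simp
    have coeff: "?c (Suc n) (I @ [j]) = ?c n I * q powi ord_sgn j i"
      using I by (simp add: nth_append)
    have path: "?p (I @ [j]) k (Suc n) = ?p I j (Suc n)"
    proof (rule oprod_cong)
      fix a assume "a < Suc n"
      then have "(i # I @ [j]) ! a = (i # I) ! a" "((I @ [j]) @ [k]) ! a = (I @ [j]) ! a"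
        using I by (simp_all add: nth_append nth_Cons split: nat.split)
      then show "L (q ^ (2 * a) * z) $ ((i # I @ [j]) ! a) $ (((I @ [j]) @ [k]) ! a)
          = L (q ^ (2 * a) * z) $ ((i # I) ! a) $ ((I @ [j]) ! a)" by simp
    qed
    have ends: "(i # I @ [j]) ! Suc n = j" "((I @ [j]) @ [k]) ! Suc n = k"
      using I by (simp_all add: nth_append)
    show "cscale (?c n I * q powi ord_sgn j i) (?p I j (Suc n) * ?Z $ j $ k)
        = cscale (?c (Suc n) (I @ [j])) (?p (I @ [j]) k (Suc (Suc n)))"
      unfolding coeff oprod.simps(2)[of _ "Suc n"] path ends ..
  qed
  also have "\<dots> = (\<Sum>I\<in>multi_indices (Suc n). cscale (?c (Suc n) I) (?p I k (Suc (Suc n))))"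
    by (rule sum_multi_indices_Suc[symmetric])
  finally show ?case .
qed

text \<open>
  Both sides are sums over closed paths \<open>i, I ! 0, I ! 1, \<dots>, i\<close>: the cycle turns the row index
  \<open>I @ [i]\<close> into \<open>i # I\<close>, and the powers of \<open>q\<close> are the same.
\<close>

lemma I_fun_conv_cycle_trace: "I_fun cscale q L (Suc n) z = cycle_trace (Suc n) z"
proof -
  let ?M = "\<lambda>I i. cscale (\<Prod>a<n. q powi ord_sgn (I ! a) i)
     (oprod (\<lambda>a. L (q ^ (2 * a) * z) $ ((i # I) ! a) $ ((I @ [i]) ! a)) (Suc n))"
  have "cycle_trace (Suc n) z = (\<Sum>I\<in>multi_indices n. \<Sum>i\<in>UNIV. \<Sum>J\<in>multi_indices (Suc n).
      cscale (cycle_op q (Suc n) n (I @ [i]) J) (L_product q L (Suc n) z (Suc n) J (I @ [i])))"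
    unfolding tr_op_def top_trace_def top_mult_def sum_multi_indices_Suc[of _ n] diff_Suc_1
    by (simp only: top_lift_def cscale_one_mult)
  also have "\<dots> = (\<Sum>I\<in>multi_indices n. \<Sum>i\<in>UNIV. ?M I i)"
  proof (intro sum.cong refl)
    fix I :: "'n list" and i assume "I \<in> multi_indices n"
    then have I: "length I = n" by simp
    have "cscale (cycle_op q (Suc n) n (I @ [i]) J) (L_product q L (Suc n) z (Suc n) J (I @ [i]))
        = (if J = i # I then ?M I i else 0)" if J: "length J = Suc n" for J
      unfolding cycle_op_entry[OF I J] using I J
      by (subst L_product_entry) (simp_all del: oprod.simps)
    then have "(\<Sum>J\<in>multi_indices (Suc n). cscale (cycle_op q (Suc n) n (I @ [i]) J) (L_product q L (Suc n) z (Suc n) J (I @ [i])))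
        = (\<Sum>J\<in>multi_indices (Suc n). if J = i # I then ?M I i else 0)"
      by (intro sum.cong refl) simp
    also have "\<dots> = ?M I i" using I by (subst sum.delta) simp_all
    finally show "(\<Sum>J\<in>multi_indices (Suc n). cscale (cycle_op q (Suc n) n (I @ [i]) J) (L_product q L (Suc n) z (Suc n) J (I @ [i])))
        = ?M I i" .
  qed
  also have "\<dots> = (\<Sum>i\<in>UNIV. \<Sum>I\<in>multi_indices n. ?M I i)" by (rule sum.swap)
  also have "\<dots> = I_fun cscale q L (Suc n) z"
    unfolding I_fun_def trace_def qpower_entry ..
  finally show ?thesis ..
qed

section \<open>Commutativity for generic parameters\<close>

lemma generic_pair_imp_separated:
  assumes "generic_pair q z w" "w \<noteq> 0" shows "separated z w"
  unfolding separated_def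
proof (intro allI notI)
  fix s t assume eq: "q ^ (2 * s) * z = q ^ (2 * t) * w"
  have "z / w = q powi (2 * (int t - int s))"
    using eq q_nonzero assms(2)
    by (simp add: right_diff_distrib power_int_diff field_simps flip: power_int_of_nat)
  then show False
    using assms(1)[unfolded generic_pair_def, rule_format, of "int t - int s"] by contradiction
qed

lemma scalar_op_cycle_op_commute:
  assumes "s + n \<le> m" "n \<ge> 1" and U: "\<And>a. s \<le> a \<Longrightarrow> a + 1 < s + n \<Longrightarrow> Pop m a * U = U * Pop m a"
  shows "scalar_op m [s..<s + n] (cycle_op q n (n - 1)) * U = U * scalar_op m [s..<s + n] (cycle_op q n (n - 1))"
proof -
  have "oprod_rev (\<lambda>i. Pop m (s + i)) (n - 1) \<in> {X. X * U = U * X}"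
  proof (rule oprod_rev_closed, goal_cases)
    case (2 X Y)
    then have X: "X * U = U * X" and Y: "Y * U = U * Y" by auto
    have "X * Y * U = X * U * Y" by (simp only: mult.assoc Y)
    then show ?case by (simp add: X mult.assoc)
  qed (use U in auto)
  then have c: "oprod_rev (\<lambda>i. Pop m (s + i)) (n - 1) * U = U * oprod_rev (\<lambda>i. Pop m (s + i)) (n - 1)" by simp
  have "n - 1 = 0 \<or> n - 1 < n" by auto
  note cyc = scalar_op_cycle_op[OF assms(1) this]
  let ?O = "oprod_rev (\<lambda>i. Pop m (s + i)) (n - 1)"
  have "blk_unit m * ?O * U = blk_unit m * (U * ?O)" by (simp only: mult.assoc c)
  also have "\<dots> = U * (blk_unit m * ?O)" by (simp only: mult.assoc[symmetric] blk_unit_central[of m U])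
  finally show ?thesis unfolding cyc .
qed

lemma scalar_op_anti_op_commute:
  assumes m: "s + n \<le> m" and U: "\<And>a. s \<le> a \<Longrightarrow> a + 1 < s + n \<Longrightarrow> Pop m a * U = U * Pop m a"
  shows "scalar_op m [s..<s + n] (anti_op n) * U = U * scalar_op m [s..<s + n] (anti_op n)"
proof -
  have "pi_at m s n \<tau> * U = U * pi_at m s n \<tau>" if "\<tau> permutes {..<n}" for \<tau>
    using that
  proof (induction rule: permutes_adjacent_induct)
    case id
    show ?case by (simp only: pi_at_id blk_unit_central)
  next
    case (swap a \<sigma>)
    let ?s = "Transposition.transpose a (a + 1)"
    have "?s permutes {..<n}" using swap by (intro permutes_swap_id) auto
    then have "pi_at m s n (\<sigma> \<circ> ?s) = pi_at m s n \<sigma> * Pop m (s + a)"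
      using swap(1,2) m by (simp only: perm_rep.rep_comp[OF perm_rep_pi_at[OF m]] pi_at_adjacent)
    moreover have "Pop m (s + a) * U = U * Pop m (s + a)" using U swap(1) by simp
    ultimately show ?case using swap.IH by (metis mult.assoc)
  qed
  then have "of_int c * pi_at m s n \<tau> * U = U * (of_int c * pi_at m s n \<tau>)" if "\<tau> permutes {..<n}" for \<tau> c
    using that by (metis mult.assoc mult_of_int_commute)
  then show ?thesis
    unfolding scalar_op_anti_op[OF m] perm_rep.anti_def[OF perm_rep_pi_at[OF m]] sum_distrib_left sum_distrib_right
    by (intro sum.cong) auto
qed

lemma anti_trace_commute_iff:
  "anti_trace n z * y = y * anti_trace n z \<longleftrightarrow> t_fun cscale q L n z * y = y * t_fun cscale q L n z"
proof -
  have "anti_trace n z * y = of_nat (fact n) * (t_fun cscale q L n z * y)"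
    by (simp add: tr_op_anti_op mult.assoc)
  moreover have "y * anti_trace n z = of_nat (fact n) * (y * t_fun cscale q L n z)"
    unfolding tr_op_anti_op by (metis mult.assoc mult_of_nat_commute)
  ultimately show ?thesis
    using of_nat_mult_cancel[of "fact n" "t_fun cscale q L n z * y" "y * t_fun cscale q L n z"] by auto
qed

text \<open>
  For \<open>q\<^sup>2 \<noteq> 1\<close> the Newton identities are used twice: with the traces of antisymmetrizers at
  shifted parameters as commuting elements, and then with a trace of a cycle.
\<close>

proposition commute_generic:
  assumes kl: "k \<ge> 1" "l \<ge> 1" and zw: "separated z w" "z \<noteq> 0" "w \<noteq> 0"
  shows "I_fun cscale q L k z * I_fun cscale q L l w = I_fun cscale q L l w * I_fun cscale q L k z
    \<and> I_fun cscale q L k z * t_fun cscale q L l w = t_fun cscale q L l w * I_fun cscale q L k z"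
proof -
  have I: "I_fun cscale q L n x = cycle_trace n x" if "n \<ge> 1" for n x
    using that I_fun_conv_cycle_trace[of "n - 1"] by simp
  have "cycle_trace k z * cycle_trace l w = cycle_trace l w * cycle_trace k z
      \<and> cycle_trace k z * anti_trace l w = anti_trace l w * cycle_trace k z"
  proof (cases "q\<^sup>2 = 1")
    case True
    note comm = tr_op_commute_diagonal[OF True zw, of "k + l" k l]
    have "cycle_trace k z * cycle_trace l w = cycle_trace l w * cycle_trace k z"
      using scalar_op_cycle_op_commute[of 0 k "k + l"] scalar_op_cycle_op_commute[of k l "k + l"] kl by (intro comm) auto
    moreover have "cycle_trace k z * anti_trace l w = anti_trace l w * cycle_trace k z"
      using scalar_op_cycle_op_commute[of 0 k "k + l"] scalar_op_anti_op_commute[of k l "k + l"] kl by (intro comm) auto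
    ultimately show ?thesis ..
  next
    case q2: False
    have tt: "anti_trace i (q ^ (2 * s) * z) * anti_trace j (q ^ (2 * t) * w)
        = anti_trace j (q ^ (2 * t) * w) * anti_trace i (q ^ (2 * s) * z)" for i j s t
      using zw q_nonzero by (intro tr_op_anti_op_commute[OF q2 separated_power]) auto
    have It: "cycle_trace k z * anti_trace j (q ^ (2 * t) * w) = anti_trace j (q ^ (2 * t) * w) * cycle_trace k z" for j t
      using cycle_trace_commute[OF q2 zw(2) kl(1) tt, of 0] by simp
    have "cycle_trace l w * cycle_trace k z = cycle_trace k z * cycle_trace l w"
      using cycle_trace_commute[OF q2 zw(3) kl(2) It[symmetric], of 0] by simp
    then show ?thesis using It[of l 0] by simp
  qed
  then show ?thesis
    using anti_trace_commute_iff[of l w "cycle_trace k z"] unfolding I[OF kl(1)] I[OF kl(2)] by metis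
qed

end

section \<open>Extension to all values of the parameters\<close>

lemma parameter_functionsD:
  assumes "parameter_functions F"
  shows "(\<lambda>_. r) \<in> F"
    and "f \<in> F \<Longrightarrow> g \<in> F \<Longrightarrow> (\<lambda>u. f u + g u) \<in> F"
    and "f \<in> F \<Longrightarrow> g \<in> F \<Longrightarrow> (\<lambda>u. f u * g u) \<in> F"
    and "f \<in> F \<Longrightarrow> c \<noteq> 0 \<Longrightarrow> (\<lambda>u. f (c * u)) \<in> F"
    and "f \<in> F \<Longrightarrow> countable {u. u \<noteq> 0 \<and> f u \<noteq> 0} \<Longrightarrow> u \<noteq> 0 \<Longrightarrow> f u = 0"
proof -
  note F = assms[unfolded parameter_functions_def]
  show "(\<lambda>_. r) \<in> F"
    by (rule F[THEN conjunct1, rule_format])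
  show "f \<in> F \<Longrightarrow> g \<in> F \<Longrightarrow> (\<lambda>u. f u + g u) \<in> F"
    by (rule F[THEN conjunct2, THEN conjunct1, rule_format, THEN conjunct1])
  show "f \<in> F \<Longrightarrow> g \<in> F \<Longrightarrow> (\<lambda>u. f u * g u) \<in> F"
    by (rule F[THEN conjunct2, THEN conjunct1, rule_format, THEN conjunct2])
  show "f \<in> F \<Longrightarrow> c \<noteq> 0 \<Longrightarrow> (\<lambda>u. f (c * u)) \<in> F"
    by (rule F[THEN conjunct2, THEN conjunct2, THEN conjunct1, rule_format])
  show "f \<in> F \<Longrightarrow> countable {u. u \<noteq> 0 \<and> f u \<noteq> 0} \<Longrightarrow> u \<noteq> 0 \<Longrightarrow> f u = 0"
    by (rule F[THEN conjunct2, THEN conjunct2, THEN conjunct2, rule_format])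
qed

context complex_algebra
begin

text \<open>
  As a function of its parameter, \<open>I_fun\<close> is a polynomial in dilations of the entries of \<open>L\<close>.
\<close>

lemma qpower_parameter_functions:
  fixes L :: "complex \<Rightarrow> 'a^'n::{finite,linorder}^'n::{finite,linorder}"
  assumes F: "parameter_functions F" and q: "q \<noteq> 0" and L: "\<And>i j. (\<lambda>u. L u $ i $ j) \<in> F"
  shows "(\<lambda>u. qpower cscale q L m u $ i $ j) \<in> F"
proof -
  note const = parameter_functionsD(1)[OF F] and add = parameter_functionsD(2)[OF F]
    and mult = parameter_functionsD(3)[OF F] and dilate = parameter_functionsD(4)[OF F]
  have sum: "(\<lambda>u. \<Sum>x\<in>A. f x u) \<in> F" if "\<And>x. x \<in> A \<Longrightarrow> f x \<in> F" for A :: "'n set" and f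
    using that by (induction A rule: infinite_finite_induct) (auto simp: const add)
  show ?thesis
  proof (induction m arbitrary: j)
    case 0
    show ?case by (simp add: const)
  next
    case (Suc m)
    have dil: "(\<lambda>u. L (q ^ (2 * m) * u) $ a $ b) \<in> F" for a b
      by (rule dilate[OF L]) (simp add: q)
    have "(\<lambda>u. cscale (q powi ord_sgn a i) 1 * (qpower cscale q L m u $ i $ a * L (q ^ (2 * m) * u) $ a $ j)) \<in> F" for a
      by (rule mult[OF const mult[OF Suc.IH dil]])
    then have "(\<lambda>u. \<Sum>a\<in>UNIV. cscale (q powi ord_sgn a i) 1 * (qpower cscale q L m u $ i $ a * L (q ^ (2 * m) * u) $ a $ j)) \<in> F"
      by (rule sum)
    then show ?case by (simp add: qmult_def cscale_one_mult)
  qed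
qed

text \<open>
  The commutator with a fixed \<open>y\<close>, as a function of the parameter, vanishes outside the countable
  set \<open>q\<^sup>2\<^sup>\<int> w\<close>.
\<close>

lemma I_fun_commute_all:
  fixes L :: "complex \<Rightarrow> 'a^'n::{finite,linorder}^'n::{finite,linorder}"
  assumes reg: "regular_dependence L" and q: "q \<noteq> 0" and w: "w \<noteq> 0" and z: "z \<noteq> 0"
    and separated: "\<And>u. u \<noteq> 0 \<Longrightarrow> generic_pair q u w \<Longrightarrow> I_fun cscale q L k u * y = y * I_fun cscale q L k u"
  shows "I_fun cscale q L k z * y = y * I_fun cscale q L k z"
proof -
  obtain F where F: "parameter_functions F" and L: "\<And>i j. (\<lambda>u. L u $ i $ j) \<in> F"
    using reg unfolding regular_dependence_def by blast
  note const = parameter_functionsD(1)[OF F] and add = parameter_functionsD(2)[OF F]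
    and mult = parameter_functionsD(3)[OF F]
  have "(\<lambda>u. \<Sum>i\<in>A. qpower cscale q L k u $ i $ i) \<in> F" for A :: "'n set"
    by (induction A rule: infinite_finite_induct) (auto simp: const intro!: add qpower_parameter_functions[OF F q L])
  then have I: "(\<lambda>u. I_fun cscale q L k u) \<in> F" by (simp add: I_fun_def trace_def)
  define f where "f u = I_fun cscale q L k u * y + - 1 * (y * I_fun cscale q L k u)" for u
  have "f \<in> F" unfolding f_def[abs_def] by (intro add mult const I)
  moreover have "countable {u. u \<noteq> 0 \<and> f u \<noteq> 0}"
  proof (rule countable_subset)
    show "{u. u \<noteq> 0 \<and> f u \<noteq> 0} \<subseteq> range (\<lambda>s::int. q powi (2 * s) * w)"
    proof
      fix u assume "u \<in> {u. u \<noteq> 0 \<and> f u \<noteq> 0}"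
      then have "\<not> generic_pair q u w" using separated[of u] by (auto simp: f_def)
      then obtain s :: int where "u / w = q powi (2 * s)" by (auto simp: generic_pair_def)
      then have "u = q powi (2 * s) * w" using w by (simp add: field_simps)
      then show "u \<in> range (\<lambda>s::int. q powi (2 * s) * w)" by blast
    qed
  qed simp
  ultimately have "f z = 0" using parameter_functionsD(5)[OF F _ _ z] by blast
  then show ?thesis by (simp add: f_def)
qed

end

theorem theorem6p6:
  fixes cscale :: "complex \<Rightarrow> 'a::ring_1 \<Rightarrow> 'a"
    and q z w :: complex
    and L :: "complex \<Rightarrow> 'a^'n::{finite,linorder}^'n::{finite,linorder}"
    and k l :: nat
  assumes "complex_algebra cscale"
    and "q \<noteq> 0"
    and "L_operator cscale q L"
    and "k \<ge> 1" and "l \<ge> 1"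
    and "z \<noteq> 0" and "w \<noteq> 0"
    and "generic_pair q z w \<or> regular_dependence L"
  shows "I_fun cscale q L k z * I_fun cscale q L l w = I_fun cscale q L l w * I_fun cscale q L k z
    \<and> I_fun cscale q L k z * t_fun cscale q L l w = t_fun cscale q L l w * I_fun cscale q L k z"
proof -
  interpret l_operator_algebra cscale q L
    using assms(1-3) by (simp add: l_operator_algebra_def l_operator_algebra_axioms_def)
  have generic: "I_fun cscale q L k u * I_fun cscale q L l w = I_fun cscale q L l w * I_fun cscale q L k u
    \<and> I_fun cscale q L k u * t_fun cscale q L l w = t_fun cscale q L l w * I_fun cscale q L k u"
    if "u \<noteq> 0" "generic_pair q u w" for u
    using assms(4,5,7) that by (intro commute_generic generic_pair_imp_separated)
  show ?thesis
    using assms(8)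
  proof
    assume "generic_pair q z w"
    then show ?thesis by (rule generic[OF assms(6)])
  next
    assume "regular_dependence L"
    then show ?thesis
      using generic I_fun_commute_all[OF _ assms(2,7,6)] by blast
  qed
qed

end
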